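(* Let $n\ge 2$ be an integer and let $0<C<+\infty$ be fixed. For $R\ne 0$ let $g_R=g_{R,C}$ denote the solution of the profile equation $$\frac{g''}{1+(g')^2}=\Big(\frac r2-\frac{n-1}{r}\Big)g'-\frac g2,\qquad g(R)=0,\quad g'(R)=C .$$ (a) Suppose that for some $R\in(-\infty,-\sqrt{2n})$ the solution $g_R$ satisfies $$\eta=(1+(g_R')^2)\Big(\frac{n-1}{r^2}+\frac12\Big)+2\Big[\Big(\frac r2-\frac{n-1}{r}\Big)-\Big(\frac R2-\frac{n-1}{R}\Big)\Big]g_R'g_R''\ \ge\ 0$$ on the portion from the initial point $r=R$ to the horizontal point of $g_R$, i.e. on the portion where $g_R\ge 0$ and $g_R'\ge0$. Then the curve $L_1$ of horizontal points of the solutions $g_{\tilde R}$, $\tilde R\in(-\infty,-\sqrt{2n})$, is monotone increasing at $R$. (b) If $R\in(0,\sqrt{2(n-1)})$ and the solution $g_R$ satisfies the same inequality $\eta\ge0$ on the portion from the initial point to its horizontal point, then the curve $L_2$ of horizontal points of the solutions $g_{\tilde R}$, $\tilde R\in(0,\sqrt{2(n-1)})$, is monotone increasing at $R$. (c) Moreover, if for all sufficiently large $C>0$ the solutions $g_{R,C}$ satisfy the strict inequality $\eta>0$ on the corresponding portion, then the same monotonicity conclusion (at $R$, for $L_1$, respectively $L_2$) holds in the limiting case $C=+\infty$, i.e. for the curves of horizontal points of the solutions with $g(\tilde R)=0$, $g'(\tilde R)=+\infty$.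
   Context: The profile equation is that of rotationally symmetric self-shrinkers in $\mathbb R^{n+1}$, with profile curve written as a graph $x=g(r)$ and rotated about the $x$-axis. The equation is also considered for $r<0$ by formal extension (it is invariant under $r\mapsto -r$). The initial condition $g'(R)=+\infty$ means that $g$ is defined to the right of $R$, is continuous at $R$, and $g'(r)\to+\infty$ as $r\to R^+$. Only the portion $r\geq R$ (for $R<0$, inside $r<0$) of a solution starting at $R$ on which $g\ge0$ and $g'\ge0$ is considered. A horizontal point of $g$ is a point of its graph where $g'=0$. For the solution $g_R$, the horizontal point ending the portion just described is denoted $(\bar R,g_R(\bar R))$, with $\bar R>R$ and $g_R'(\bar R)=0$. For a given initial slope $C\in(0,+\infty]$, $L_1$ denotes the curve formed by the horizontal points $(\bar R,g_R(\bar R))$ for $R\in(-\infty,-\sqrt{2n})$, and $L_2$ the curve formed by the horizontal points for $R\in(0,\sqrt{2(n-1)})$. Monotonicity: $L_1$ is called monotone increasing at $R\in(-\infty,-\sqrt{2n})$ if there is an interval $I_R\subset(-\infty,-\sqrt{2n})$ containing $R$ (a neighbourhood of $R$) such that for all $R_1,R_2\in I_R$, $$R_2>R_1\ \Rightarrow\ \bar R_2>\bar R_1\ \text{ and }\ g_{R_2}(\bar R_2)>g_{R_1}(\bar R_1).$$ The definition for $L_2$ is the same with $(-\infty,-\sqrt{2n})$ replaced by $(0,\sqrt{2(n-1)})$. *)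

theory Defs
  imports "HOL-Analysis.Analysis"
begin

definition profile_drift :: "nat \<Rightarrow> real \<Rightarrow> real" where
  "profile_drift n r = r / 2 - (real n - 1) / r"

text \<open>
  The profile equation on \<open>S\<close>.  It is used with open \<open>S\<close> only, so that \<^const>\<open>deriv\<close> is the ordinary
  derivative.  The singular point \<open>0\<close> is excluded explicitly because \<open>x / 0 = 0\<close> would otherwise
  give the equation an unintended meaning there; an interval of solution therefore stays on one
  side of \<open>0\<close>.
\<close>

definition solves_profile_equation_on :: "nat \<Rightarrow> real set \<Rightarrow> (real \<Rightarrow> real) \<Rightarrow> bool" where
  "solves_profile_equation_on n S g \<longleftrightarrow>
    (\<forall>r\<in>S. r \<noteq> 0 \<and> g field_differentiable at r \<and> deriv g field_differentiable at r \<and>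
      deriv (deriv g) r / (1 + (deriv g r)\<^sup>2) = profile_drift n r * deriv g r - g r / 2)"

text \<open>
  \<open>g\<close> solves the initial value problem \<open>g(R) = 0\<close>, \<open>g'(R) = C\<close> up to (but excluding) \<open>b\<close>.  For
  \<open>C = \<infinity>\<close> the solution lives to the right of \<open>R\<close> only, where it is continuous up to \<open>R\<close>.
  For finite \<open>C\<close> the solution is regular at \<open>R\<close> and is taken on a neighbourhood of \<open>R\<close>, so that
  the first and second derivative make sense at \<open>R\<close> itself.
\<close>

definition profile_solution :: "nat \<Rightarrow> ereal \<Rightarrow> real \<Rightarrow> real \<Rightarrow> (real \<Rightarrow> real) \<Rightarrow> bool" where
  "profile_solution n C R b g \<longleftrightarrow>
    R < b \<and> g R = 0 \<and>
    (case C of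
       ereal c \<Rightarrow> (\<exists>a<R. solves_profile_equation_on n {a<..<b} g) \<and> deriv g R = c
     | PInfty \<Rightarrow> solves_profile_equation_on n {R<..<b} g \<and>
         continuous (at_right R) g \<and> filterlim (deriv g) at_top (at_right R)
     | MInfty \<Rightarrow> False)"

text \<open>
  \<open>g\<close> is the solution starting at \<open>R\<close> with slope \<open>C\<close>, and \<open>\<rho>\<close> is the abscissa of the horizontal
  point ending the portion on which \<open>g \<ge> 0\<close> and \<open>g' \<ge> 0\<close>.  For \<open>C > 0\<close> there is at most one such \<open>\<rho>\<close>: at the
  first zero of \<open>g'\<close> one has \<open>g > 0\<close>, hence \<open>g'' = - g / 2 < 0\<close>, so \<open>g'\<close> becomes
  negative immediately afterwards.
\<close>

definition horizontal_portion :: "nat \<Rightarrow> ereal \<Rightarrow> real \<Rightarrow> (real \<Rightarrow> real) \<Rightarrow> real \<Rightarrow> bool" where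
  "horizontal_portion n C R g \<rho> \<longleftrightarrow>
    R < \<rho> \<and> (\<exists>b>\<rho>. profile_solution n C R b g) \<and>
    (\<forall>r\<in>{R<..\<rho>}. 0 \<le> g r \<and> 0 \<le> deriv g r) \<and> deriv g \<rho> = 0"

definition profile_eta :: "nat \<Rightarrow> real \<Rightarrow> (real \<Rightarrow> real) \<Rightarrow> real \<Rightarrow> real" where
  "profile_eta n R g r =
    (1 + (deriv g r)\<^sup>2) * ((real n - 1) / r\<^sup>2 + 1 / 2)
    + 2 * (profile_drift n r - profile_drift n R) * deriv g r * deriv (deriv g) r"

text \<open>
  The curve of the horizontal points \<open>(\<rho>, g \<rho>)\<close> of the solutions with starting points in \<open>J\<close> is
  monotone increasing at \<open>R\<close>.  Not every solution has a horizontal point when \<open>C\<close> is finite, so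
  their existence for all starting points near \<open>R\<close> is made part of the notion.
\<close>

definition horizontal_curve_increasing_at :: "nat \<Rightarrow> ereal \<Rightarrow> real set \<Rightarrow> real \<Rightarrow> bool" where
  "horizontal_curve_increasing_at n C J R \<longleftrightarrow>
    (\<exists>a b. R \<in> {a<..<b} \<and> {a<..<b} \<subseteq> J \<and>
      (\<forall>R'\<in>{a<..<b}. \<exists>g \<rho>. horizontal_portion n C R' g \<rho>) \<and>
      (\<forall>R1\<in>{a<..<b}. \<forall>R2\<in>{a<..<b}. \<forall>g1 \<rho>1 g2 \<rho>2.
        horizontal_portion n C R1 g1 \<rho>1 \<and> horizontal_portion n C R2 g2 \<rho>2 \<and> R1 < R2
        \<longrightarrow> \<rho>1 < \<rho>2 \<and> g1 \<rho>1 < g2 \<rho>2))"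

definition L1_range :: "nat \<Rightarrow> real set" where
  "L1_range n = {..< - sqrt (2 * real n)}"

definition L2_range :: "nat \<Rightarrow> real set" where
  "L2_range n = {0 <..< sqrt (2 * (real n - 1))}"

end

theory Submission
  imports Defs "HOL-Real_Asymp.Real_Asymp"
begin

text \<open>
  Differentiate the solutions with respect to the starting point \<open>R\<close> and let \<open>w\<close> be the variation
  of the translates \<open>t \<mapsto> g\<^sub>R (R + t)\<close>.  Put \<open>p\<close> for the drift, \<open>q = p(r) - p(R)\<close>, \<open>A = 1 + g'\<^sup>2\<close>,
  \<open>z = w' / A - q g'\<close> and \<open>v = A q g - w\<close>.  Since \<open>\<eta> = (A q)'\<close>, the linearized equation becomes
  \<open>z' = p A z + v / 2\<close>, \<open>v' = \<eta> g - A z\<close> with zero initial values.  Its comparison with the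
  homogeneous solution \<open>(Z, V)\<close> given by the variation of \<open>g\<^sub>R\<close> itself is a Sturm argument: while
  \<open>Z > 0\<close>, the Wronskian \<open>z V - v Z\<close> is nonpositive, so \<open>z / Z\<close> increases and \<open>z \<ge> 0\<close>; but
  \<open>Z = z + g / 2 - p(R) g'\<close> and \<open>p(R) < 0\<close>, so \<open>Z\<close> never vanishes.  Now \<open>z \<ge> 0\<close> gives \<open>w > 0\<close>
  at the horizontal point, and both coordinates of that point have positive derivative in \<open>R\<close>.

  For slope \<open>\<infinity>\<close> the equation is rewritten as a regular autonomous system, in which solutions and
  linearizations depend continuously on the initial slope; \<open>z \<ge> 0\<close> then passes to the limit, and
  the strict inequalities are recovered from it.
\<close>

section \<open>Ordinary differential equations\<close>

text \<open>As (arctan g')' = g'' / A, the equation is first order for the inclination angle. Let u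
  = dg_R/dR at fixed r. Then Z = u' / A is the variation of the angle and V = -u; they solve the
  homogeneous system because at fixed r the equation does not involve R. The translates have w = u +
  g'. They all start with height 0 and slope C at t = 0, so w and w' vanish there, whence the zero
  initial values of z and v. At the horizontal point g' = 0 and g'' = -g / 2, so the height varies
  at rate u = w and the abscissa at rate -u' / g'' = 2 Z / g = 1 + 2 z / g, which is at least 1.
  That w > 0 is strict comes from the drift: z >= 0 says w' >= A q g', and q > 0 to the right of R.
  In this form positivity survives the limit of infinite slope, where strict inequalities leave only
  weak ones. The hypothesis on \<eta> concerns the single starting point R, while monotonicity at R
  compares arbitrary R1 < R2 near R. A derivative at R does not suffice for this; strict
  differentiability of the flow does, together with the existence of horizontal points for all
  nearby starts.\<close>

text \<open>The square of the norm is differentiable also where u vanishes. The function exp(-M t)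
  |u|^2 - e^2 t decreases for M = 2 L + 1: the additional 1 pays for the cross term, by 2 e |u| <=
  |u|^2 + e^2. With e = 0 this gives uniqueness and stability, with e the linearization error it
  controls difference quotients.\<close>

lemma gronwall_inhomogeneous:
  fixes u :: "real \<Rightarrow> 'a::real_inner"
  assumes cont: "continuous_on {0..T} u"
    and deriv: "\<And>t. t \<in> {0<..<T} \<Longrightarrow> (u has_vector_derivative u' t) (at t)"
    and bound: "\<And>t. t \<in> {0<..<T} \<Longrightarrow> norm (u' t) \<le> L * norm (u t) + e"
    and t: "t \<in> {0..T}"
    and L: "0 \<le> L" and e: "0 \<le> e"
  shows "(norm (u t))\<^sup>2 \<le> exp ((2 * L + 1) * t) * ((norm (u 0))\<^sup>2 + e\<^sup>2 * t)"
proof -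
  define M where "M = 2 * L + 1"
  define f where "f = (\<lambda>t. exp (- M * t) * (u t \<bullet> u t) - e\<^sup>2 * t)"
  have contf: "continuous_on {0..t} f"
    unfolding f_def using t by (auto intro!: continuous_intros continuous_on_subset[OF cont])
  have "f t \<le> f 0"
  proof (rule DERIV_nonpos_imp_decreasing_open[OF _ _ contf])
    show "0 \<le> t" using t by simp
  next
    fix s assume s: "0 < s" "s < t"
    then have sT: "s \<in> {0<..<T}" using t by auto
    have du: "((\<lambda>s. u s \<bullet> u s) has_real_derivative 2 * (u s \<bullet> u' s)) (at s)"
      using deriv[OF sT] unfolding has_vector_derivative_def has_field_derivative_def
      by (auto intro!: derivative_eq_intros simp: inner_commute)
    let ?d = "exp (- M * s) * (2 * (u s \<bullet> u' s) - M * (u s \<bullet> u s)) - e\<^sup>2"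
    have "(f has_real_derivative ?d) (at s)"
      unfolding f_def by (auto intro!: derivative_eq_intros du simp: algebra_simps)
    moreover have "?d \<le> 0"
    proof -
      have "u s \<bullet> u' s \<le> norm (u s) * norm (u' s)" by (rule norm_cauchy_schwarz)
      also have "\<dots> \<le> norm (u s) * (L * norm (u s) + e)"
        by (rule mult_left_mono[OF bound[OF sT]]) simp
      finally have "2 * (u s \<bullet> u' s) - M * (u s \<bullet> u s) \<le> 2 * e * norm (u s) - (norm (u s))\<^sup>2"
        unfolding M_def by (simp add: power2_norm_eq_inner[symmetric] power2_eq_square algebra_simps)
      also have "\<dots> \<le> e\<^sup>2"
        using zero_le_power2[of "e - norm (u s)"] by (simp add: power2_eq_square algebra_simps)
      finally have "exp (- M * s) * (2 * (u s \<bullet> u' s) - M * (u s \<bullet> u s)) \<le> exp (- M * s) * e\<^sup>2"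
        by (rule mult_left_mono) simp
      also have "\<dots> \<le> 1 * e\<^sup>2"
        by (rule mult_right_mono) (use s L in \<open>auto simp: M_def intro!: mult_nonpos_nonneg\<close>)
      finally show ?thesis by simp
    qed
    ultimately show "\<exists>y. (f has_real_derivative y) (at s) \<and> y \<le> 0" by blast
  qed
  then have "exp (- M * t) * (norm (u t))\<^sup>2 \<le> (norm (u 0))\<^sup>2 + e\<^sup>2 * t"
    by (simp add: f_def power2_norm_eq_inner)
  then have "exp (M * t) * (exp (- M * t) * (norm (u t))\<^sup>2) \<le> exp (M * t) * ((norm (u 0))\<^sup>2 + e\<^sup>2 * t)"
    by (rule mult_left_mono) simp
  then show ?thesis
    by (simp add: M_def[symmetric] mult.assoc[symmetric] exp_minus)
qed

text \<open>Picard iteration on all of {0..T} at once. The fixed point \<phi> stands for exp(-K t)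
  Y(t); with this weight the iteration contracts by |L| / K < 1 / 2, whatever the length T.\<close>

lemma lipschitz_ode_exists:
  fixes f :: "real \<Rightarrow> 'a::euclidean_space \<Rightarrow> 'a"
  assumes T: "0 \<le> T"
    and cont: "continuous_on ({0..T} \<times> UNIV) (\<lambda>(t, y). f t y)"
    and lip: "\<And>t y z. t \<in> {0..T} \<Longrightarrow> norm (f t y - f t z) \<le> L * norm (y - z)"
  obtains Y where "Y 0 = y0"
    "\<And>t. t \<in> {0..T} \<Longrightarrow> (Y has_vector_derivative f t (Y t)) (at t within {0..T})"
proof -
  define K where "K = 2 * \<bar>L\<bar> + 1"
  have K: "K > 0" by (simp add: K_def)
  have lip': "norm (f t y - f t z) \<le> \<bar>L\<bar> * norm (y - z)" if "t \<in> {0..T}" for t y z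
    using lip[OF that, of y z] by (smt (verit) mult_right_mono norm_ge_zero)
  \<comment> \<open>Clamping the time to {0..T} turns a function on the interval into a bounded
    continuous function on the line, so that the fixed point theorem can be used in the complete
    space of these functions.\<close>
  define cl where "cl = (\<lambda>t. max 0 (min T t))"
  have cl: "cl t \<in> {0..T}" for t using T by (auto simp: cl_def)
  have clid: "cl t = t" if "t \<in> {0..T}" for t using that by (auto simp: cl_def)
  have contcl: "continuous_on UNIV cl" unfolding cl_def by (intro continuous_intros)
  have contf: "continuous_on {0..T} (\<lambda>s. f s (w s))" if "continuous_on {0..T} w" for w
  proof -
    have "continuous_on {0..T} ((\<lambda>(t, y). f t y) \<circ> (\<lambda>s. (s, w s)))"
      by (rule continuous_on_compose[OF _ continuous_on_subset[OF cont]])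
        (auto intro!: continuous_intros that)
    then show ?thesis by (simp add: o_def)
  qed
  define g where "g = (\<lambda>(\<phi>::real \<Rightarrow>\<^sub>C 'a) s. f s (exp (K * s) *\<^sub>R \<phi> s))"
  have contg: "continuous_on {0..T} (g \<phi>)" for \<phi>
    unfolding g_def by (rule contf) (intro continuous_intros continuous_on_apply_bcontfun)
  have intg: "g \<phi> integrable_on {0..t}" if "t \<in> {0..T}" for \<phi> t
    by (rule integrable_continuous_real, rule continuous_on_subset[OF contg]) (use that in auto)
  define op where "op = (\<lambda>(\<phi>::real \<Rightarrow>\<^sub>C 'a) t. exp (- K * t) *\<^sub>R (y0 + integral {0..t} (g \<phi>)))"
  have contop: "continuous_on {0..T} (op \<phi>)" for \<phi>
    unfolding op_def
    by (intro continuous_intros indefinite_integral_continuous_1 integrable_continuous_real contg)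
  have opbc: "(\<lambda>t. op \<phi> (cl t)) \<in> bcontfun" for \<phi>
  proof -
    have 1: "continuous_on UNIV (op \<phi> \<circ> cl)"
      by (rule continuous_on_compose[OF contcl continuous_on_subset[OF contop]]) (use cl in auto)
    have "bounded (op \<phi> ` {0..T})"
      by (intro compact_imp_bounded compact_continuous_image contop compact_Icc)
    then have "bounded (range (\<lambda>t. op \<phi> (cl t)))"
      by (rule bounded_subset) (use cl in auto)
    with 1 show ?thesis by (simp add: bcontfun_def o_def)
  qed
  define P where "P = (\<lambda>\<phi>. Bcontfun (\<lambda>t. op \<phi> (cl t)))"
  have P: "P \<phi> t = op \<phi> (cl t)" for \<phi> t
    unfolding P_def by (simp add: Bcontfun_inverse opbc)
  have contr: "dist (P \<phi>) (P \<psi>) \<le> (1 / 2) * dist \<phi> \<psi>" for \<phi> \<psi>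
  proof (rule dist_bound)
    fix t
    define s where "s = cl t"
    have s: "s \<in> {0..T}" using cl s_def by simp
    define d where "d = dist \<phi> \<psi>"
    have d0: "0 \<le> d" by (simp add: d_def)
    have ie: "((\<lambda>u. exp (K * u)) has_integral (exp (K * s) - exp (K * 0)) / K) {0..s}"
    proof -
      have "((\<lambda>u. exp (K * u)) has_integral (exp (K * s) / K - exp (K * 0) / K)) {0..s}"
        by (rule fundamental_theorem_of_calculus)
          (use s K in \<open>auto intro!: derivative_eq_intros simp: has_real_derivative_iff_has_vector_derivative[symmetric]\<close>)
      then show ?thesis by (simp add: diff_divide_distrib)
    qed
    have ie2: "((\<lambda>u. \<bar>L\<bar> * d * exp (K * u)) has_integral \<bar>L\<bar> * d * ((exp (K * s) - exp (K * 0)) / K)) {0..s}"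
      by (rule has_integral_mult_right[OF ie])
    have "norm (integral {0..s} (\<lambda>u. g \<phi> u - g \<psi> u)) \<le> integral {0..s} (\<lambda>u. \<bar>L\<bar> * d * exp (K * u))"
    proof (rule integral_norm_bound_integral)
      show "(\<lambda>u. g \<phi> u - g \<psi> u) integrable_on {0..s}"
        by (intro integrable_diff intg s)
      show "(\<lambda>u. \<bar>L\<bar> * d * exp (K * u)) integrable_on {0..s}" using ie2 by blast
      fix u assume u: "u \<in> {0..s}"
      then have uT: "u \<in> {0..T}" using s by auto
      have "norm (g \<phi> u - g \<psi> u) \<le> \<bar>L\<bar> * norm (exp (K * u) *\<^sub>R \<phi> u - exp (K * u) *\<^sub>R \<psi> u)"
        unfolding g_def by (rule lip'[OF uT])
      also have "norm (exp (K * u) *\<^sub>R \<phi> u - exp (K * u) *\<^sub>R \<psi> u) = exp (K * u) * dist (\<phi> u) (\<psi> u)"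
        by (simp add: scaleR_diff_right[symmetric] dist_norm)
      also have "\<bar>L\<bar> * (exp (K * u) * dist (\<phi> u) (\<psi> u)) \<le> \<bar>L\<bar> * (exp (K * u) * d)"
        by (intro mult_left_mono) (auto simp: d_def dist_bounded)
      finally show "norm (g \<phi> u - g \<psi> u) \<le> \<bar>L\<bar> * d * exp (K * u)" by (simp add: mult_ac)
    qed
    also have "\<dots> = \<bar>L\<bar> * d * ((exp (K * s) - exp (K * 0)) / K)"
      using ie2 by (rule integral_unique)
    also have "\<dots> \<le> \<bar>L\<bar> * d * (exp (K * s) / K)"
      by (intro mult_left_mono divide_right_mono) (use K d0 in auto)
    finally have *: "norm (integral {0..s} (\<lambda>u. g \<phi> u - g \<psi> u)) \<le> (\<bar>L\<bar> / K) * d * exp (K * s)"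
      by (simp add: mult_ac)
    have "dist (P \<phi> t) (P \<psi> t) = exp (- K * s) * norm (integral {0..s} (\<lambda>u. g \<phi> u - g \<psi> u))"
      unfolding P s_def[symmetric] op_def dist_norm
      by (simp add: scaleR_diff_right[symmetric] integral_diff[OF intg[OF s] intg[OF s]])
    also have "\<dots> \<le> exp (- K * s) * ((\<bar>L\<bar> / K) * d * exp (K * s))"
      by (intro mult_left_mono *) simp
    also have "\<dots> = (\<bar>L\<bar> / K) * d * (exp (- K * s) * exp (K * s))" by (simp only: mult_ac)
    also have "exp (- K * s) * exp (K * s) = 1" by (simp add: exp_add[symmetric])
    also have "(\<bar>L\<bar> / K) * d * 1 \<le> (1 / 2) * d"
      using d0 mult_right_mono[of "\<bar>L\<bar> / K" "1 / 2" d] by (simp add: K_def field_simps)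
    finally show "dist (P \<phi> t) (P \<psi> t) \<le> (1 / 2) * dist \<phi> \<psi>" by (simp add: d_def)
  qed
  obtain \<phi> where \<phi>: "P \<phi> = \<phi>"
    using banach_fix_type[of "1 / 2" P] contr by auto
  define Y where "Y = (\<lambda>t. y0 + integral {0..t} (g \<phi>))"
  have Yeq: "exp (K * t) *\<^sub>R \<phi> t = Y t" if "t \<in> {0..T}" for t
  proof -
    have "\<phi> t = op \<phi> t" using P[of \<phi> t] clid[OF that] \<phi> by simp
    then show ?thesis by (simp add: op_def Y_def exp_add[symmetric] scaleR_scaleR)
  qed
  show thesis
  proof
    show "Y 0 = y0" by (simp add: Y_def)
    fix t assume t: "t \<in> {0..T}"
    have "(Y has_vector_derivative g \<phi> t) (at t within {0..T})"
      unfolding Y_def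
      by (auto intro!: derivative_eq_intros integral_has_vector_derivative contg t)
    then show "(Y has_vector_derivative f t (Y t)) (at t within {0..T})"
      by (simp add: g_def Yeq[OF t])
  qed
qed

text \<open>The derivative is required at interior times only, so a curve obtained from a graph with
  vertical initial tangent qualifies without a one-sided derivative at its start. Where such a
  derivative matters it is a separate assumption.\<close>

definition ode_solution :: "('a::real_normed_vector \<Rightarrow> 'a) \<Rightarrow> 'a set \<Rightarrow> real \<Rightarrow> (real \<Rightarrow> 'a) \<Rightarrow> bool" where
  "ode_solution F U T Y \<longleftrightarrow> continuous_on {0..T} Y \<and> Y ` {0..T} \<subseteq> U \<and>
    (\<forall>t\<in>{0<..<T}. (Y has_vector_derivative F (Y t)) (at t))"

lemma ode_solutionI:
  assumes "\<And>t. t \<in> {0..T} \<Longrightarrow> (Y has_vector_derivative F (Y t)) (at t within {0..T})"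
    and "\<And>t. t \<in> {0..T} \<Longrightarrow> Y t \<in> U"
  shows "ode_solution F U T Y"
  unfolding ode_solution_def
proof (intro conjI ballI)
  show "continuous_on {0..T} Y"
    using assms(1) has_vector_derivative_continuous continuous_on_eq_continuous_within by blast
  fix t assume t: "t \<in> {0<..<T}"
  then have "at t within {0..T} = at t" by (intro at_within_interior) simp
  then show "(Y has_vector_derivative F (Y t)) (at t)" using assms(1)[of t] t by auto
qed (use assms(2) in auto)

lemma ode_solution_subinterval:
  "ode_solution F U T Y \<Longrightarrow> T' \<le> T \<Longrightarrow> ode_solution F U T' Y"
  unfolding ode_solution_def
  by (meson atLeastatMost_subset_iff continuous_on_subset dual_order.refl greaterThanLessThan_iff
      image_mono order_less_le_trans subset_trans)

section \<open>The flow of a continuously differentiable vector field: stability and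
  differentiability in the initial value\<close>

locale c1_vector_field =
  fixes F :: "'a::euclidean_space \<Rightarrow> 'a" and F' :: "'a \<Rightarrow> 'a \<Rightarrow>\<^sub>L 'a" and U :: "'a set"
  assumes open_U: "open U"
    and deriv: "\<And>y. y \<in> U \<Longrightarrow> (F has_derivative blinfun_apply (F' y)) (at y)"
    and cont_F': "continuous_on U F'"
begin

lemma cont_F: "continuous_on U F"
  using deriv has_derivative_continuous
  by (metis continuous_at_imp_continuous_on)

text \<open>K need not be convex, so the mean value inequality does not apply to it directly; a
  local Lipschitz condition together with compactness replaces it. The field is autonomous, and the
  time set {0} is only formal.\<close>

lemma compact_lipschitz:
  assumes "compact K" "K \<subseteq> U"
  obtains L where "0 \<le> L" "\<And>x y. x \<in> K \<Longrightarrow> y \<in> K \<Longrightarrow> norm (F x - F y) \<le> L * norm (x - y)"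
proof -
  have "continuous_on (UNIV \<times> U) (F' \<circ> snd)"
    by (rule continuous_on_compose[OF _ continuous_on_subset[OF cont_F']]) (auto intro!: continuous_intros)
  then have "local_lipschitz (UNIV :: real set) U (\<lambda>t. F)"
    by (intro c1_implies_local_lipschitz[of _ _ _ "\<lambda>(t, x). F' x"])
      (auto simp: deriv open_U case_prod_beta o_def)
  then have "local_lipschitz {0::real} K (\<lambda>t. F)"
    by (rule local_lipschitz_subset) (use assms in auto)
  then obtain L where L: "\<And>t. t \<in> {0::real} \<Longrightarrow> L-lipschitz_on K F"
    using local_lipschitz_compact_implies_lipschitz[where X = K and T = "{0::real}" and f = "\<lambda>t. F"] assms(1) by auto
  show thesis
    by (rule that[of L]) (use L[of 0] in \<open>auto simp: lipschitz_on_def dist_norm\<close>)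
qed

lemma ode_solution_unique:
  assumes Y: "ode_solution F U T Y" and Z: "ode_solution F U T Z"
    and eq: "Y 0 = Z 0" and t: "t \<in> {0..T}"
  shows "Y t = Z t"
proof -
  have cY: "continuous_on {0..T} Y" and cZ: "continuous_on {0..T} Z"
    using Y Z by (auto simp: ode_solution_def)
  define K where "K = Y ` {0..T} \<union> Z ` {0..T}"
  have "compact K" unfolding K_def by (intro compact_Un compact_continuous_image cY cZ compact_Icc)
  moreover have "K \<subseteq> U" using Y Z by (auto simp: K_def ode_solution_def)
  ultimately obtain L where L: "0 \<le> L"
    "\<And>x y. x \<in> K \<Longrightarrow> y \<in> K \<Longrightarrow> norm (F x - F y) \<le> L * norm (x - y)"
    using compact_lipschitz[of K] by blast
  have "(norm (Y t - Z t))\<^sup>2 \<le> exp ((2 * L + 1) * t) * ((norm (Y 0 - Z 0))\<^sup>2 + 0\<^sup>2 * t)"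
  proof (rule gronwall_inhomogeneous[where u' = "\<lambda>t. F (Y t) - F (Z t)" and T = T])
    show "continuous_on {0..T} (\<lambda>t. Y t - Z t)" by (intro continuous_intros cY cZ)
  next
    fix s assume "s \<in> {0<..<T}"
    then show "((\<lambda>t. Y t - Z t) has_vector_derivative F (Y s) - F (Z s)) (at s)"
      using Y Z by (auto simp: ode_solution_def intro!: derivative_eq_intros)
  next
    fix s assume "s \<in> {0<..<T}"
    then show "norm (F (Y s) - F (Z s)) \<le> L * norm (Y s - Z s) + 0"
      using L(2)[of "Y s" "Z s"] by (auto simp: K_def)
  qed (use t L in auto)
  then show ?thesis by (simp add: eq)
qed

text \<open>Uniform constants near a compact trajectory. The cross-section of the tube at each time
  is a ball, hence convex, which makes the mean value inequality available there.\<close>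

lemma tube:
  assumes Y: "ode_solution F U T Y"
  obtains r L where "0 < r" "0 \<le> L" "\<And>t. t \<in> {0..T} \<Longrightarrow> cball (Y t) r \<subseteq> U"
    "\<And>t y. t \<in> {0..T} \<Longrightarrow> y \<in> cball (Y t) r \<Longrightarrow> norm (F' y) \<le> L"
    "\<And>e. 0 < e \<Longrightarrow> \<exists>d>0. d \<le> r \<and> (\<forall>t\<in>{0..T}. \<forall>y\<in>cball (Y t) d. norm (F' y - F' (Y t)) \<le> e)"
proof -
  have cY: "continuous_on {0..T} Y" and YU: "Y ` {0..T} \<subseteq> U"
    using Y by (auto simp: ode_solution_def)
  have comp: "compact (Y ` {0..T})" by (intro compact_continuous_image cY compact_Icc)
  obtain r where r: "0 < r" "(\<Union>x\<in>Y ` {0..T}. cball x r) \<subseteq> U"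
    using compact_subset_open_imp_cball_epsilon_subset[OF comp open_U YU] by blast
  \<comment> \<open>The closed tube as a sum of two compact sets, so that \<open>F'\<close> is
    bounded and uniformly continuous on it.\<close>
  define K where "K = {x + d | x d. x \<in> Y ` {0..T} \<and> d \<in> cball 0 r}"
  have "compact K" unfolding K_def by (intro compact_sums comp compact_cball)
  have cb: "cball (Y t) r \<subseteq> K" if "t \<in> {0..T}" for t
  proof
    fix y assume "y \<in> cball (Y t) r"
    then have "y - Y t \<in> cball 0 r" by (simp add: dist_norm norm_minus_commute)
    moreover have "y = Y t + (y - Y t)" by simp
    ultimately show "y \<in> K" unfolding K_def using that by blast
  qed
  have "K \<subseteq> U"
  proof
    fix y assume "y \<in> K"
    then obtain x d where "y = x + d" "x \<in> Y ` {0..T}" "d \<in> cball 0 r" by (auto simp: K_def)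
    then have "y \<in> cball x r" by (simp add: dist_norm)
    with \<open>x \<in> Y ` {0..T}\<close> show "y \<in> U" using r(2) by blast
  qed
  have cK: "continuous_on K F'" by (rule continuous_on_subset[OF cont_F' \<open>K \<subseteq> U\<close>])
  have "bounded (F' ` K)" by (intro compact_imp_bounded compact_continuous_image cK \<open>compact K\<close>)
  then obtain L where L: "0 < L" "\<And>y. y \<in> K \<Longrightarrow> norm (F' y) \<le> L"
    unfolding bounded_pos by auto
  have uc: "uniformly_continuous_on K F'" by (rule compact_uniformly_continuous[OF cK \<open>compact K\<close>])
  show thesis
  proof (rule that[OF r(1) less_imp_le[OF L(1)]])
    show "cball (Y t) r \<subseteq> U" if "t \<in> {0..T}" for t using cb[OF that] \<open>K \<subseteq> U\<close> by auto
    show "norm (F' y) \<le> L" if "t \<in> {0..T}" "y \<in> cball (Y t) r" for t y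
      using cb[OF that(1)] that(2) L(2) by blast
    fix e :: real assume "0 < e"
    then obtain d where d: "0 < d" "\<And>x x'. x \<in> K \<Longrightarrow> x' \<in> K \<Longrightarrow> dist x' x < d \<Longrightarrow> dist (F' x') (F' x) < e"
      using uc unfolding uniformly_continuous_on_def by metis
    show "\<exists>d>0. d \<le> r \<and> (\<forall>t\<in>{0..T}. \<forall>y\<in>cball (Y t) d. norm (F' y - F' (Y t)) \<le> e)"
    proof (intro exI[of _ "min r (d / 2)"] conjI ballI)
      fix t y assume t: "t \<in> {0..T}" and y: "y \<in> cball (Y t) (min r (d / 2))"
      have "y \<in> K" "Y t \<in> K" using cb[OF t] y r(1) by auto
      moreover have "dist y (Y t) < d" using y d(1) by (simp add: dist_commute)
      ultimately have "dist (F' y) (F' (Y t)) < e" using d(2) by blast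
      then show "norm (F' y - F' (Y t)) \<le> e" by (simp add: dist_norm)
    qed (use r(1) d(1) in auto)
  qed
qed

text \<open>The nearest-point projection onto a ball is nonexpansive. Composing \<open>F\<close>
  with it gives a field defined everywhere with a global Lipschitz constant, as
  \<open>lipschitz_ode_exists\<close> demands, and unchanged inside the ball.\<close>

lemma clipped_lipschitz:
  assumes r: "0 < r" and sub: "cball c r \<subseteq> U" and L: "0 \<le> L" "\<And>y. y \<in> cball c r \<Longrightarrow> norm (F' y) \<le> L"
  defines "P \<equiv> \<lambda>y. c + closest_point (cball 0 r) (y - c)"
  shows "norm (F (P y) - F (P z)) \<le> L * norm (y - z)"
proof -
  have in_ball: "P y \<in> cball c r" for y
    using closest_point_in_set[of "cball (0::'a) r" "y - c"] r by (auto simp: P_def dist_norm)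
  have "norm (F (P y) - F (P z)) \<le> L * norm (P y - P z)"
  proof (rule differentiable_bound[of "cball c r" _ "\<lambda>y. blinfun_apply (F' y)"])
    show "(F has_derivative blinfun_apply (F' x)) (at x within cball c r)" if "x \<in> cball c r" for x
      using deriv sub that has_derivative_at_withinI by blast
    show "onorm (blinfun_apply (F' x)) \<le> L" if "x \<in> cball c r" for x
      using L(2)[OF that] by (simp add: norm_blinfun.rep_eq)
  qed (use in_ball in auto)
  also have "norm (P y - P z) \<le> norm (y - z)"
    using closest_point_lipschitz[of "cball (0::'a) r" "y - c" "z - c"] r
    by (simp add: P_def dist_norm)
  finally show ?thesis using L(1) by (simp add: mult_left_mono)
qed

lemma continuous_on_clipped:
  assumes r: "0 < r" and cY: "continuous_on S Y" and sub: "\<And>t. t \<in> S \<Longrightarrow> cball (Y t) r \<subseteq> U"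
  shows "continuous_on (S \<times> UNIV) (\<lambda>(t, y). F (Y t + closest_point (cball 0 r) (y - Y t)))"
proof -
  let ?P = "\<lambda>p. Y (fst p) + closest_point (cball 0 r) (snd p - Y (fst p))"
  have cY': "continuous_on (S \<times> UNIV) (\<lambda>p. Y (fst p))"
    by (rule continuous_on_compose2[OF cY]) (auto intro!: continuous_intros)
  have "continuous_on UNIV (closest_point (cball (0::'a) r))"
    by (rule continuous_on_closest_point) (use r in auto)
  then have "continuous_on (S \<times> UNIV) (\<lambda>p. closest_point (cball 0 r) (snd p - Y (fst p)))"
    by (rule continuous_on_compose2) (auto intro!: continuous_intros cY')
  then have cP: "continuous_on (S \<times> UNIV) ?P" by (intro continuous_intros cY')
  have "?P p \<in> U" if "p \<in> S \<times> UNIV" for p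
  proof -
    have "?P p \<in> cball (Y (fst p)) r"
      using closest_point_in_set[of "cball (0::'a) r" "snd p - Y (fst p)"] r by (auto simp: dist_norm)
    moreover have "cball (Y (fst p)) r \<subseteq> U" by (rule sub) (use that in auto)
    ultimately show ?thesis by blast
  qed
  then have "continuous_on (S \<times> UNIV) (\<lambda>p. F (?P p))"
    by (intro continuous_on_compose2[OF cont_F cP]) auto
  then show ?thesis by (simp add: case_prod_beta)
qed

lemma local_solution:
  assumes "y0 \<in> U"
  obtains T Y where "0 < T" "Y 0 = y0" "\<And>t. t \<in> {0..T} \<Longrightarrow> Y t \<in> U"
    "\<And>t. t \<in> {0..T} \<Longrightarrow> (Y has_vector_derivative F (Y t)) (at t within {0..T})"
proof -
  \<comment> \<open>A trajectory of length 0: its tube is a single ball around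
    \<open>y0\<close>.\<close>
  have "ode_solution F U 0 (\<lambda>t. y0)" using assms by (auto simp: ode_solution_def)
  then obtain r L where r: "0 < r" "0 \<le> L" "cball y0 r \<subseteq> U"
    "\<And>y. y \<in> cball y0 r \<Longrightarrow> norm (F' y) \<le> L"
    by (elim tube) auto
  define f where "f = (\<lambda>(t::real) y. F (y0 + closest_point (cball 0 r) (y - y0)))"
  have "continuous_on ({0..1} \<times> UNIV) (\<lambda>(t, y). f t y)"
    unfolding f_def by (rule continuous_on_clipped) (use r in auto)
  moreover have "norm (f t y - f t z) \<le> L * norm (y - z)" for t y z
    unfolding f_def by (rule clipped_lipschitz) (use r in auto)
  ultimately obtain Y where Y: "Y 0 = y0"
    "\<And>t. t \<in> {0..1} \<Longrightarrow> (Y has_vector_derivative f t (Y t)) (at t within {0..1})"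
    using lipschitz_ode_exists[of 1 f L y0] by (metis zero_le_one)
  have "continuous_on {0..1} Y"
    using Y(2) has_vector_derivative_continuous continuous_on_eq_continuous_within by blast
  then obtain d where d: "0 < d" "\<And>t. t \<in> {0..1} \<Longrightarrow> dist t 0 < d \<Longrightarrow> dist (Y t) (Y 0) < r"
    using r(1) unfolding continuous_on_iff by (metis atLeastAtMost_iff order_refl zero_le_one)
  define T where "T = min 1 (d / 2)"
  have near: "Y t \<in> cball y0 r" if "t \<in> {0..T}" for t
    using d(2)[of t] that d(1) Y(1) by (auto simp: T_def dist_commute less_imp_le)
  show thesis
  proof (rule that)
    show "0 < T" using d(1) by (simp add: T_def)
    show "Y 0 = y0" by fact
    fix t assume t: "t \<in> {0..T}"
    show "Y t \<in> U" using near[OF t] r(3) by auto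
    have "f t (Y t) = F (Y t)"
      using near[OF t] closest_point_self[of "Y t - y0" "cball 0 r"]
      by (simp add: f_def dist_norm norm_minus_commute)
    moreover have "(Y has_vector_derivative f t (Y t)) (at t within {0..T})"
      by (rule has_vector_derivative_within_subset[OF Y(2)]) (use t in \<open>auto simp: T_def\<close>)
    ultimately show "(Y has_vector_derivative F (Y t)) (at t within {0..T})" by simp
  qed
qed

text \<open>The field clipped to a tube around \<open>Y\<close> has a solution on all of {0..T}. By
  Gronwall a solution that starts close to \<open>Y 0\<close> stays strictly inside the tube, so the
  clipping is never active and the original equation is solved.\<close>

lemma nearby_solution:
  assumes T: "0 \<le> T" and Y: "ode_solution F U T Y" and e: "0 < e"
  obtains d where "0 < d"
    "\<And>y. norm (y - Y 0) < d \<Longrightarrow> \<exists>Z. Z 0 = y \<and> ode_solution F U T Z \<and>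
       (\<forall>t\<in>{0..T}. (Z has_vector_derivative F (Z t)) (at t within {0..T}) \<and> norm (Z t - Y t) < e)"
proof -
  obtain r0 L where r0: "0 < r0" "0 \<le> L" "\<And>t. t \<in> {0..T} \<Longrightarrow> cball (Y t) r0 \<subseteq> U"
    "\<And>t y. t \<in> {0..T} \<Longrightarrow> y \<in> cball (Y t) r0 \<Longrightarrow> norm (F' y) \<le> L"
    using tube[OF Y] by metis
  define r where "r = min r0 (e / 2)"
  have r: "0 < r" "r < e" "\<And>t. t \<in> {0..T} \<Longrightarrow> cball (Y t) r \<subseteq> U"
    "\<And>t y. t \<in> {0..T} \<Longrightarrow> y \<in> cball (Y t) r \<Longrightarrow> norm (F' y) \<le> L"
    using r0 e by (force simp: r_def)+
  have cY: "continuous_on {0..T} Y" using Y by (simp add: ode_solution_def)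
  define f where "f = (\<lambda>t y. F (Y t + closest_point (cball 0 r) (y - Y t)))"
  have contf: "continuous_on ({0..T} \<times> UNIV) (\<lambda>(t, y). f t y)"
    unfolding f_def by (rule continuous_on_clipped) (use r cY in auto)
  have lipf: "norm (f t y - f t z) \<le> L * norm (y - z)" if "t \<in> {0..T}" for t y z
    unfolding f_def by (rule clipped_lipschitz) (use r r0(2) that in auto)
  define E where "E = exp ((2 * L + 1) * T)"
  \<comment> \<open>\<open>E\<close> bounds the growth of the squared distance, hence the square
    root.\<close>
  define d where "d = r / sqrt E"
  have E: "0 < E" by (simp add: E_def)
  have "\<exists>Z. Z 0 = y \<and> ode_solution F U T Z \<and>
       (\<forall>t\<in>{0..T}. (Z has_vector_derivative F (Z t)) (at t within {0..T}) \<and> norm (Z t - Y t) < e)"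
    if y: "norm (y - Y 0) < d" for y
  proof -
    obtain Z where Z: "Z 0 = y"
      "\<And>t. t \<in> {0..T} \<Longrightarrow> (Z has_vector_derivative f t (Z t)) (at t within {0..T})"
      by (rule lipschitz_ode_exists[OF T contf lipf, of y]) auto
    have cZ: "continuous_on {0..T} Z"
      using Z(2) has_vector_derivative_continuous continuous_on_eq_continuous_within by blast
    have fY: "f t (Y t) = F (Y t)" for t
      using r(1) closest_point_self[of "0::'a" "cball 0 r"] by (simp add: f_def)
    have close: "norm (Z t - Y t) < r" if t: "t \<in> {0..T}" for t
    proof -
      have "(norm (Z t - Y t))\<^sup>2 \<le> exp ((2 * L + 1) * t) * ((norm (Z 0 - Y 0))\<^sup>2 + 0\<^sup>2 * t)"
      proof (rule gronwall_inhomogeneous[where u' = "\<lambda>t. f t (Z t) - F (Y t)" and T = T])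
        show "continuous_on {0..T} (\<lambda>t. Z t - Y t)" by (intro continuous_intros cY cZ)
      next
        fix s assume s: "s \<in> {0<..<T}"
        then have "at s within {0..T} = at s" by (intro at_within_interior) simp
        then have "(Z has_vector_derivative f s (Z s)) (at s)" using Z(2)[of s] s by auto
        then show "((\<lambda>t. Z t - Y t) has_vector_derivative f s (Z s) - F (Y s)) (at s)"
          using Y s by (auto simp: ode_solution_def intro!: derivative_eq_intros)
      next
        fix s assume "s \<in> {0<..<T}"
        then show "norm (f s (Z s) - F (Y s)) \<le> L * norm (Z s - Y s) + 0"
          using lipf[of s "Z s" "Y s"] fY[of s] by simp
      qed (use t r0(2) in auto)
      also have "\<dots> \<le> E * (norm (y - Y 0))\<^sup>2"
        using t r0(2) by (auto simp: E_def Z(1) intro!: mult_right_mono mult_left_mono)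
      also have "\<dots> < E * d\<^sup>2"
        using y E by (intro mult_strict_left_mono power_strict_mono) auto
      also have "\<dots> = r\<^sup>2" using E by (simp add: d_def power_divide)
      finally show ?thesis using r(1) by (simp add: power_less_imp_less_base)
    qed
    have fZ: "f t (Z t) = F (Z t)" if "t \<in> {0..T}" for t
      using close[OF that] closest_point_self[of "Z t - Y t" "cball 0 r"] by (simp add: f_def)
    have dZ: "(Z has_vector_derivative F (Z t)) (at t within {0..T})" if "t \<in> {0..T}" for t
      using Z(2)[OF that] fZ[OF that] by simp
    have "ode_solution F U T Z"
    proof (rule ode_solutionI[OF dZ])
      fix t assume t: "t \<in> {0..T}"
      have "Z t \<in> cball (Y t) r" using close[OF t] by (simp add: dist_norm norm_minus_commute)
      then show "Z t \<in> U" using r(3)[OF t] by auto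
    qed
    then show ?thesis using Z(1) dZ close r(2) by (intro exI[of _ Z]) force
  qed
  moreover have "0 < d" using r(1) E by (simp add: d_def)
  ultimately show thesis using that by blast
qed

lemma linearized_solution:
  assumes T: "0 \<le> T" and Y: "ode_solution F U T Y"
  obtains X where "X 0 = v" "\<And>t. t \<in> {0..T} \<Longrightarrow> (X has_vector_derivative F' (Y t) (X t)) (at t within {0..T})"
proof -
  obtain r L where r: "0 < r" "\<And>t y. t \<in> {0..T} \<Longrightarrow> y \<in> cball (Y t) r \<Longrightarrow> norm (F' y) \<le> L"
    using tube[OF Y] by metis
  have cY: "continuous_on {0..T} Y" and YU: "Y ` {0..T} \<subseteq> U" using Y by (auto simp: ode_solution_def)
  have "continuous_on {0..T} (\<lambda>t. F' (Y t))"
    by (rule continuous_on_compose2[OF cont_F' cY YU])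
  then have "continuous_on ({0..T} \<times> UNIV) (\<lambda>p. F' (Y (fst p)))"
    by (rule continuous_on_compose2) (auto intro!: continuous_intros)
  then have "continuous_on ({0..T} \<times> UNIV) (\<lambda>(t, x). blinfun_apply (F' (Y t)) x)"
    by (auto simp: case_prod_beta intro!: continuous_intros)
  moreover have "norm (F' (Y t) y - F' (Y t) z) \<le> L * norm (y - z)" if "t \<in> {0..T}" for t y z
  proof -
    have "norm (F' (Y t) (y - z)) \<le> norm (F' (Y t)) * norm (y - z)" by (rule norm_blinfun)
    also have "\<dots> \<le> L * norm (y - z)" using r(2)[OF that, of "Y t"] r(1) by (simp add: mult_right_mono)
    finally show ?thesis by (simp add: blinfun.diff_right)
  qed
  ultimately show thesis
    using lipschitz_ode_exists[OF T, of "\<lambda>t. blinfun_apply (F' (Y t))" L v] that by blast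
qed

text \<open>Both solutions vary near \<open>Y\<close>: this is strict differentiability, which also controls the
  linearizations along neighbouring solutions.\<close>

lemma difference_quotient_bound:
  assumes T: "0 \<le> T" and Y: "ode_solution F U T Y"
    and X: "\<And>t. t \<in> {0..T} \<Longrightarrow> (X has_vector_derivative F' (Y t) (X t)) (at t within {0..T})"
    and e: "0 < e"
  obtains d where "0 < d"
    "\<And>Y1 Y2 h t. ode_solution F U T Y1 \<Longrightarrow> ode_solution F U T Y2 \<Longrightarrow>
       (\<And>t. t \<in> {0..T} \<Longrightarrow> norm (Y1 t - Y t) < d) \<Longrightarrow> (\<And>t. t \<in> {0..T} \<Longrightarrow> norm (Y2 t - Y t) < d) \<Longrightarrow>
       h \<noteq> 0 \<Longrightarrow> Y2 0 - Y1 0 = h *\<^sub>R X 0 \<Longrightarrow> t \<in> {0..T} \<Longrightarrow>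
       norm ((Y2 t - Y1 t) /\<^sub>R h - X t) < e"
proof -
  obtain r L where r: "0 < r" "0 \<le> L" "\<And>t. t \<in> {0..T} \<Longrightarrow> cball (Y t) r \<subseteq> U"
    "\<And>t y. t \<in> {0..T} \<Longrightarrow> y \<in> cball (Y t) r \<Longrightarrow> norm (F' y) \<le> L"
    and osc: "\<And>e. 0 < e \<Longrightarrow> \<exists>d>0. d \<le> r \<and> (\<forall>t\<in>{0..T}. \<forall>y\<in>cball (Y t) d. norm (F' y - F' (Y t)) \<le> e)"
    using tube[OF Y] by metis
  have cX: "continuous_on {0..T} X"
    using X has_vector_derivative_continuous continuous_on_eq_continuous_within by blast
  have "bounded (X ` {0..T})" by (intro compact_imp_bounded compact_continuous_image cX compact_Icc)
  then obtain B where B: "0 < B" "\<And>t. t \<in> {0..T} \<Longrightarrow> norm (X t) \<le> B"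
    unfolding bounded_pos by auto
  define E where "E = exp ((2 * (L + 1) + 1) * T)"
  have E: "1 \<le> E" using T r(2) by (simp add: E_def)
  \<comment> \<open>k bounds the oscillation of \<open>F'\<close> in the tube. The linearization
    error of the quotient D is at most k |D| <= k |D - X| + k B: the bound k <= 1 lets the first
    part be absorbed into the Lipschitz constant L + 1, and the second is the inhomogeneity, small
    enough by \<open>kB\<close>.\<close>
  define k where "k = min 1 (e / (2 * B * E * (T + 1)))"
  have k: "0 < k" "k \<le> 1" using e B E T by (auto simp: k_def)
  have kB: "E * ((k * B)\<^sup>2 * T) < e\<^sup>2"
  proof -
    have "0 < 2 * B * E * (T + 1)" using B(1) E T by simp
    moreover have "k \<le> e / (2 * B * E * (T + 1))" by (simp add: k_def)
    ultimately have "k * (2 * B * E * (T + 1)) \<le> e" by (simp only: pos_le_divide_eq)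
    then have a: "(k * B) * E * (T + 1) \<le> e / 2" by (simp add: algebra_simps)
    have "E * ((k * B)\<^sup>2 * T) \<le> ((k * B) * E * (T + 1))\<^sup>2"
    proof -
      have "E * T \<le> (E * E) * ((T + 1) * (T + 1))"
      proof (rule mult_mono)
        show "E \<le> E * E" using E mult_left_mono[of 1 E E] by simp
        show "T \<le> (T + 1) * (T + 1)" using T by (simp add: algebra_simps)
      qed (use E T in auto)
      then have "(k * B)\<^sup>2 * (E * T) \<le> (k * B)\<^sup>2 * ((E * E) * ((T + 1) * (T + 1)))"
        by (rule mult_left_mono) simp
      then show ?thesis by (simp add: power2_eq_square mult_ac)
    qed
    also have "\<dots> \<le> (e / 2)\<^sup>2" using a k B E T by (intro power_mono) auto
    also have "\<dots> < e\<^sup>2" using e by (simp add: power_divide)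
    finally show ?thesis .
  qed
  obtain d where d: "0 < d" "d \<le> r" "\<And>t y. t \<in> {0..T} \<Longrightarrow> y \<in> cball (Y t) d \<Longrightarrow> norm (F' y - F' (Y t)) \<le> k"
    using osc[OF k(1)] by blast
  show thesis
  proof (rule that[OF d(1)])
    fix Y1 Y2 h t
    assume Y1: "ode_solution F U T Y1" and Y2: "ode_solution F U T Y2"
      and n1: "\<And>t. t \<in> {0..T} \<Longrightarrow> norm (Y1 t - Y t) < d" and n2: "\<And>t. t \<in> {0..T} \<Longrightarrow> norm (Y2 t - Y t) < d"
      and h: "h \<noteq> 0" and init: "Y2 0 - Y1 0 = h *\<^sub>R X 0" and t: "t \<in> {0..T}"
    have c1: "continuous_on {0..T} Y1" and c2: "continuous_on {0..T} Y2"
      using Y1 Y2 by (auto simp: ode_solution_def)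
    let ?D = "\<lambda>t. (Y2 t - Y1 t) /\<^sub>R h"
    have "(norm (?D t - X t))\<^sup>2 \<le> exp ((2 * (L + 1) + 1) * t) * ((norm (?D 0 - X 0))\<^sup>2 + (k * B)\<^sup>2 * t)"
    proof (rule gronwall_inhomogeneous[where u' = "\<lambda>t. (F (Y2 t) - F (Y1 t)) /\<^sub>R h - F' (Y t) (X t)" and T = T])
      show "continuous_on {0..T} (\<lambda>t. ?D t - X t)" by (intro continuous_intros c1 c2 cX)
    next
      fix s assume s: "s \<in> {0<..<T}"
      then have "at s within {0..T} = at s" by (intro at_within_interior) simp
      then have "(X has_vector_derivative F' (Y s) (X s)) (at s)" using X[of s] s by auto
      then show "((\<lambda>t. ?D t - X t) has_vector_derivative (F (Y2 s) - F (Y1 s)) /\<^sub>R h - F' (Y s) (X s)) (at s)"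
        using Y1 Y2 s by (auto simp: ode_solution_def intro!: derivative_eq_intros)
    next
      fix s assume "s \<in> {0<..<T}"
      then have s: "s \<in> {0..T}" by auto
      have lin: "norm (F (Y2 s) - F (Y1 s) - F' (Y s) (Y2 s - Y1 s)) \<le> norm (Y2 s - Y1 s) * k"
      proof -
        let ?S = "cball (Y s) d"
        \<comment> \<open>Mean value inequality for \<open>F\<close> minus its linearization at the
          reference point \<open>Y s\<close>, whose derivative is at most k throughout the ball.
          Both curves may thus differ from \<open>Y\<close>.\<close>
        have "norm ((\<lambda>y. F y - F' (Y s) y) (Y2 s) - (\<lambda>y. F y - F' (Y s) y) (Y1 s)) \<le> k * norm (Y2 s - Y1 s)"
        proof (rule differentiable_bound[of ?S _ "\<lambda>y. blinfun_apply (F' y - F' (Y s))"])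
          fix y assume y: "y \<in> ?S"
          then have "y \<in> U" using r(3)[OF s] d(2) by auto
          then have "(F has_derivative blinfun_apply (F' y)) (at y within ?S)"
            using deriv has_derivative_at_withinI by blast
          then show "((\<lambda>y. F y - F' (Y s) y) has_derivative blinfun_apply (F' y - F' (Y s))) (at y within ?S)"
            by (auto intro!: derivative_eq_intros simp: blinfun.diff_left)
          show "onorm (blinfun_apply (F' y - F' (Y s))) \<le> k"
            using d(3)[OF s y] by (simp add: norm_blinfun.rep_eq)
        qed (use n1[OF s] n2[OF s] in \<open>auto simp: dist_norm norm_minus_commute\<close>)
        then show ?thesis by (simp add: blinfun.diff_right algebra_simps)
      qed
      let ?rem = "(F (Y2 s) - F (Y1 s) - F' (Y s) (Y2 s - Y1 s)) /\<^sub>R h"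
      have "(F (Y2 s) - F (Y1 s)) /\<^sub>R h - F' (Y s) (X s) = F' (Y s) (?D s - X s) + ?rem"
        by (simp add: blinfun.diff_right blinfun.add_right blinfun.scaleR_right algebra_simps)
      then have "norm ((F (Y2 s) - F (Y1 s)) /\<^sub>R h - F' (Y s) (X s)) \<le> norm (F' (Y s) (?D s - X s)) + norm ?rem"
        by (metis norm_triangle_ineq)
      also have "norm (F' (Y s) (?D s - X s)) \<le> norm (F' (Y s)) * norm (?D s - X s)" by (rule norm_blinfun)
      also have "norm (F' (Y s)) * norm (?D s - X s) \<le> L * norm (?D s - X s)"
        using r(4)[OF s, of "Y s"] r(1) by (simp add: mult_right_mono)
      also have "norm ?rem \<le> norm (?D s) * k"
        using mult_left_mono[OF lin, of "inverse \<bar>h\<bar>"]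
        by (simp only: norm_scaleR abs_inverse mult.assoc inverse_nonnegative_iff_nonnegative abs_ge_zero)
      also have "norm (?D s) * k \<le> (norm (?D s - X s) + B) * k"
        using norm_triangle_ineq[of "?D s - X s" "X s"] B(2)[OF s] k by (intro mult_right_mono) auto
      also have "\<dots> \<le> norm (?D s - X s) + k * B"
        using k mult_left_mono[of k 1 "norm (?D s - X s)"] by (simp add: algebra_simps)
      finally show "norm ((F (Y2 s) - F (Y1 s)) /\<^sub>R h - F' (Y s) (X s)) \<le> (L + 1) * norm (?D s - X s) + k * B"
        by (simp add: algebra_simps)
    qed (use t r(2) k B in auto)
    also have "norm (?D 0 - X 0) = 0" using init h by simp
    also have "exp ((2 * (L + 1) + 1) * t) * (0\<^sup>2 + (k * B)\<^sup>2 * t) \<le> E * ((k * B)\<^sup>2 * T)"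
      using t r(2) by (auto simp: E_def intro!: mult_mono)
    also have "\<dots> < e\<^sup>2" by (rule kB)
    finally show "norm (?D t - X t) < e" using e by (simp add: power_less_imp_less_base)
  qed
qed

text \<open>A single auxiliary solution V starting at Z(0) + h X(0) links the two linearizations:
  the quotient (V - Z) / h is close to X by strict differentiability along \<open>Y\<close>, and
  close to W by differentiability along \<open>Z\<close>. No estimate for the linear equations
  themselves is needed.\<close>

lemma linearized_solution_continuous:
  assumes T: "0 \<le> T" and Y: "ode_solution F U T Y"
    and X: "\<And>t. t \<in> {0..T} \<Longrightarrow> (X has_vector_derivative F' (Y t) (X t)) (at t within {0..T})"
    and e: "0 < e"
  obtains d where "0 < d"
    "\<And>Z W t. ode_solution F U T Z \<Longrightarrow> (\<And>t. t \<in> {0..T} \<Longrightarrow> norm (Z t - Y t) < d) \<Longrightarrow> W 0 = X 0 \<Longrightarrow>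
       (\<And>t. t \<in> {0..T} \<Longrightarrow> (W has_vector_derivative F' (Z t) (W t)) (at t within {0..T})) \<Longrightarrow>
       t \<in> {0..T} \<Longrightarrow> norm (W t - X t) < e"
proof -
  obtain d where d: "0 < d"
    "\<And>Y1 Y2 h t. ode_solution F U T Y1 \<Longrightarrow> ode_solution F U T Y2 \<Longrightarrow>
       (\<And>t. t \<in> {0..T} \<Longrightarrow> norm (Y1 t - Y t) < d) \<Longrightarrow> (\<And>t. t \<in> {0..T} \<Longrightarrow> norm (Y2 t - Y t) < d) \<Longrightarrow>
       h \<noteq> 0 \<Longrightarrow> Y2 0 - Y1 0 = h *\<^sub>R X 0 \<Longrightarrow> t \<in> {0..T} \<Longrightarrow> norm ((Y2 t - Y1 t) /\<^sub>R h - X t) < e / 2"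
    using difference_quotient_bound[OF T Y X, of "e / 2"] e by (metis half_gt_zero)
  show thesis
  proof (rule that[of "d / 2"])
    fix Z W t
    assume Z: "ode_solution F U T Z" and near: "\<And>t. t \<in> {0..T} \<Longrightarrow> norm (Z t - Y t) < d / 2"
      and W0: "W 0 = X 0" and W: "\<And>t. t \<in> {0..T} \<Longrightarrow> (W has_vector_derivative F' (Z t) (W t)) (at t within {0..T})"
      and t: "t \<in> {0..T}"
    obtain d' where d': "0 < d'"
      "\<And>Y1 Y2 h t. ode_solution F U T Y1 \<Longrightarrow> ode_solution F U T Y2 \<Longrightarrow>
         (\<And>t. t \<in> {0..T} \<Longrightarrow> norm (Y1 t - Z t) < d') \<Longrightarrow> (\<And>t. t \<in> {0..T} \<Longrightarrow> norm (Y2 t - Z t) < d') \<Longrightarrow>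
         h \<noteq> 0 \<Longrightarrow> Y2 0 - Y1 0 = h *\<^sub>R W 0 \<Longrightarrow> t \<in> {0..T} \<Longrightarrow> norm ((Y2 t - Y1 t) /\<^sub>R h - W t) < e / 2"
      using difference_quotient_bound[OF T Z W, of "e / 2"] e by (metis half_gt_zero)
    have "0 < min d' (d / 2)" using d(1) d'(1) by simp
    then obtain d'' where d'': "0 < d''" "\<And>y. norm (y - Z 0) < d'' \<Longrightarrow> \<exists>V. V 0 = y \<and> ode_solution F U T V \<and>
        (\<forall>t\<in>{0..T}. (V has_vector_derivative F (V t)) (at t within {0..T}) \<and> norm (V t - Z t) < min d' (d / 2))"
      using nearby_solution[OF T Z] by metis
    \<comment> \<open>Small enough for the start of V to lie within the distance for which a
      solution near \<open>Z\<close> exists; the 1 covers X(0) = 0.\<close>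
    define h where "h = d'' / (2 * (norm (X 0) + 1))"
    have h: "0 < h" using d''(1) by (simp add: h_def add_nonneg_pos)
    have "norm (h *\<^sub>R X 0) \<le> h * (norm (X 0) + 1)" using h by simp
    also have "\<dots> = d'' / 2" by (simp add: h_def add_nonneg_eq_0_iff field_simps)
    also have "\<dots> < d''" using d''(1) by simp
    finally have "norm ((Z 0 + h *\<^sub>R X 0) - Z 0) < d''" by simp
    then obtain V where V: "V 0 = Z 0 + h *\<^sub>R X 0" "ode_solution F U T V"
      and close: "\<And>t. t \<in> {0..T} \<Longrightarrow> norm (V t - Z t) < min d' (d / 2)"
      using d''(2) by blast
    have "norm ((V t - Z t) /\<^sub>R h - X t) < e / 2"
    proof (rule d(2)[OF Z V(2)])
      fix s assume s: "s \<in> {0..T}"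
      show "norm (Z s - Y s) < d" using near[OF s] d(1) by simp
      show "norm (V s - Y s) < d"
        using norm_triangle_ineq[of "V s - Z s" "Z s - Y s"] close[OF s] near[OF s] by simp
    qed (use h V t in auto)
    moreover have "norm ((V t - Z t) /\<^sub>R h - W t) < e / 2"
      by (rule d'(2)[OF Z V(2)]) (use h V t close d'(1) W0 in auto)
    ultimately show "norm (W t - X t) < e"
      using norm_triangle_ineq4[of "(V t - Z t) /\<^sub>R h - X t" "(V t - Z t) /\<^sub>R h - W t"] by simp
  qed (use d in auto)
qed

text \<open>For finite slope \<open>profile_solution\<close> demands a solution on both sides of R.
  The past is a solution of the reversed field -F from the same point; the two pieces fit together
  differentiably because both one-sided derivatives at time 0 equal F(Y(0)), which is what
  \<open>d0\<close> is for.\<close>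

lemma backward_extension:
  assumes Y: "ode_solution F U T Y" and T: "0 < T"
    and d0: "(Y has_vector_derivative F (Y 0)) (at 0 within {0..T})"
  obtains \<tau> Z where "0 < \<tau>" "continuous_on {-\<tau>..T} Z" "\<And>t. t \<in> {0..T} \<Longrightarrow> Z t = Y t"
    "\<And>t. t \<in> {-\<tau>..T} \<Longrightarrow> Z t \<in> U"
    "\<And>t. t \<in> {-\<tau><..<T} \<Longrightarrow> (Z has_vector_derivative F (Z t)) (at t)"
proof -
  interpret rev: c1_vector_field "\<lambda>y. - F y" "\<lambda>y. - F' y" U
    using open_U deriv cont_F'
    by unfold_locales (auto intro!: derivative_eq_intros continuous_intros simp: blinfun.minus_left)
  have YU: "Y t \<in> U" if "t \<in> {0..T}" for t using Y that by (auto simp: ode_solution_def)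
  obtain \<tau> B where B: "0 < \<tau>" "B 0 = Y 0" "\<And>t. t \<in> {0..\<tau>} \<Longrightarrow> B t \<in> U"
    "\<And>t. t \<in> {0..\<tau>} \<Longrightarrow> (B has_vector_derivative - F (B t)) (at t within {0..\<tau>})"
    using rev.local_solution[OF YU[of 0]] T by auto
  define Z where "Z = (\<lambda>t. if t \<in> {0..T} then Y t else B (- t))"
  have Zneg: "Z t = B (- t)" if "t \<in> {-\<tau>..0}" for t using that T by (auto simp: Z_def B(2))
  have dB: "((\<lambda>t. B (- t)) has_vector_derivative F (B (- t))) (at t within {-\<tau>..0})" if t: "t \<in> {-\<tau>..0}" for t
  proof -
    have "uminus ` {-\<tau>..0} = {0..\<tau>}" by simp
    then have "(B has_vector_derivative - F (B (- t))) (at (- t) within uminus ` {-\<tau>..0})" using B(4)[of "- t"] t by simp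
    moreover have "(uminus has_vector_derivative - 1) (at t within {-\<tau>..0})"
      by (auto intro!: derivative_eq_intros simp: has_real_derivative_iff_has_vector_derivative[symmetric])
    ultimately show ?thesis
      using vector_diff_chain_within[of uminus "- 1" t "{-\<tau>..0}" B "- F (B (- t))"] by (simp add: o_def)
  qed
  have dZ: "(Z has_vector_derivative F (Z t)) (at t)" if t: "t \<in> {-\<tau><..<T}" for t
  proof -
    have "(Z has_vector_derivative (if t \<in> {0..T} then F (Y t) else F (B (- t)))) (at t within {-\<tau>..T})"
      unfolding Z_def
    proof (rule has_vector_derivative_If_within_closures[where T = "{-\<tau>..0}"])
      show "{-\<tau>..T} = {0..T} \<union> {-\<tau>..0}" using B(1) T by auto
      have cl: "{0..T} \<union> (closure {0..T} \<inter> closure {-\<tau>..0}) = {0..T}"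
        "{-\<tau>..0} \<union> (closure {0..T} \<inter> closure {-\<tau>..0}) = {-\<tau>..0}" using B(1) T by auto
      show "(Y has_vector_derivative F (Y t)) (at t within {0..T} \<union> (closure {0..T} \<inter> closure {-\<tau>..0}))"
        if "t \<in> {0..T} \<union> (closure {0..T} \<inter> closure {-\<tau>..0})"
      proof (cases "t = 0")
        case True then show ?thesis using d0 unfolding cl by simp
      next
        case False
        then have "t \<in> {0<..<T}" using that t unfolding cl by auto
        then show ?thesis using Y has_vector_derivative_at_within unfolding ode_solution_def by blast
      qed
      show "((\<lambda>t. B (- t)) has_vector_derivative F (B (- t))) (at t within {-\<tau>..0} \<union> (closure {0..T} \<inter> closure {-\<tau>..0}))"
        if "t \<in> {-\<tau>..0} \<union> (closure {0..T} \<inter> closure {-\<tau>..0})"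
        using dB that unfolding cl by blast
    qed (use t B(2) in auto)
    moreover have "at t within {-\<tau>..T} = at t" using t by (intro at_within_interior) simp
    ultimately show ?thesis by (auto simp: Z_def split: if_splits)
  qed
  show thesis
  proof (rule that[OF B(1) _ _ _ dZ])
    have "continuous_on {-\<tau>..0} (\<lambda>t. B (- t))"
      using dB has_vector_derivative_continuous continuous_on_eq_continuous_within by blast
    then have "continuous_on {-\<tau>..0} Z" by (rule continuous_on_eq) (use Zneg in auto)
    moreover have "continuous_on {0..T} Z"
      by (rule continuous_on_eq[of _ Y]) (use Y in \<open>auto simp: ode_solution_def Z_def\<close>)
    moreover have "{-\<tau>..T} = {-\<tau>..0} \<union> {0..T}" using B(1) T by auto
    ultimately show "continuous_on {-\<tau>..T} Z" by (auto intro: continuous_on_closed_Un)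
    show "Z t \<in> U" if "t \<in> {-\<tau>..T}" for t
      using that YU[of t] B(3)[of "- t"] by (auto simp: Z_def)
  qed (auto simp: Z_def)
qed

end

section \<open>The linearized profile equation\<close>

abbreviation profile_drift' :: "nat \<Rightarrow> real \<Rightarrow> real" where
  "profile_drift' n r \<equiv> (real n - 1) / r\<^sup>2 + 1 / 2"

lemma has_real_derivative_profile_drift:
  "r \<noteq> 0 \<Longrightarrow> (profile_drift n has_real_derivative profile_drift' n r) (at r)"
  unfolding profile_drift_def[abs_def]
  by (auto intro!: derivative_eq_intros simp: power2_eq_square field_simps)

lemma profile_drift_strict_mono:
  assumes "n \<ge> 1" "r < s" "0 < r * s"
  shows "profile_drift n r < profile_drift n s"
proof -
  have "r \<noteq> 0" "s \<noteq> 0" using assms by auto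
  then have "profile_drift n s - profile_drift n r = (s - r) * (1 / 2 + (real n - 1) / (r * s))"
    by (simp add: profile_drift_def field_simps)
  moreover have "0 < 1 / 2 + (real n - 1) / (r * s)" using assms by (intro add_pos_nonneg divide_nonneg_pos) auto
  ultimately have "0 < profile_drift n s - profile_drift n r" using assms(2) by simp
  then show ?thesis by simp
qed

text \<open>The drift increases on each side of its pole 0. By the intermediate value theorem a
  curve avoiding r = 0 stays on one side.\<close>

lemma profile_drift_less_along_curve:
  fixes r :: "real \<Rightarrow> real"
  assumes n: "n \<ge> 1" and cont: "continuous_on {0..T} r"
    and deriv: "\<And>t. t \<in> {0<..<T} \<Longrightarrow> (r has_real_derivative 1 - m t) (at t)"
    and m1: "\<And>t. t \<in> {0<..<T} \<Longrightarrow> m t < 1"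
    and nz: "\<And>t. t \<in> {0..T} \<Longrightarrow> r t \<noteq> 0"
    and t: "0 < t" "t \<le> T"
  shows "r 0 < r t" "profile_drift n (r 0) < profile_drift n (r t)"
proof -
  have ct: "continuous_on {0..t} r" by (rule continuous_on_subset[OF cont]) (use t in auto)
  show lt: "r 0 < r t"
  proof (rule DERIV_pos_imp_increasing_open[OF t(1) _ ct])
    fix s assume "0 < s" "s < t"
    then have "s \<in> {0<..<T}" using t by auto
    then show "\<exists>y. (r has_real_derivative y) (at s) \<and> 0 < y"
      using deriv[of s] m1[of s] by (intro exI[of _ "1 - m s"]) auto
  qed
  have "0 < r 0 * r t"
  proof (rule ccontr)
    assume "\<not> 0 < r 0 * r t"
    then have "r 0 \<le> 0" "0 \<le> r t" using lt by (auto simp: zero_less_mult_iff not_less)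
    then obtain s where "0 \<le> s" "s \<le> t" "r s = 0"
      using IVT'[of r 0 0 t] ct t by auto
    then show False using nz[of s] t by auto
  qed
  then show "profile_drift n (r 0) < profile_drift n (r t)" by (rule profile_drift_strict_mono[OF n lt])
qed

text \<open>The coordinate \<open>m = g' / (1 + g')\<close> stays finite when \<open>g' = \<infinity>\<close>, and with the time \<open>t = (r - R) + x\<close>
  the profile equation becomes the autonomous system below, rational in all variables.\<close>

definition slope_speed :: "nat \<Rightarrow> real \<Rightarrow> real \<Rightarrow> real \<Rightarrow> real" where
  "slope_speed n r x m = (m\<^sup>2 + (1 - m)\<^sup>2) * (profile_drift n r * m - x * (1 - m) / 2)"

definition slope_speed_deriv :: "nat \<Rightarrow> real \<Rightarrow> real \<Rightarrow> real \<Rightarrow> real \<Rightarrow> real \<Rightarrow> real \<Rightarrow> real" where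
  "slope_speed_deriv n r x m \<xi> \<zeta> \<mu> =
     (4 * m - 2) * \<mu> * (profile_drift n r * m - x * (1 - m) / 2) +
     (m\<^sup>2 + (1 - m)\<^sup>2) * (profile_drift' n r * \<xi> * m + profile_drift n r * \<mu> - \<zeta> * (1 - m) / 2 + x * \<mu> / 2)"

text \<open>The margin is \<open>(1 - m) a z\<close> for the quantity \<open>z\<close> in the proof of
  \<open>horizontal_variation_nonneg\<close>; in this form it makes sense, and is continuous, also at \<open>m = 1\<close>.\<close>

definition variation_margin :: "nat \<Rightarrow> real \<Rightarrow> real \<Rightarrow> real \<Rightarrow> real \<Rightarrow> real \<Rightarrow> real \<Rightarrow> real" where
  "variation_margin n R r x m \<zeta> \<mu> = (1 - m) * \<mu> + slope_speed n r x m * \<zeta> -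
     (m\<^sup>2 + (1 - m)\<^sup>2) * (profile_drift n r - profile_drift n R) * m"

section \<open>The Sturm comparison\<close>

text \<open>The argument of the overview in the time t, where dr = (1 - m) dt, so that each
  derivative with respect to r acquires the factor 1 - m. Here (1 - \<zeta>, \<zeta>, \<mu>) is the
  variation of (r, x, m) at fixed t. The assumption \<open>eta\<close> is the inequality for \<eta>
  with g'' eliminated by the equation. It is essential that m < 1 also at time 0, so infinite slope
  is not covered.\<close>

lemma horizontal_variation_nonneg:
  fixes r x m \<zeta> \<mu> :: "real \<Rightarrow> real"
  assumes n: "n \<ge> 1" and S: "0 < S"
    and cr: "continuous_on {0..S} r" and cx: "continuous_on {0..S} x" and cm: "continuous_on {0..S} m"
    and c\<zeta>: "continuous_on {0..S} \<zeta>" and c\<mu>: "continuous_on {0..S} \<mu>"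
    and dr: "\<And>t. t \<in> {0<..<S} \<Longrightarrow> (r has_real_derivative 1 - m t) (at t)"
    and dx: "\<And>t. t \<in> {0<..<S} \<Longrightarrow> (x has_real_derivative m t) (at t)"
    and dm: "\<And>t. t \<in> {0<..<S} \<Longrightarrow> (m has_real_derivative slope_speed n (r t) (x t) (m t)) (at t)"
    and d\<zeta>: "\<And>t. t \<in> {0<..<S} \<Longrightarrow> (\<zeta> has_real_derivative \<mu> t) (at t)"
    and d\<mu>: "\<And>t. t \<in> {0<..<S} \<Longrightarrow>
      (\<mu> has_real_derivative slope_speed_deriv n (r t) (x t) (m t) (1 - \<zeta> t) (\<zeta> t) (\<mu> t)) (at t)"
    and init: "r 0 = R" "x 0 = 0" "\<zeta> 0 = 0" "\<mu> 0 = 0"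
    and m1: "\<And>t. t \<in> {0..S} \<Longrightarrow> m t < 1" and m0: "\<And>t. t \<in> {0..<S} \<Longrightarrow> 0 < m t"
    and nz: "\<And>t. t \<in> {0..S} \<Longrightarrow> r t \<noteq> 0"
    and pR: "profile_drift n R < 0"
    and eta: "\<And>t G A. t \<in> {0<..<S} \<Longrightarrow> G = m t / (1 - m t) \<Longrightarrow> A = 1 + G\<^sup>2 \<Longrightarrow>
      0 \<le> A * profile_drift' n (r t) +
        2 * (profile_drift n (r t) - profile_drift n R) * G * (A * (profile_drift n (r t) * G - x t / 2))"
    and t: "t \<in> {0..S}"
  shows "0 \<le> variation_margin n R (r t) (x t) (m t) (\<zeta> t) (\<mu> t)" "0 \<le> \<zeta> t"
proof -
  define p where "p = (\<lambda>t. profile_drift n (r t))"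
  define pR where "pR = profile_drift n R"
  define G where "G = (\<lambda>t. m t / (1 - m t))"
  define A where "A = (\<lambda>t. 1 + (G t)\<^sup>2)"
  define a where "a = (\<lambda>t. (m t)\<^sup>2 + (1 - m t)\<^sup>2)"
  define k where "k = (\<lambda>t. p t * G t - x t / 2)"
  \<comment> \<open>With \<theta> = arctan(m / (1 - m)) one has d\<theta> = dm / a, so y is the
    variation of the angle at fixed t. Since k = d\<theta>/dr and 1 - \<zeta> is the variation of r,
    subtracting k (1 - \<zeta>) gives the variation Z at fixed r. In the same way V is minus the
    variation of the height at fixed r.\<close>
  define y where "y = (\<lambda>t. \<mu> t / a t)"
  define Z where "Z = (\<lambda>t. y t - k t * (1 - \<zeta> t))"
  define V where "V = (\<lambda>t. G t * (1 - \<zeta> t) - \<zeta> t)"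
  \<comment> \<open>These are z and v of the overview, with w = G - V and with w' / A rewritten as Z
    + k.\<close>
  define z where "z = (\<lambda>t. Z t - x t / 2 + pR * G t)"
  define v where "v = (\<lambda>t. A t * (p t - pR) * x t + V t - G t)"
  define D where "D = (\<lambda>t. z t * V t - v t * Z t)"
  define \<eta> where "\<eta> = (\<lambda>t. A t * profile_drift' n (r t) + 2 * (p t - pR) * G t * (A t * k t))"
  have pR0: "pR < 0" using pR by (simp add: pR_def)
  have mG: "m t = (1 - m t) * G t" if "t \<in> {0..S}" for t using m1[OF that] by (simp add: G_def)
  have a: "a t = A t * (1 - m t)\<^sup>2" if "t \<in> {0..S}" for t
    using m1[OF that] by (simp add: a_def A_def G_def power_divide field_simps)
  have a_pos: "0 < a t" for t
    unfolding a_def by (simp add: sum_power2_gt_zero_iff)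
  have a_nz: "a t \<noteq> 0" for t using a_pos[of t] by simp
  have cp: "continuous_on {0..S} p"
    unfolding p_def profile_drift_def by (intro continuous_intros cr) (use nz in auto)
  have cG: "continuous_on {0..S} G" unfolding G_def by (intro continuous_intros cm) (use m1 in force)
  have cA: "continuous_on {0..S} A" unfolding A_def by (intro continuous_intros cG)
  have ck: "continuous_on {0..S} k" unfolding k_def by (intro continuous_intros cp cG cx) simp
  have cy: "continuous_on {0..S} y"
    unfolding y_def by (intro continuous_intros c\<mu>) (auto simp: a_nz, auto simp: a_def intro!: continuous_intros cm)
  have cZ: "continuous_on {0..S} Z" unfolding Z_def by (intro continuous_intros cy ck c\<zeta>)
  have cV: "continuous_on {0..S} V" unfolding V_def by (intro continuous_intros cG c\<zeta>)
  have cz: "continuous_on {0..S} z" unfolding z_def by (intro continuous_intros cZ cx cG) simp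
  have cv: "continuous_on {0..S} v" unfolding v_def by (intro continuous_intros cA cp cx cV cG)
  have cD: "continuous_on {0..S} D" unfolding D_def by (intro continuous_intros cz cV cv cZ)

  have sub: "t \<in> {0..S}" if "t \<in> {0<..<S}" for t using that by auto
  have speed: "slope_speed n (r t) (x t) (m t) = (1 - m t)^3 * A t * k t" if "t \<in> {0..S}" for t
  proof -
    have "slope_speed n (r t) (x t) (m t) = a t * (p t * ((1 - m t) * G t) - x t * (1 - m t) / 2)"
      by (simp add: slope_speed_def a_def p_def mG[OF that, symmetric])
    also have "\<dots> = (1 - m t)^3 * A t * k t"
      unfolding a[OF that] k_def by (simp add: field_simps power2_eq_square power3_eq_cube)
    finally show ?thesis .
  qed
  have dp: "(p has_real_derivative profile_drift' n (r t) * (1 - m t)) (at t)" if "t \<in> {0<..<S}" for t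
    unfolding p_def by (rule DERIV_chain2[OF has_real_derivative_profile_drift[OF nz[OF sub[OF that]]] dr[OF that]])
  have dG: "(G has_real_derivative (1 - m t) * A t * k t) (at t)" if "t \<in> {0<..<S}" for t
  proof -
    have nz': "1 - m t \<noteq> 0" using m1[OF sub[OF that]] by simp
    have "(G has_real_derivative ((1 - m t)^3 * A t * k t) / (1 - m t)\<^sup>2) (at t)"
      unfolding G_def
      by (rule derivative_eq_intros dm[OF that] refl nz')+
        (use nz' in \<open>simp add: speed[OF sub[OF that]] divide_simps power2_eq_square, simp add: algebra_simps\<close>)
    then show ?thesis using nz' by (elim DERIV_cong) (simp add: power3_eq_cube power2_eq_square)
  qed
  have dk: "(k has_real_derivative (1 - m t) * (profile_drift' n (r t) * G t + p t * A t * k t - G t / 2)) (at t)"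
    if "t \<in> {0<..<S}" for t
  proof -
    have "(k has_real_derivative profile_drift' n (r t) * (1 - m t) * G t + p t * ((1 - m t) * A t * k t) - ((1 - m t) * G t) / 2) (at t)"
      unfolding k_def mG[OF sub[OF that], symmetric]
      by (auto intro!: derivative_eq_intros dp[OF that] dG[OF that, unfolded k_def] dx[OF that])
    then show ?thesis by (simp add: algebra_simps)
  qed
  have dy: "(y has_real_derivative profile_drift' n (r t) * (1 - \<zeta> t) * m t + (p t + x t / 2) * \<mu> t - \<zeta> t * (1 - m t) / 2) (at t)"
    if "t \<in> {0<..<S}" for t
  proof -
    \<comment> \<open>\<kappa> is d\<theta>/dt, so m' = a \<kappa>. The part of
      \<open>slope_speed_deriv\<close> that comes from varying the factor a cancels against the
      derivative of the denominator of y.\<close>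
    define \<kappa> where "\<kappa> = p t * m t - x t * (1 - m t) / 2"
    have da: "(a has_real_derivative (4 * m t - 2) * (a t * \<kappa>)) (at t)"
    proof -
      have "(a has_real_derivative 2 * m t * slope_speed n (r t) (x t) (m t)
          + 2 * (1 - m t) * - slope_speed n (r t) (x t) (m t)) (at t)"
        unfolding a_def by (auto intro!: derivative_eq_intros dm[OF that])
      moreover have "slope_speed n (r t) (x t) (m t) = a t * \<kappa>"
        by (simp add: slope_speed_def a_def p_def \<kappa>_def)
      ultimately show ?thesis by (elim DERIV_cong) algebra
    qed
    let ?w = "profile_drift' n (r t) * (1 - \<zeta> t) * m t + p t * \<mu> t - \<zeta> t * (1 - m t) / 2 + x t * \<mu> t / 2"
    have "slope_speed_deriv n (r t) (x t) (m t) (1 - \<zeta> t) (\<zeta> t) (\<mu> t) = (4 * m t - 2) * \<mu> t * \<kappa> + a t * ?w"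
      by (simp add: slope_speed_deriv_def \<kappa>_def a_def p_def)
    then have d\<mu>': "(\<mu> has_real_derivative (4 * m t - 2) * \<mu> t * \<kappa> + a t * ?w) (at t)" using d\<mu>[OF that] by simp
    have "(y has_real_derivative (((4 * m t - 2) * \<mu> t * \<kappa> + a t * ?w) * a t - \<mu> t * ((4 * m t - 2) * (a t * \<kappa>))) / (a t * a t)) (at t)"
      unfolding y_def by (rule DERIV_divide[OF d\<mu>' da a_nz])
    also have "(((4 * m t - 2) * \<mu> t * \<kappa> + a t * ?w) * a t - \<mu> t * ((4 * m t - 2) * (a t * \<kappa>))) / (a t * a t) = ?w"
    proof -
      have "((4 * m t - 2) * \<mu> t * \<kappa> + a t * ?w) * a t - \<mu> t * ((4 * m t - 2) * (a t * \<kappa>)) = (a t * a t) * ?w"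
        by (simp only: distrib_right) (simp add: algebra_simps)
      then show ?thesis using a_nz[of t] by simp
    qed
    finally show ?thesis by (simp add: algebra_simps)
  qed
  have \<mu>y: "\<mu> t = A t * (1 - m t)\<^sup>2 * y t" if "t \<in> {0..S}" for t
    using a_nz[of t] a[OF that] by (simp add: y_def)
  have G\<mu>: "(1 + G t) * \<mu> t = (1 - m t) * A t * y t" if "t \<in> {0..S}" for t
  proof -
    have "(1 + G t) * (1 - m t) = 1" using mG[OF that] by (simp add: algebra_simps)
    then show ?thesis unfolding \<mu>y[OF that] by algebra
  qed
  have dZ: "(Z has_real_derivative (1 - m t) * (p t * A t * Z t + V t / 2)) (at t)" if "t \<in> {0<..<S}" for t
  proof -
    have "(Z has_real_derivative
      (profile_drift' n (r t) * (1 - \<zeta> t) * m t + (p t + x t / 2) * \<mu> t - \<zeta> t * (1 - m t) / 2)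
      - ((1 - m t) * (profile_drift' n (r t) * G t + p t * A t * k t - G t / 2) * (1 - \<zeta> t) - k t * \<mu> t)) (at t)"
      unfolding Z_def by (auto intro!: derivative_eq_intros dy[OF that] dk[OF that] d\<zeta>[OF that])
    moreover have "(p t + x t / 2) * \<mu> t + k t * \<mu> t = (1 - m t) * p t * A t * y t"
    proof -
      have "(p t + x t / 2) * \<mu> t + k t * \<mu> t = p t * ((1 + G t) * \<mu> t)" by (simp add: k_def algebra_simps)
      then show ?thesis by (simp add: G\<mu>[OF sub[OF that]])
    qed
    moreover have "m t = (1 - m t) * G t" using mG[OF sub[OF that]] .
    ultimately show ?thesis
      unfolding Z_def V_def by (elim DERIV_cong) algebra
  qed
  have dV: "(V has_real_derivative - ((1 - m t) * A t * Z t)) (at t)" if "t \<in> {0<..<S}" for t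
  proof -
    have "(V has_real_derivative (1 - m t) * A t * k t * (1 - \<zeta> t) - G t * \<mu> t - \<mu> t) (at t)"
      unfolding V_def by (auto intro!: derivative_eq_intros dG[OF that] d\<zeta>[OF that])
    then show ?thesis
      using G\<mu>[OF sub[OF that]] unfolding Z_def by (elim DERIV_cong) algebra
  qed
  have dz: "(z has_real_derivative (1 - m t) * (p t * A t * z t + v t / 2)) (at t)" if "t \<in> {0<..<S}" for t
  proof -
    have "(z has_real_derivative (1 - m t) * (p t * A t * Z t + V t / 2) - m t / 2 + pR * ((1 - m t) * A t * k t)) (at t)"
      unfolding z_def by (auto intro!: derivative_eq_intros dZ[OF that] dx[OF that] dG[OF that])
    moreover have "(1 - m t) * (p t * A t * Z t + V t / 2) - (1 - m t) * G t / 2 + pR * ((1 - m t) * A t * k t)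
        = (1 - m t) * (p t * A t * z t + v t / 2)"
      by (simp add: z_def v_def k_def field_simps)
    ultimately show ?thesis
      using mG[OF sub[OF that]] by (elim DERIV_cong) argo
  qed
  \<comment> \<open>The place where \<eta> enters, as the derivative of A (p - p(R)) with respect to
    r.\<close>
  have dv: "(v has_real_derivative (1 - m t) * (\<eta> t * x t - A t * z t)) (at t)" if "t \<in> {0<..<S}" for t
  proof -
    have dA: "(A has_real_derivative 2 * G t * ((1 - m t) * A t * k t)) (at t)"
      unfolding A_def by (auto intro!: derivative_eq_intros dG[OF that, unfolded A_def])
    have "(v has_real_derivative
       (2 * G t * ((1 - m t) * A t * k t) * (p t - pR) + A t * (profile_drift' n (r t) * (1 - m t))) * x t
       + A t * (p t - pR) * m t - (1 - m t) * A t * Z t - (1 - m t) * A t * k t) (at t)"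
      unfolding v_def
      by (auto intro!: derivative_eq_intros dA dp[OF that] dx[OF that] dV[OF that] dG[OF that] simp: algebra_simps)
    moreover have "m t = (1 - m t) * G t" using mG[OF sub[OF that]] .
    moreover have "Z t = z t + x t / 2 - pR * G t" by (simp add: z_def)
    ultimately show ?thesis
      unfolding \<eta>_def k_def by (elim DERIV_cong) algebra
  qed
  \<comment> \<open>The cross terms cancel; besides the multiple of D only the source of v remains,
    whose sign is known as long as Z > 0.\<close>
  have dD: "(D has_real_derivative (1 - m t) * (p t * A t * D t - \<eta> t * x t * Z t)) (at t)" if "t \<in> {0<..<S}" for t
  proof -
    have "(D has_real_derivative (1 - m t) * (p t * A t * z t + v t / 2) * V t + z t * - ((1 - m t) * A t * Z t)
      - ((1 - m t) * (\<eta> t * x t - A t * z t) * Z t + v t * ((1 - m t) * (p t * A t * Z t + V t / 2)))) (at t)"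
      unfolding D_def by (auto intro!: derivative_eq_intros dz[OF that] dV[OF that] dv[OF that] dZ[OF that])
    then show ?thesis unfolding D_def by (elim DERIV_cong) algebra
  qed

  have x_pos: "0 < x t" if "t \<in> {0<..S}" for t
  proof -
    have "x 0 < x t"
    proof (rule DERIV_pos_imp_increasing_open[OF _ _ continuous_on_subset[OF cx]])
      fix s assume "0 < s" "s < t"
      then show "\<exists>y. (x has_real_derivative y) (at s) \<and> 0 < y"
        using dx[of s] m0[of s] that by (intro exI[of _ "m s"]) auto
    qed (use that in auto)
    then show ?thesis by (simp add: init)
  qed
  have x_nonneg: "0 \<le> x t" if "t \<in> {0..S}" for t
    using x_pos[of t] init(2) that by (cases "t = 0") auto
  have G_pos: "0 < G t" if "t \<in> {0..<S}" for t using m0[OF that] m1[of t] that by (simp add: G_def)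
  \<comment> \<open>This is Z - z. At t = 0 the height vanishes and the slope term is positive; at t
    = S the slope may vanish and the height is positive.\<close>
  have base: "0 < x t / 2 - pR * G t" if "t \<in> {0..S}" for t
  proof (cases "t = S")
    case True
    have "0 \<le> m S"
      by (rule continuous_ge_on_closure[of "{0..<S}" m S])
        (use S cm m0 in \<open>auto simp: less_imp_le\<close>)
    then have "0 \<le> G S" using m1[of S] S by (simp add: G_def)
    then have "0 \<le> - pR * G S" using pR0 by (intro mult_nonneg_nonneg) auto
    then show ?thesis using x_pos[of S] S True by simp
  next
    case False
    then have "0 < - pR * G t" using pR0 G_pos[of t] that by (intro mult_pos_pos) auto
    then show ?thesis using x_nonneg[OF that] by simp
  qed

  have z0: "z 0 = 0" by (simp add: z_def Z_def y_def k_def p_def pR_def init)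
  have D0: "D 0 = 0" by (simp add: D_def z0 v_def V_def init)
  have cc: "continuous_on {0..S} (\<lambda>t. (1 - m t) * (p t * A t))" by (intro continuous_intros cm cp cA)
  \<comment> \<open>exp(-E) is the integrating factor that removes the term p A D from
    \<open>dD\<close>.\<close>
  obtain E where E: "\<And>t. t \<in> {0..S} \<Longrightarrow>
      (E has_vector_derivative (1 - m t) * (p t * A t)) (at t within {0..S})"
    using antiderivative_continuous[OF cc] by blast
  have cE: "continuous_on {0..S} E"
    using E has_vector_derivative_continuous continuous_on_eq_continuous_within by blast
  have dE: "(E has_real_derivative (1 - m t) * (p t * A t)) (at t)" if "t \<in> {0<..<S}" for t
  proof -
    have "at t within {0..S} = at t" using that by (intro at_within_interior) simp
    then show ?thesis using E[OF sub[OF that]] by (simp add: has_real_derivative_iff_has_vector_derivative)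
  qed
  have z_nonneg_upto: "0 \<le> z t" if t: "t \<in> {0..<s}" and sS: "s \<le> S" and Zpos: "\<And>t. t \<in> {0..<s} \<Longrightarrow> 0 < Z t" for s t
  proof -
    have inner: "u \<in> {0<..<S}" if "0 < u" "u < s" for u using that sS by auto
    have D_le: "D u \<le> 0" if u: "u \<in> {0..<s}" for u
    proof -
      have "D u * exp (- E u) \<le> D 0 * exp (- E 0)"
      proof (rule DERIV_nonpos_imp_decreasing_open[where f = "\<lambda>u. D u * exp (- E u)"])
        show "continuous_on {0..u} (\<lambda>u. D u * exp (- E u))"
          by (rule continuous_on_subset[of "{0..S}"]) (use u sS in \<open>auto intro!: continuous_intros cD cE\<close>)
        fix w assume w: "0 < w" "w < u"
        then have wS: "w \<in> {0<..<S}" using inner u by auto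
        have "((\<lambda>u. D u * exp (- E u)) has_real_derivative
          (1 - m w) * (p w * A w * D w - \<eta> w * x w * Z w) * exp (- E w) + D w * (exp (- E w) * - ((1 - m w) * (p w * A w)))) (at w)"
          by (auto intro!: derivative_eq_intros dD[OF wS] dE[OF wS])
        then have "((\<lambda>u. D u * exp (- E u)) has_real_derivative - ((1 - m w) * (\<eta> w * x w * Z w) * exp (- E w))) (at w)"
          by (elim DERIV_cong) (simp add: algebra_simps)
        moreover have "0 \<le> \<eta> w"
          using eta[OF wS refl refl] by (simp add: \<eta>_def A_def G_def k_def p_def pR_def)
        then have "0 \<le> (1 - m w) * (\<eta> w * x w * Z w) * exp (- E w)"
          using m1[of w] x_nonneg[of w] Zpos[of w] wS w u
          by (intro mult_nonneg_nonneg) (auto simp: less_imp_le)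
        ultimately show "\<exists>y. ((\<lambda>u. D u * exp (- E u)) has_real_derivative y) (at w) \<and> y \<le> 0" by force
      qed (use u in auto)
      then show ?thesis by (simp add: D0 mult_le_0_iff)
    qed
    have "z 0 / Z 0 \<le> z t / Z t"
    proof (rule DERIV_nonneg_imp_increasing_open[where f = "\<lambda>u. z u / Z u"])
      have "u \<in> {0..t} \<Longrightarrow> Z u \<noteq> 0" for u using Zpos[of u] t by auto
      moreover have "{0..t} \<subseteq> {0..S}" using t sS by auto
      ultimately show "continuous_on {0..t} (\<lambda>u. z u / Z u)"
        by (intro continuous_on_divide continuous_on_subset[OF cz] continuous_on_subset[OF cZ]) auto
      fix w assume w: "0 < w" "w < t"
      then have wS: "w \<in> {0<..<S}" using inner t by auto
      have Zw: "0 < Z w" using Zpos[of w] w t by auto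
      have "((\<lambda>u. z u / Z u) has_real_derivative ((1 - m w) * (p w * A w * z w + v w / 2) * Z w
         - z w * ((1 - m w) * (p w * A w * Z w + V w / 2))) / (Z w * Z w)) (at w)"
        by (rule DERIV_divide[OF dz[OF wS] dZ[OF wS]]) (use Zw in simp)
      moreover have "(1 - m w) * (p w * A w * z w + v w / 2) * Z w
         - z w * ((1 - m w) * (p w * A w * Z w + V w / 2)) = (1 - m w) * (- D w) / 2"
        by (simp add: D_def field_simps)
      moreover have "0 \<le> (1 - m w) * (- D w) / 2 / (Z w * Z w)"
        using m1[of w] D_le[of w] w wS t Zw by (intro divide_nonneg_pos mult_nonneg_nonneg) auto
      ultimately show "\<exists>y. ((\<lambda>u. z u / Z u) has_real_derivative y) (at w) \<and> 0 \<le> y" by metis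
    qed (use t in auto)
    then show ?thesis using Zpos[OF t] by (simp add: z0 zero_le_divide_iff)
  qed
  have Z_pos: "0 < Z t" if "t \<in> {0..S}" for t
  proof (rule ccontr)
    assume "\<not> 0 < Z t"
    define B where "B = {0..S} \<inter> Z -` {..0}"
    have tB: "t \<in> B" using that \<open>\<not> 0 < Z t\<close> by (simp add: B_def)
    have clB: "closed B" unfolding B_def by (rule continuous_closed_preimage[OF cZ]) auto
    have bdd: "bdd_below B" unfolding B_def by (rule bdd_belowI[of _ 0]) auto
    \<comment> \<open>The first time at which Z is not positive. Before s the comparison gives z >=
      0, by continuity also at s, and then \<open>base\<close> forces Z > 0 at s.\<close>
    define s where "s = Inf B"
    have sB: "s \<in> B" unfolding s_def by (rule closed_contains_Inf[OF _ bdd clB]) (use tB in auto)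
    have before: "0 < Z u" if "u \<in> {0..<s}" for u
    proof (rule ccontr)
      assume "\<not> 0 < Z u"
      then have "u \<in> B" using that sB by (auto simp: B_def)
      then show False using cInf_lower[OF _ bdd, of u] that by (simp add: s_def)
    qed
    have s: "0 \<le> s" "s \<le> S" using sB by (auto simp: B_def)
    have "0 \<le> z s"
    proof (cases "s = 0")
      case False
      show ?thesis
        by (rule continuous_ge_on_closure[of "{0..<s}" z s])
          (use False s z_nonneg_upto[OF _ s(2) before] continuous_on_subset[OF cz] in auto)
    qed (simp add: z0)
    then have "0 < Z s" using base[of s] s by (simp add: z_def)
    then show False using sB by (simp add: B_def)
  qed
  have z_nonneg: "0 \<le> z t" if "t \<in> {0..S}" for t
    by (rule continuous_ge_on_closure[of "{0..<S}" z])
      (use S that z_nonneg_upto[OF _ order_refl] Z_pos cz in auto)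
  have margin: "variation_margin n R (r t) (x t) (m t) (\<zeta> t) (\<mu> t) = (1 - m t) * a t * z t" if "t \<in> {0..S}" for t
  proof -
    have ay: "a t * y t = \<mu> t" using a_nz[of t] by (simp add: y_def)
    have sp: "slope_speed n (r t) (x t) (m t) = a t * ((1 - m t) * k t)"
      by (simp add: speed[OF that] a[OF that] power2_eq_square power3_eq_cube)
    have "variation_margin n R (r t) (x t) (m t) (\<zeta> t) (\<mu> t)
        = (1 - m t) * \<mu> t + slope_speed n (r t) (x t) (m t) * \<zeta> t - a t * (p t - pR) * m t"
      by (simp add: variation_margin_def a_def p_def pR_def)
    also have "\<dots> = (1 - m t) * (a t * y t) + a t * ((1 - m t) * k t) * \<zeta> t - a t * (p t - pR) * ((1 - m t) * G t)"
      by (simp only: ay sp mG[OF that, symmetric])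
    also have "\<dots> = (1 - m t) * a t * z t"
      by (simp add: z_def Z_def k_def field_simps)
    finally show ?thesis .
  qed
  show margin_nonneg: "0 \<le> variation_margin n R (r t) (x t) (m t) (\<zeta> t) (\<mu> t)"
    using margin[OF t] z_nonneg[OF t] m1[OF t] a_pos[of t] by simp
  show "0 \<le> \<zeta> t"
  proof -
    \<comment> \<open>The quotient \<zeta> / (1 - m) is w, the variation at fixed r - R. The
      numerator of its derivative is the margin plus a nonnegative drift term.\<close>
    have "\<zeta> 0 / (1 - m 0) \<le> \<zeta> t / (1 - m t)"
    proof (rule DERIV_nonneg_imp_increasing_open[where f = "\<lambda>t. \<zeta> t / (1 - m t)"])
      show "continuous_on {0..t} (\<lambda>t. \<zeta> t / (1 - m t))"
        by (rule continuous_on_subset[of "{0..S}"]) (use m1 t in \<open>force intro!: continuous_intros c\<zeta> cm\<close>)+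
      fix w assume "0 < w" "w < t"
      then have wS: "w \<in> {0<..<S}" using t by auto
      have nz': "1 - m w > 0" using m1[OF sub[OF wS]] by simp
      let ?s = "slope_speed n (r w) (x w) (m w)"
      have "((\<lambda>t. \<zeta> t / (1 - m t)) has_real_derivative (\<mu> w * (1 - m w) - \<zeta> w * (0 - ?s)) / ((1 - m w) * (1 - m w))) (at w)"
        by (rule DERIV_divide[OF d\<zeta>[OF wS] DERIV_diff[OF DERIV_const dm[OF wS]]]) (use nz' in simp)
      moreover have "\<mu> w * (1 - m w) - \<zeta> w * (0 - ?s)
        = variation_margin n R (r w) (x w) (m w) (\<zeta> w) (\<mu> w) + a w * (p w - pR) * m w"
        by (simp add: variation_margin_def a_def p_def pR_def algebra_simps)
      moreover have "pR \<le> p w"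
        using profile_drift_less_along_curve(2)[OF n cr dr _ nz, of w] m1 wS
        by (simp add: pR_def p_def init less_imp_le)
      then have "0 \<le> variation_margin n R (r w) (x w) (m w) (\<zeta> w) (\<mu> w) + a w * (p w - pR) * m w"
        using margin[OF sub[OF wS]] z_nonneg[OF sub[OF wS]] nz' a_pos[of w] m0[of w] wS by simp
      ultimately show "\<exists>y. ((\<lambda>t. \<zeta> t / (1 - m t)) has_real_derivative y) (at w) \<and> 0 \<le> y" by force
    qed (use t in auto)
    then show ?thesis using m1[OF t] by (simp add: init zero_le_divide_iff)
  qed
qed

section \<open>Trajectories and profile curves\<close>

definition profile_field :: "nat \<Rightarrow> real \<times> real \<times> real \<Rightarrow> real \<times> real \<times> real" where
  "profile_field n y = (1 - snd (snd y), snd (snd y), slope_speed n (fst y) (fst (snd y)) (snd (snd y)))"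

definition profile_field_deriv :: "nat \<Rightarrow> real \<times> real \<times> real \<Rightarrow> (real \<times> real \<times> real) \<Rightarrow>\<^sub>L (real \<times> real \<times> real)" where
  "profile_field_deriv n y = Blinfun (\<lambda>v. (- snd (snd v), snd (snd v),
     slope_speed_deriv n (fst y) (fst (snd y)) (snd (snd y)) (fst v) (fst (snd v)) (snd (snd v))))"

lemma profile_field_deriv_apply:
  "blinfun_apply (profile_field_deriv n y) v = (- snd (snd v), snd (snd v),
     slope_speed_deriv n (fst y) (fst (snd y)) (snd (snd y)) (fst v) (fst (snd v)) (snd (snd v)))"
proof -
  have "bounded_linear (\<lambda>v. (- snd (snd v), snd (snd v),
     slope_speed_deriv n (fst y) (fst (snd y)) (snd (snd y)) (fst v) (fst (snd v)) (snd (snd v))))"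
    unfolding slope_speed_deriv_def
    by (intro bounded_linear_Pair bounded_linear_minus bounded_linear_add bounded_linear_sub bounded_linear_const_mult
        bounded_linear_mult_const bounded_linear_divide[THEN bounded_linear_compose] bounded_linear_fst_comp bounded_linear_snd_comp
        bounded_linear_ident)
  then show ?thesis by (simp add: profile_field_deriv_def bounded_linear_Blinfun_apply)
qed

interpretation profile: c1_vector_field "profile_field n" "profile_field_deriv n" "{y. fst y \<noteq> 0}" for n
proof
  have "{y :: real \<times> real \<times> real. fst y \<noteq> 0} = fst -` (- {0})" by auto
  then show "open {y :: real \<times> real \<times> real. fst y \<noteq> 0}"
    by (metis open_vimage_fst open_Compl closed_singleton)
next
  fix y :: "real \<times> real \<times> real" assume "y \<in> {y. fst y \<noteq> 0}"
  then have nz: "fst y \<noteq> 0" by simp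
  define q where "q = profile_drift' n (fst y)"
  have dp: "((\<lambda>y. profile_drift n (fst y)) has_derivative (\<lambda>v. fst v * q)) (at y)"
    unfolding q_def
    by (rule DERIV_compose_FDERIV[where f = "profile_drift n" and g = fst, OF has_real_derivative_profile_drift[OF nz]]) (rule has_derivative_fst[OF has_derivative_ident])
  show "(profile_field n has_derivative blinfun_apply (profile_field_deriv n y)) (at y)"
    unfolding profile_field_def[abs_def] slope_speed_def
    by (auto intro!: derivative_eq_intros dp
        simp: profile_field_deriv_apply slope_speed_deriv_def q_def[symmetric] fun_eq_iff)
      (simp add: power2_eq_square field_simps)
next
  show "continuous_on {y. fst y \<noteq> 0} (profile_field_deriv n)"
    unfolding profile_drift_def
    by (rule continuous_on_blinfun_componentwise)
      (auto simp: profile_field_deriv_apply slope_speed_deriv_def profile_drift_def intro!: continuous_intros)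
qed

abbreviation trajectory :: "nat \<Rightarrow> real \<Rightarrow> (real \<Rightarrow> real \<times> real \<times> real) \<Rightarrow> bool" where
  "trajectory n T Y \<equiv> ode_solution (profile_field n) {y. fst y \<noteq> 0} T Y"

lemma has_real_derivative_components:
  assumes "(Y has_vector_derivative (a, b, c)) (at t within S)"
  shows "((\<lambda>t. fst (Y t)) has_real_derivative a) (at t within S)"
    "((\<lambda>t. fst (snd (Y t))) has_real_derivative b) (at t within S)"
    "((\<lambda>t. snd (snd (Y t))) has_real_derivative c) (at t within S)"
  using bounded_linear.has_vector_derivative[OF bounded_linear_fst assms]
    bounded_linear.has_vector_derivative[OF bounded_linear_fst_comp[OF bounded_linear_snd] assms]
    bounded_linear.has_vector_derivative[OF bounded_linear_snd_comp[OF bounded_linear_snd] assms]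
  by (auto simp: has_real_derivative_iff_has_vector_derivative)

lemma trajectory_components:
  assumes "trajectory n T Y"
  shows "continuous_on {0..T} (\<lambda>t. fst (Y t))" "continuous_on {0..T} (\<lambda>t. fst (snd (Y t)))"
    "continuous_on {0..T} (\<lambda>t. snd (snd (Y t)))"
    "\<And>t. t \<in> {0..T} \<Longrightarrow> fst (Y t) \<noteq> 0"
    "\<And>t. t \<in> {0<..<T} \<Longrightarrow> ((\<lambda>t. fst (Y t)) has_real_derivative 1 - snd (snd (Y t))) (at t)"
    "\<And>t. t \<in> {0<..<T} \<Longrightarrow> ((\<lambda>t. fst (snd (Y t))) has_real_derivative snd (snd (Y t))) (at t)"
    "\<And>t. t \<in> {0<..<T} \<Longrightarrow> ((\<lambda>t. snd (snd (Y t))) has_real_derivative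
        slope_speed n (fst (Y t)) (fst (snd (Y t))) (snd (snd (Y t)))) (at t)"
proof -
  have d: "(Y has_vector_derivative (1 - snd (snd (Y t)), snd (snd (Y t)),
      slope_speed n (fst (Y t)) (fst (snd (Y t))) (snd (snd (Y t))))) (at t)" if "t \<in> {0<..<T}" for t
    using assms that by (auto simp: ode_solution_def profile_field_def)
  show "\<And>t. t \<in> {0<..<T} \<Longrightarrow> ((\<lambda>t. fst (Y t)) has_real_derivative 1 - snd (snd (Y t))) (at t)"
    "\<And>t. t \<in> {0<..<T} \<Longrightarrow> ((\<lambda>t. fst (snd (Y t))) has_real_derivative snd (snd (Y t))) (at t)"
    "\<And>t. t \<in> {0<..<T} \<Longrightarrow> ((\<lambda>t. snd (snd (Y t))) has_real_derivative
        slope_speed n (fst (Y t)) (fst (snd (Y t))) (snd (snd (Y t)))) (at t)"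
    using has_real_derivative_components[OF d] by blast+
qed (use assms in \<open>auto simp: ode_solution_def image_subset_iff intro!: continuous_intros\<close>)

text \<open>The derivative of f may vanish or fail to exist at the endpoints, as happens to 1 - m at
  a vertical tangent; there the inverse is merely continuous.\<close>

lemma increasing_inverse:
  fixes f :: "real \<Rightarrow> real"
  assumes ab: "a < b" and cont: "continuous_on {a..b} f"
    and deriv: "\<And>x. x \<in> {a<..<b} \<Longrightarrow> (f has_real_derivative f' x) (at x)"
    and pos: "\<And>x. x \<in> {a<..<b} \<Longrightarrow> 0 < f' x"
  obtains \<phi> where "continuous_on {f a..f b} \<phi>" "\<And>x. x \<in> {a..b} \<Longrightarrow> \<phi> (f x) = x"
    "\<And>x. x \<in> {a<..<b} \<Longrightarrow> (\<phi> has_real_derivative inverse (f' x)) (at (f x))"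
    "\<And>x y. a \<le> x \<Longrightarrow> x < y \<Longrightarrow> y \<le> b \<Longrightarrow> f x < f y"
    "\<And>y. y \<in> {f a..f b} \<Longrightarrow> \<exists>x\<in>{a..b}. y = f x"
proof -
  have mono: "f x < f y" if "a \<le> x" "x < y" "y \<le> b" for x y
  proof (rule DERIV_pos_imp_increasing_open[OF that(2)])
    show "continuous_on {x..y} f" by (rule continuous_on_subset[OF cont]) (use that in auto)
    fix z assume "x < z" "z < y"
    then have "z \<in> {a<..<b}" using that by auto
    then show "\<exists>d. (f has_real_derivative d) (at z) \<and> 0 < d" using deriv pos by blast
  qed
  have inj: "inj_on f {a..b}"
    by (rule linorder_inj_onI) (use mono in \<open>fastforce dest: mono\<close>)+
  define \<phi> where "\<phi> = inv_into {a..b} f"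
  have inv: "\<phi> (f x) = x" if "x \<in> {a..b}" for x using that inj by (simp add: \<phi>_def)
  have surj: "\<exists>x\<in>{a..b}. y = f x" if "y \<in> {f a..f b}" for y
    using IVT'[of f a y b] that ab cont by fastforce
  have img: "f ` {a..b} = {f a..f b}"
  proof
    show "f ` {a..b} \<subseteq> {f a..f b}"
      using mono ab by (smt (verit) atLeastAtMost_iff image_subset_iff order_le_less)
  qed (use surj in blast)
  have cont\<phi>: "continuous_on {f a..f b} \<phi>"
    unfolding img[symmetric] by (rule continuous_on_inv[OF cont]) (use inv in auto)
  show thesis
  proof (rule that[OF cont\<phi> inv _ mono surj])
    fix x assume x: "x \<in> {a<..<b}"
    then have fx: "f a < f x" "f x < f b" using mono[of a x] mono[of x b] by auto
    show "(\<phi> has_real_derivative inverse (f' x)) (at (f x))"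
    proof (rule DERIV_inverse_function[where f = f and a = "f a" and b = "f b"])
      show "(f has_real_derivative f' x) (at (\<phi> (f x)))" using deriv[OF x] inv[of x] x by simp
      show "f (\<phi> y) = y" if "f a < y" "y < f b" for y using surj[of y] that inv by auto
      show "isCont \<phi> (f x)" using continuous_on_interior[OF cont\<phi>, of "f x"] fx by simp
    qed (use pos[OF x] fx in auto)
  qed auto
qed

section \<open>Correspondence between graphs with a horizontal point and trajectories\<close>

text \<open>The initial value of m = g' / (1 + g'); a vertical tangent corresponds to the limit
  1.\<close>

definition initial_slope :: "ereal \<Rightarrow> real" where
  "initial_slope C = (case C of ereal c \<Rightarrow> c / (1 + c) | PInfty \<Rightarrow> 1 | MInfty \<Rightarrow> 0)"

lemma initial_slope_bounds:
  assumes "0 < C"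
  shows "0 < initial_slope C" "initial_slope C \<le> 1" "C \<noteq> \<infinity> \<Longrightarrow> initial_slope C < 1"
  using assms by (cases C; simp add: initial_slope_def)+

text \<open>This is g'' / (1 + g')^3: with m = G / (1 + G) one has dm/dr = g'' / (1 + G)^2, and
  dr/dt = 1 / (1 + G).\<close>

lemma slope_speed_graph:
  assumes G: "1 + G \<noteq> 0"
  shows "slope_speed n r x (G / (1 + G)) =
    (1 + G\<^sup>2) * (profile_drift n r * G - x / 2) / ((1 + G)\<^sup>2 * (1 + G))"
proof -
  have 1: "1 - G / (1 + G) = 1 / (1 + G)" using G by (simp add: field_simps)
  have "slope_speed n r x (G / (1 + G))
      = ((G / (1 + G))\<^sup>2 + (1 / (1 + G))\<^sup>2) * (profile_drift n r * (G / (1 + G)) - x * (1 / (1 + G)) / 2)"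
    unfolding slope_speed_def 1 ..
  also have "(G / (1 + G))\<^sup>2 + (1 / (1 + G))\<^sup>2 = (1 + G\<^sup>2) / (1 + G)\<^sup>2"
    by (simp add: power_divide add_divide_distrib)
  also have "profile_drift n r * (G / (1 + G)) - x * (1 / (1 + G)) / 2 = (profile_drift n r * G - x / 2) / (1 + G)"
    by (simp add: diff_divide_distrib)
  finally show ?thesis by simp
qed

text \<open>Removes the distinction between finite and infinite slope: in both cases m = g' / (1 +
  g') has the limit \<open>initial_slope C\<close> at R from the right.\<close>

lemma profile_solution_graph:
  assumes sol: "profile_solution n C R b g" and C: "0 < C"
  shows "continuous_on {R..<b} g" "g R = 0" "R < b"
    "solves_profile_equation_on n {R<..<b} g"
    "((\<lambda>r. deriv g r / (1 + deriv g r)) \<longlongrightarrow> initial_slope C) (at_right R)"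
proof -
  show "g R = 0" "R < b" using sol by (auto simp: profile_solution_def)
  have *: "continuous (at_right R) g \<and> solves_profile_equation_on n {R<..<b} g \<and>
      ((\<lambda>r. deriv g r / (1 + deriv g r)) \<longlongrightarrow> initial_slope C) (at_right R)"
  proof (cases C)
    case (real c)
    then obtain a where a: "a < R" "solves_profile_equation_on n {a<..<b} g" "deriv g R = c"
      using sol by (auto simp: profile_solution_def)
    then have R: "g field_differentiable at R" "deriv g field_differentiable at R"
      using \<open>R < b\<close> by (auto simp: solves_profile_equation_on_def)
    have "(deriv g \<longlongrightarrow> c) (at R)"
      using field_differentiable_imp_continuous_at[OF R(2)] a(3) by (simp add: isCont_def)
    then have "(deriv g \<longlongrightarrow> c) (at_right R)" by (rule filterlim_at_split[THEN iffD1, THEN conjunct2])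
    then have "((\<lambda>r. deriv g r / (1 + deriv g r)) \<longlongrightarrow> c / (1 + c)) (at_right R)"
      using C real by (intro tendsto_intros) auto
    moreover have "continuous (at_right R) g"
      using field_differentiable_imp_continuous_at[OF R(1)] continuous_at_imp_continuous_within by blast
    moreover have "solves_profile_equation_on n {R<..<b} g"
      using a by (auto simp: solves_profile_equation_on_def)
    ultimately show ?thesis by (simp add: real initial_slope_def)
  next
    case PInf
    then have **: "continuous (at_right R) g" "solves_profile_equation_on n {R<..<b} g"
      and lim: "filterlim (deriv g) at_top (at_right R)"
      using sol by (auto simp: profile_solution_def)
    have "((\<lambda>x::real. x / (1 + x)) \<longlongrightarrow> 1) at_top" by real_asymp
    from filterlim_compose[OF this lim] show ?thesis using ** by (simp add: PInf initial_slope_def)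
  qed (use C in auto)
  then have cR: "continuous (at_right R) g" by simp
  show "solves_profile_equation_on n {R<..<b} g"
    "((\<lambda>r. deriv g r / (1 + deriv g r)) \<longlongrightarrow> initial_slope C) (at_right R)"
    using * by auto
  show "continuous_on {R..<b} g"
    unfolding continuous_on_eq_continuous_within
  proof
    fix r assume r: "r \<in> {R..<b}"
    show "continuous (at r within {R..<b}) g"
    proof (cases "r = R")
      case True
      have "at R within {R..<b} \<le> at_right R"
        unfolding at_within_def by (intro inf.mono) auto
      then show ?thesis
        using cR \<open>R < b\<close> True filterlim_mono[OF _ order_refl] by (auto simp: continuous_within)
    next
      case False
      then have "g field_differentiable at r"
        using \<open>solves_profile_equation_on n {R<..<b} g\<close> r by (auto simp: solves_profile_equation_on_def)
      then show ?thesis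
        using continuous_at_imp_continuous_within field_differentiable_imp_continuous_at by blast
    qed
  qed
qed

text \<open>The graph is parametrized by the time \<sigma>(r) = r - R + g(r), which increases as
  long as 1 + g' > 0. The curve is continued a little beyond the horizontal point, so that S < T and
  the zero of m is crossed at an interior time.\<close>

lemma trajectory_of_portion:
  assumes hp: "horizontal_portion n C R g \<rho>" and C: "0 < C" and R: "R \<noteq> 0"
  obtains T S Y where "0 < S" "S < T" "trajectory n T Y" "Y 0 = (R, 0, initial_slope C)" "Y S = (\<rho>, g \<rho>, 0)"
    "\<And>t. t \<in> {0<..<S} \<Longrightarrow> 0 < snd (snd (Y t)) \<and> snd (snd (Y t)) < 1"
    "\<And>t. t \<in> {0<..S} \<Longrightarrow> R < fst (Y t) \<and> fst (Y t) \<le> \<rho> \<and> fst (snd (Y t)) = g (fst (Y t)) \<and>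
       deriv g (fst (Y t)) = snd (snd (Y t)) / (1 - snd (snd (Y t))) \<and>
       deriv (deriv g) (fst (Y t)) = (1 + (deriv g (fst (Y t)))\<^sup>2) *
         (profile_drift n (fst (Y t)) * deriv g (fst (Y t)) - g (fst (Y t)) / 2)"
proof -
  obtain b where b: "\<rho> < b" "profile_solution n C R b g" and R\<rho>: "R < \<rho>"
    and nonneg: "\<And>r. R < r \<Longrightarrow> r \<le> \<rho> \<Longrightarrow> 0 \<le> g r \<and> 0 \<le> deriv g r" and horiz: "deriv g \<rho> = 0"
    using hp by (auto simp: horizontal_portion_def)
  note gr = profile_solution_graph[OF b(2) C]
  define G where "G = deriv g"
  have nz: "r \<noteq> 0" and dg: "(g has_real_derivative G r) (at r)"
    and dG: "(G has_real_derivative (1 + (G r)\<^sup>2) * (profile_drift n r * G r - g r / 2)) (at r)"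
    if "R < r" "r < b" for r
  proof -
    have *: "r \<noteq> 0" "g field_differentiable at r" "deriv g field_differentiable at r"
      "deriv (deriv g) r / (1 + (deriv g r)\<^sup>2) = profile_drift n r * deriv g r - g r / 2"
      using gr(4) that by (auto simp: solves_profile_equation_on_def)
    show "r \<noteq> 0" by fact
    show "(g has_real_derivative G r) (at r)"
      using *(2) by (simp add: G_def DERIV_deriv_iff_field_differentiable)
    have "1 + (deriv g r)\<^sup>2 \<noteq> 0" by (metis add_eq_0_iff not_one_le_zero power2_eq_square sum_power2_eq_zero_iff zero_neq_one power_one)
    then have "deriv (deriv g) r = (1 + (G r)\<^sup>2) * (profile_drift n r * G r - g r / 2)"
      using *(4) by (simp add: G_def field_simps)
    then show "(G has_real_derivative (1 + (G r)\<^sup>2) * (profile_drift n r * G r - g r / 2)) (at r)"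
      using *(3) by (metis DERIV_deriv_iff_field_differentiable G_def)
  qed
  have "isCont G \<rho>" using dG[of \<rho>] R\<rho> b(1) DERIV_isCont by blast
  then obtain e where e: "0 < e" "\<And>r. dist r \<rho> < e \<Longrightarrow> dist (G r) (G \<rho>) < 1 / 2"
    unfolding continuous_at_eps_delta by (metis half_gt_zero zero_less_one)
  \<comment> \<open>Beyond \<rho> the slope becomes negative; up to \<open>b'\<close> it stays above
    -1 / 2, so \<sigma> still increases.\<close>
  define b' where "b' = \<rho> + min (e / 2) ((b - \<rho>) / 2)"
  have b': "\<rho> < b'" "b' < b" using e(1) b(1) by (auto simp: b'_def min_def field_simps)
  have G1: "0 < 1 + G r" if "R < r" "r \<le> b'" for r
  proof (cases "r \<le> \<rho>")
    case True then show ?thesis using nonneg[of r] that by (simp add: G_def)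
  next
    case False
    have "b' \<le> \<rho> + e / 2" by (simp add: b'_def)
    then have "dist r \<rho> < e" using that e(1) False by (simp add: dist_real_def)
    then have "dist (G r) 0 < 1 / 2" using e(2)[of r] horiz by (simp add: G_def)
    then show ?thesis by (simp add: dist_real_def)
  qed
  define \<sigma> where "\<sigma> = (\<lambda>r. r - R + g r)"
  have cg: "continuous_on {R..b'} g" by (rule continuous_on_subset[OF gr(1)]) (use b' in auto)
  have c\<sigma>: "continuous_on {R..b'} \<sigma>" unfolding \<sigma>_def by (intro continuous_intros cg)
  have d\<sigma>: "(\<sigma> has_real_derivative 1 + G r) (at r)" if "r \<in> {R<..<b'}" for r
    unfolding \<sigma>_def using that b' by (auto intro!: derivative_eq_intros dg)
  obtain \<phi> where \<phi>: "continuous_on {\<sigma> R..\<sigma> b'} \<phi>" "\<And>x. x \<in> {R..b'} \<Longrightarrow> \<phi> (\<sigma> x) = x"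
    "\<And>x. x \<in> {R<..<b'} \<Longrightarrow> (\<phi> has_real_derivative inverse (1 + G x)) (at (\<sigma> x))"
    "\<And>x y. R \<le> x \<Longrightarrow> x < y \<Longrightarrow> y \<le> b' \<Longrightarrow> \<sigma> x < \<sigma> y"
    "\<And>y. y \<in> {\<sigma> R..\<sigma> b'} \<Longrightarrow> \<exists>x\<in>{R..b'}. y = \<sigma> x"
    by (rule increasing_inverse[OF _ c\<sigma> d\<sigma>]) (use R\<rho> b' G1 in auto)
  have \<sigma>R: "\<sigma> R = 0" by (simp add: \<sigma>_def gr(2))
  \<comment> \<open>At R the value is the limit from the right, which makes M continuous even where
    g' is infinite.\<close>
  define M where "M = (\<lambda>r. if r = R then initial_slope C else G r / (1 + G r))"
  have dM: "(M has_real_derivative ((1 + (G r)\<^sup>2) * (profile_drift n r * G r - g r / 2)) / (1 + G r)\<^sup>2) (at r)"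
    if "r \<in> {R<..b'}" for r
  proof (rule has_field_derivative_transform_within_open[where S = "{R<..}"])
    let ?d = "(1 + (G r)\<^sup>2) * (profile_drift n r * G r - g r / 2)"
    have d: "(G has_real_derivative ?d) (at r)" using dG[of r] that b' by simp
    have "1 + G r \<noteq> 0" using G1[of r] that by auto
    have eq: "d * (1 + a) - a * (0 + d) = d" for a d :: real by (simp add: algebra_simps)
    show "((\<lambda>r. G r / (1 + G r)) has_real_derivative ?d / (1 + G r)\<^sup>2) (at r)"
      using DERIV_divide[OF d DERIV_add[OF DERIV_const d] \<open>1 + G r \<noteq> 0\<close>]
      unfolding eq power2_eq_square[of "1 + G r"] .
  qed (use that in \<open>auto simp: M_def\<close>)
  have cM: "continuous_on {R..b'} M"
    unfolding continuous_on_eq_continuous_within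
  proof
    fix r assume r: "r \<in> {R..b'}"
    show "continuous (at r within {R..b'}) M"
    proof (cases "r = R")
      case True
      have "(M \<longlongrightarrow> initial_slope C) (at_right R)"
        using gr(5) by (rule Lim_transform_eventually)
          (auto simp: M_def G_def eventually_at_right_less[THEN eventually_mono])
      then show ?thesis
        using True R\<rho> b' by (simp add: continuous_within at_within_Icc_at_right M_def)
    next
      case False
      then have "isCont M r" using DERIV_isCont[OF dM] r by simp
      then show ?thesis by (rule continuous_at_imp_continuous_within)
    qed
  qed
  define T where "T = \<sigma> b'"
  define S where "S = \<sigma> \<rho>"
  define Y where "Y = (\<lambda>t. (\<phi> t, g (\<phi> t), M (\<phi> t)))"
  have im: "\<exists>r\<in>{R..b'}. t = \<sigma> r" if "t \<in> {0..T}" for t using \<phi>(5)[of t] that by (simp add: \<sigma>R T_def)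
  have im': "\<exists>r\<in>{R<..<b'}. t = \<sigma> r" if t: "t \<in> {0<..<T}" for t
  proof -
    obtain r where "r \<in> {R..b'}" "t = \<sigma> r" using im[of t] t by auto
    moreover have "r \<noteq> R" "r \<noteq> b'" using \<open>t = \<sigma> r\<close> t \<sigma>R by (auto simp: T_def)
    ultimately show ?thesis by auto
  qed
  have Y\<sigma>: "Y (\<sigma> r) = (r, g r, M r)" if "r \<in> {R..b'}" for r using \<phi>(2)[OF that] by (simp add: Y_def)
  have traj: "trajectory n T Y"
    unfolding ode_solution_def
  proof (intro conjI ballI)
    have "\<phi> ` {0..T} \<subseteq> {R..b'}" using im \<phi>(2) by fastforce
    then show "continuous_on {0..T} Y"
      unfolding Y_def using \<phi>(1)
      by (intro continuous_intros continuous_on_compose2[OF cg] continuous_on_compose2[OF cM]) (auto simp: \<sigma>R T_def)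
    show "Y ` {0..T} \<subseteq> {y. fst y \<noteq> 0}"
    proof
      fix y assume "y \<in> Y ` {0..T}"
      then obtain t where t: "t \<in> {0..T}" "y = Y t" by blast
      then obtain r where r: "r \<in> {R..b'}" "t = \<sigma> r" using im by blast
      then have "r \<noteq> 0" using nz[of r] b' R by (cases "r = R") auto
      then show "y \<in> {y. fst y \<noteq> 0}" using t r Y\<sigma> by simp
    qed
    fix t assume "t \<in> {0<..<T}"
    then obtain r where r: "r \<in> {R<..<b'}" "t = \<sigma> r" using im' by blast
    have G1r: "1 + G r \<noteq> 0" using G1[of r] r by auto
    have Mr: "M r = G r / (1 + G r)" using r by (simp add: M_def)
    have \<phi>r: "\<phi> t = r" using \<phi>(2)[of r] r by simp
    have d1: "(\<phi> has_real_derivative inverse (1 + G r)) (at t)" using \<phi>(3)[OF r(1)] r(2) by simp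
    have d2: "((\<lambda>t. g (\<phi> t)) has_real_derivative G r * inverse (1 + G r)) (at t)"
      by (rule DERIV_chain2[OF _ d1]) (use dg[of r] r b' \<phi>r in auto)
    have d3: "((\<lambda>t. M (\<phi> t)) has_real_derivative ((1 + (G r)\<^sup>2) * (profile_drift n r * G r - g r / 2)) / (1 + G r)\<^sup>2 * inverse (1 + G r)) (at t)"
      by (rule DERIV_chain2[OF _ d1]) (use dM[of r] r \<phi>r in auto)
    have "(Y has_vector_derivative (inverse (1 + G r), G r * inverse (1 + G r),
        ((1 + (G r)\<^sup>2) * (profile_drift n r * G r - g r / 2)) / (1 + G r)\<^sup>2 * inverse (1 + G r))) (at t)"
      unfolding Y_def
      using d1 d2 d3 by (intro has_vector_derivative_Pair) (auto simp: has_real_derivative_iff_has_vector_derivative)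
    moreover have "profile_field n (Y t) = (inverse (1 + G r), G r * inverse (1 + G r),
        ((1 + (G r)\<^sup>2) * (profile_drift n r * G r - g r / 2)) / (1 + G r)\<^sup>2 * inverse (1 + G r))"
      using G1r by (simp add: Y_def \<phi>r profile_field_def Mr slope_speed_graph divide_inverse[symmetric])
        (simp add: field_simps)
    ultimately show "(Y has_vector_derivative profile_field n (Y t)) (at t)" by simp
  qed
  have G_pos: "0 < G r" if r: "R < r" "r < \<rho>" for r
  proof -
    \<comment> \<open>The initial value of m is positive, so g' > 0 just to the right of R; together
      with g' >= 0 afterwards this yields g > 0.\<close>
    have "\<forall>\<^sub>F u in at_right R. 0 < G u / (1 + G u)"
      using order_tendstoD(1)[OF gr(5), of 0] initial_slope_bounds(1)[OF C] by (simp add: G_def)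
    then obtain u where u: "R < u" "\<And>w. R < w \<Longrightarrow> w < u \<Longrightarrow> 0 < G w / (1 + G w)"
      unfolding eventually_at_right_field by auto
    define w where "w = min ((R + u) / 2) ((R + r) / 2)"
    have w: "R < w" "w < u" "w < r" using u(1) r by (auto simp: w_def min_def field_simps)
    have "g R < g w"
    proof (rule DERIV_pos_imp_increasing_open[OF w(1)])
      show "continuous_on {R..w} g" by (rule continuous_on_subset[OF cg]) (use w r b' in auto)
      fix v assume v: "R < v" "v < w"
      then have "0 < G v" using u(2)[of v] G1[of v] w r b' by (simp add: zero_less_divide_iff)
      then show "\<exists>y. (g has_real_derivative y) (at v) \<and> 0 < y" using dg[of v] v w r b by auto
    qed
    also have "g w \<le> g r"
    proof (rule DERIV_nonneg_imp_increasing_open[where f = g])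
      show "continuous_on {w..r} g" by (rule continuous_on_subset[OF cg]) (use w r b' in auto)
      fix v assume v: "w < v" "v < r"
      then show "\<exists>y. (g has_real_derivative y) (at v) \<and> 0 \<le> y"
        using dg[of v] nonneg[of v] w r b by (auto simp: G_def)
    qed (use w in auto)
    finally have gr_pos: "0 < g r" by (simp add: gr(2))
    \<comment> \<open>A zero of g' before \<rho> would have g'' = -g / 2 < 0 there, so g' would be
      negative right after it, still within the portion.\<close>
    have "G r \<noteq> 0"
    proof
      assume G0: "G r = 0"
      then have "(G has_real_derivative - g r / 2) (at r)" using dG[of r] r b by simp
      from DERIV_neg_dec_right[OF this] gr_pos
      obtain d where d: "0 < d" "\<And>h. 0 < h \<Longrightarrow> h < d \<Longrightarrow> G (r + h) < G r" by auto
      define h where "h = min (d / 2) ((\<rho> - r) / 2)"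
      have h: "0 < h" "h < d" "r + h \<le> \<rho>" using d(1) r by (auto simp: h_def min_def field_simps)
      then have "G (r + h) < 0" using d(2)[of h] G0 by simp
      then show False using nonneg[of "r + h"] h r by (simp add: G_def)
    qed
    then show ?thesis using nonneg[of r] r by (simp add: G_def)
  qed
  have MG: "G r = M r / (1 - M r)" if "R < r" "r \<le> b'" for r
  proof -
    have "1 - M r = 1 / (1 + G r)" using G1[OF that] that by (simp add: M_def field_simps)
    then show ?thesis using G1[OF that] that by (simp add: M_def)
  qed
  show thesis
  proof (rule that[of S T Y])
    show "0 < S" "S < T" using \<phi>(4)[of R \<rho>] \<phi>(4)[of \<rho> b'] R\<rho> b' by (auto simp: S_def T_def \<sigma>R)
    show "trajectory n T Y" by fact
    show "Y 0 = (R, 0, initial_slope C)" using Y\<sigma>[of R] R\<rho> b' by (simp add: \<sigma>R M_def gr(2))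
    show "Y S = (\<rho>, g \<rho>, 0)" using Y\<sigma>[of \<rho>] R\<rho> b' horiz by (simp add: S_def M_def G_def)
    have imS: "\<exists>r\<in>{R<..\<rho>}. t = \<sigma> r \<and> (t < S \<longrightarrow> r < \<rho>)" if t: "t \<in> {0<..S}" for t
    proof -
      have "t \<in> {0..T}" using t \<open>S < T\<close> by auto
      then obtain r where r: "r \<in> {R..b'}" "t = \<sigma> r" using im by blast
      have "r \<noteq> R" using r t \<sigma>R by auto
      moreover have "r \<le> \<rho>" using \<phi>(4)[of \<rho> r] r t R\<rho> by (fastforce simp: S_def not_le)
      moreover have "t < S \<longrightarrow> r \<noteq> \<rho>" using r by (auto simp: S_def)
      ultimately show ?thesis using r by force
    qed
    show "0 < snd (snd (Y t)) \<and> snd (snd (Y t)) < 1" if t: "t \<in> {0<..<S}" for t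
    proof -
      obtain r where r: "R < r" "r < \<rho>" "t = \<sigma> r" using imS[of t] t by auto
      then show ?thesis using Y\<sigma>[of r] G_pos[of r] b' by (simp add: M_def)
    qed
    show "R < fst (Y t) \<and> fst (Y t) \<le> \<rho> \<and> fst (snd (Y t)) = g (fst (Y t)) \<and>
       deriv g (fst (Y t)) = snd (snd (Y t)) / (1 - snd (snd (Y t))) \<and>
       deriv (deriv g) (fst (Y t)) = (1 + (deriv g (fst (Y t)))\<^sup>2) *
         (profile_drift n (fst (Y t)) * deriv g (fst (Y t)) - g (fst (Y t)) / 2)"
      if t: "t \<in> {0<..S}" for t
    proof -
      obtain r where r: "R < r" "r \<le> \<rho>" "t = \<sigma> r" using imS[OF t] by auto
      then have Yt: "Y t = (r, g r, M r)" using Y\<sigma>[of r] b' by simp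
      show ?thesis using r MG[of r] b b' DERIV_imp_deriv[OF dG[of r]]
        unfolding Yt by (simp add: G_def)
    qed
  qed
qed

text \<open>Converse of the parametrization by \<sigma>: where m < 1 the abscissa increases and the
  curve is a graph. At the endpoints m = 1 is allowed, and the start a may be negative; these serve
  infinite and finite initial slope respectively. The inverse \<phi> is exported for the limit of g'
  at a vertical tangent.\<close>

lemma profile_graph_of_curve:
  fixes r x m :: "real \<Rightarrow> real"
  assumes ab: "a < b"
    and cr: "continuous_on {a..b} r" and cx: "continuous_on {a..b} x" and cm: "continuous_on {a..b} m"
    and dr: "\<And>t. t \<in> {a<..<b} \<Longrightarrow> (r has_real_derivative 1 - m t) (at t)"
    and dx: "\<And>t. t \<in> {a<..<b} \<Longrightarrow> (x has_real_derivative m t) (at t)"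
    and dm: "\<And>t. t \<in> {a<..<b} \<Longrightarrow> (m has_real_derivative slope_speed n (r t) (x t) (m t)) (at t)"
    and m1: "\<And>t. t \<in> {a<..<b} \<Longrightarrow> m t < 1" and nz: "\<And>t. t \<in> {a<..<b} \<Longrightarrow> r t \<noteq> 0"
  obtains g \<phi> where "continuous_on {r a..r b} g" "\<And>t. t \<in> {a..b} \<Longrightarrow> g (r t) = x t"
    "solves_profile_equation_on n {r a<..<r b} g"
    "\<And>t. t \<in> {a<..<b} \<Longrightarrow> deriv g (r t) = m t / (1 - m t)"
    "\<And>s t. a \<le> s \<Longrightarrow> s < t \<Longrightarrow> t \<le> b \<Longrightarrow> r s < r t"
    "\<And>y. y \<in> {r a..r b} \<Longrightarrow> \<exists>t\<in>{a..b}. y = r t"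
    "continuous_on {r a..r b} \<phi>" "\<And>t. t \<in> {a..b} \<Longrightarrow> \<phi> (r t) = t"
proof -
  obtain \<phi> where \<phi>: "continuous_on {r a..r b} \<phi>" "\<And>t. t \<in> {a..b} \<Longrightarrow> \<phi> (r t) = t"
    "\<And>t. t \<in> {a<..<b} \<Longrightarrow> (\<phi> has_real_derivative inverse (1 - m t)) (at (r t))"
    "\<And>s t. a \<le> s \<Longrightarrow> s < t \<Longrightarrow> t \<le> b \<Longrightarrow> r s < r t"
    "\<And>y. y \<in> {r a..r b} \<Longrightarrow> \<exists>t\<in>{a..b}. y = r t"
    by (rule increasing_inverse[OF ab cr dr]) (use m1 in auto)
  define g where "g = (\<lambda>y. x (\<phi> y))"
  define G where "G = (\<lambda>y. m (\<phi> y) / (1 - m (\<phi> y)))"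
  have im: "\<exists>t\<in>{a<..<b}. y = r t" if y: "y \<in> {r a<..<r b}" for y
  proof -
    obtain t where "t \<in> {a..b}" "y = r t" using \<phi>(5)[of y] y by auto
    moreover have "t \<noteq> a" "t \<noteq> b" using \<open>y = r t\<close> y by auto
    ultimately show ?thesis by auto
  qed
  have "\<phi> ` {r a..r b} \<subseteq> {a..b}" using \<phi>(2,5) by fastforce
  then have cg: "continuous_on {r a..r b} g"
    unfolding g_def by (intro continuous_on_compose2[OF cx \<phi>(1)])
  have gr: "g (r t) = x t" if "t \<in> {a..b}" for t using \<phi>(2)[OF that] by (simp add: g_def)
  have dg: "(g has_real_derivative G (r t)) (at (r t))" if t: "t \<in> {a<..<b}" for t
  proof -
    have "(g has_real_derivative m t * inverse (1 - m t)) (at (r t))"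
      unfolding g_def by (rule DERIV_chain2[OF _ \<phi>(3)[OF t]]) (use dx[OF t] \<phi>(2)[of t] t in auto)
    then show ?thesis using \<phi>(2)[of t] t by (simp add: G_def divide_inverse)
  qed
  have dG: "(G has_real_derivative (1 + (G (r t))\<^sup>2) * (profile_drift n (r t) * G (r t) - x t / 2)) (at (r t))"
    if t: "t \<in> {a<..<b}" for t
  proof -
    let ?M = "m t" and ?s = "slope_speed n (r t) (x t) (m t)"
    have nz': "1 - ?M \<noteq> 0" using m1[OF t] by simp
    have \<phi>t: "\<phi> (r t) = t" using \<phi>(2)[of t] t by simp
    have Gt: "G (r t) = ?M / (1 - ?M)" by (simp add: G_def \<phi>t)
    have "((\<lambda>y. m (\<phi> y)) has_real_derivative ?s * inverse (1 - ?M)) (at (r t))"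
      by (rule DERIV_chain2[OF _ \<phi>(3)[OF t]]) (use dm[OF t] \<phi>t in auto)
    from DERIV_divide[OF this DERIV_diff[OF DERIV_const this]]
    have "(G has_real_derivative (?s * inverse (1 - ?M) * (1 - ?M) - ?M * (0 - ?s * inverse (1 - ?M)))
        / ((1 - ?M) * (1 - ?M))) (at (r t))"
      using nz' by (simp add: G_def \<phi>t)
    also have "?s * inverse (1 - ?M) * (1 - ?M) - ?M * (0 - ?s * inverse (1 - ?M)) = ?s * inverse (1 - ?M)"
      by (simp add: algebra_simps)
    also have "?s * inverse (1 - ?M) / ((1 - ?M) * (1 - ?M))
        = (1 + (G (r t))\<^sup>2) * (profile_drift n (r t) * G (r t) - x t / 2)"
    proof -
      have 1: "1 + G (r t) = inverse (1 - ?M)" using nz' by (simp add: Gt field_simps)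
      then have 2: "1 + G (r t) \<noteq> 0" using nz' by simp
      have "?M = G (r t) / (1 + G (r t))" using nz' by (simp only: 1) (simp add: Gt)
      then have "?s = (1 + (G (r t))\<^sup>2) * (profile_drift n (r t) * G (r t) - x t / 2) / ((1 + G (r t))\<^sup>2 * (1 + G (r t)))"
        using slope_speed_graph[OF 2] by metis
      moreover have "?s * inverse (1 - ?M) / ((1 - ?M) * (1 - ?M)) = ?s * ((1 + G (r t))\<^sup>2 * (1 + G (r t)))"
        unfolding 1 by (simp add: power2_eq_square divide_inverse mult.assoc)
      ultimately show ?thesis using 2 by simp
    qed
    finally show ?thesis .
  qed
  have derivg: "deriv g y = G y" if "y \<in> {r a<..<r b}" for y
    using im[OF that] dg DERIV_imp_deriv by blast
  have dderivg: "(deriv g has_real_derivative (1 + (G (r t))\<^sup>2) * (profile_drift n (r t) * G (r t) - x t / 2)) (at (r t))"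
    if t: "t \<in> {a<..<b}" for t
  proof (rule has_field_derivative_transform_within_open[OF dG[OF t]])
    show "r t \<in> {r a<..<r b}" using t \<phi>(4)[of a t] \<phi>(4)[of t b] by auto
  qed (auto simp: derivg)
  show thesis
  proof (rule that[OF cg gr _ _ \<phi>(4) \<phi>(5) \<phi>(1) \<phi>(2)])
    show "solves_profile_equation_on n {r a<..<r b} g"
      unfolding solves_profile_equation_on_def
    proof
      fix y assume y: "y \<in> {r a<..<r b}"
      then obtain t where t: "t \<in> {a<..<b}" "y = r t" using im by blast
      have "g y = x t" using gr[of t] t by simp
      moreover have "1 + (G y)\<^sup>2 \<noteq> 0" by (smt (verit) zero_le_power2)
      ultimately have "deriv (deriv g) y / (1 + (deriv g y)\<^sup>2) = profile_drift n y * deriv g y - g y / 2"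
        using DERIV_imp_deriv[OF dderivg[OF t(1)]] derivg[OF y] t(2) by simp
      then show "y \<noteq> 0 \<and> g field_differentiable at y \<and> deriv g field_differentiable at y \<and>
          deriv (deriv g) y / (1 + (deriv g y)\<^sup>2) = profile_drift n y * deriv g y - g y / 2"
        using nz[OF t(1)] dg[OF t(1)] dderivg[OF t(1)] unfolding t(2) field_differentiable_def by blast
    qed
    show "deriv g (r t) = m t / (1 - m t)" if t: "t \<in> {a<..<b}" for t
      using derivg[of "r t"] t \<phi>(4)[of a t] \<phi>(4)[of t b] \<phi>(2)[of t] by (simp add: G_def)
  qed auto
qed

text \<open>The bound m < 1 is required up to T > S, as the solution must exist beyond its
  horizontal point. For finite slope the curve is first continued backwards, since the solution has
  to be regular around R; for infinite slope the graph over the forward curve suffices and g' tends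
  to infinity because 1 - m tends to 0 from above.\<close>

lemma portion_of_trajectory:
  assumes Y: "trajectory n T Y" and d0: "(Y has_vector_derivative profile_field n (Y 0)) (at 0 within {0..T})"
    and init: "Y 0 = (R, 0, initial_slope C)" and C: "0 < C" and S: "0 < S" "S < T"
    and mS: "snd (snd (Y S)) = 0" and m0: "\<And>t. t \<in> {0<..<S} \<Longrightarrow> 0 < snd (snd (Y t))"
    and m1: "\<And>t. t \<in> {0<..T} \<Longrightarrow> snd (snd (Y t)) < 1"
  shows "\<exists>g. horizontal_portion n C R g (fst (Y S))"
proof -
  define r where "r t = fst (Y t)" for t
  define x where "x t = fst (snd (Y t))" for t
  define m where "m t = snd (snd (Y t))" for t
  note comp = trajectory_components[OF Y, folded r_def x_def m_def]
  have T: "0 < T" using S by simp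
  have x_nonneg: "0 \<le> x t" if t: "t \<in> {0..S}" for t
  proof -
    have "x 0 \<le> x t"
    proof (rule DERIV_nonneg_imp_increasing_open[where f = x])
      show "continuous_on {0..t} x" by (rule continuous_on_subset[OF comp(2)]) (use t S in auto)
      fix s assume "0 < s" "s < t"
      then show "\<exists>y. (x has_real_derivative y) (at s) \<and> 0 \<le> y"
        using comp(6)[of s] m0[of s] t S by (auto simp: m_def intro!: exI[of _ "m s"])
    qed (use t in auto)
    then show ?thesis using init by (simp add: x_def)
  qed
  have m_slope: "0 \<le> m t / (1 - m t)" if t: "t \<in> {0<..S}" for t
    using m0[of t] m1[of t] mS t S by (cases "t = S") (auto simp: m_def)
  have goal: ?thesis if sol: "profile_solution n C R (r T) g" and gr: "\<And>t. t \<in> {0..T} \<Longrightarrow> g (r t) = x t"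
    and dg: "\<And>t. t \<in> {0<..<T} \<Longrightarrow> deriv g (r t) = m t / (1 - m t)"
    and mono: "\<And>s t. 0 \<le> s \<Longrightarrow> s < t \<Longrightarrow> t \<le> T \<Longrightarrow> r s < r t"
    and surj: "\<And>y. y \<in> {r 0..r T} \<Longrightarrow> \<exists>t\<in>{0..T}. y = r t" for g
  proof (rule exI[of _ g])
    have rR: "r 0 = R" using init by (simp add: r_def)
    show "horizontal_portion n C R g (fst (Y S))"
      unfolding horizontal_portion_def r_def[symmetric]
    proof (intro conjI ballI)
      show "R < r S" using mono[of 0 S] S rR by simp
      show "\<exists>b>r S. profile_solution n C R b g" using sol mono[of S T] S by auto
      show "deriv g (r S) = 0" using dg[of S] S mS by (simp add: m_def)
      fix y assume y: "y \<in> {R<..r S}"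
      then have "y \<in> {r 0..r T}" using mono[of S T] S rR by auto
      then obtain t where t: "t \<in> {0..T}" "y = r t" using surj by blast
      have "t \<noteq> 0" using t y rR by auto
      moreover have "t \<le> S"
      proof (rule ccontr)
        assume "\<not> t \<le> S"
        then have "r S < r t" using mono[of S t] t S by simp
        then show False using t y by simp
      qed
      ultimately have "t \<in> {0<..S}" using t by auto
      then show "0 \<le> g y" "0 \<le> deriv g y"
        using gr[OF t(1)] dg[of t] x_nonneg[of t] m_slope[of t] t(2) S by auto
    qed
  qed
  show ?thesis
  proof (cases C)
    case (real c)
    have c: "0 < c" using C real by simp
    have m00: "m 0 = c / (1 + c)" using init real by (simp add: m_def initial_slope_def)
    obtain \<tau>0 Z where Z: "0 < \<tau>0" "continuous_on {-\<tau>0..T} Z" "\<And>t. t \<in> {0..T} \<Longrightarrow> Z t = Y t"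
      "\<And>t. t \<in> {-\<tau>0..T} \<Longrightarrow> Z t \<in> {y. fst y \<noteq> 0}"
      "\<And>t. t \<in> {-\<tau>0<..<T} \<Longrightarrow> (Z has_vector_derivative profile_field n (Z t)) (at t)"
      by (rule profile.backward_extension[OF Y T d0]) blast
    define mz where "mz = (\<lambda>t. snd (snd (Z t)))"
    have cmz: "continuous_on {-\<tau>0..T} mz" unfolding mz_def by (intro continuous_intros Z(2))
    have "mz 0 < 1" using Z(3)[of 0] T m00 c by (simp add: mz_def m_def)
    then obtain e where e: "0 < e" "\<And>t. t \<in> {-\<tau>0..T} \<Longrightarrow> dist t 0 < e \<Longrightarrow> dist (mz t) (mz 0) < 1 - mz 0"
      using cmz Z(1) T unfolding continuous_on_iff
      by (metis add_nonneg_nonneg atLeastAtMost_iff diff_gt_0_iff_gt less_eq_real_def neg_le_0_iff_le)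
    \<comment> \<open>Short enough for m < 1 to persist before time 0, so that the backward piece is
      a graph as well.\<close>
    define \<tau> where "\<tau> = min \<tau>0 (e / 2)"
    have \<tau>: "0 < \<tau>" "\<tau> \<le> \<tau>0" "\<tau> < e" using e(1) Z(1) by (auto simp: \<tau>_def)
    have mz1: "mz t < 1" if t: "t \<in> {-\<tau><..<T}" for t
    proof (cases "0 < t")
      case True then show ?thesis using m1[of t] Z(3)[of t] t by (simp add: mz_def)
    next
      case False
      then have "dist (mz t) (mz 0) < 1 - mz 0" using e(2)[of t] t \<tau> by (simp add: dist_real_def)
      then show ?thesis by (simp add: dist_real_def)
    qed
    have dZ: "((\<lambda>t. fst (Z t)) has_real_derivative 1 - mz t) (at t)"
      "((\<lambda>t. fst (snd (Z t))) has_real_derivative mz t) (at t)"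
      "(mz has_real_derivative slope_speed n (fst (Z t)) (fst (snd (Z t))) (mz t)) (at t)"
      if "t \<in> {-\<tau><..<T}" for t
    proof -
      have "(Z has_vector_derivative (1 - mz t, mz t, slope_speed n (fst (Z t)) (fst (snd (Z t))) (mz t))) (at t)"
        using Z(5)[of t] that \<tau> by (simp add: profile_field_def mz_def)
      from has_real_derivative_components[OF this]
      show "((\<lambda>t. fst (Z t)) has_real_derivative 1 - mz t) (at t)"
        "((\<lambda>t. fst (snd (Z t))) has_real_derivative mz t) (at t)"
        "(mz has_real_derivative slope_speed n (fst (Z t)) (fst (snd (Z t))) (mz t)) (at t)"
        by (auto simp: mz_def[abs_def])
    qed
    have cZ: "continuous_on {-\<tau>..T} Z" by (rule continuous_on_subset[OF Z(2)]) (use \<tau> in auto)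
    have \<tau>T: "- \<tau> < T" using \<tau>(1) T by simp
    obtain g \<phi> where g: "\<And>t. t \<in> {-\<tau>..T} \<Longrightarrow> g (fst (Z t)) = fst (snd (Z t))"
      "solves_profile_equation_on n {fst (Z (-\<tau>))<..<fst (Z T)} g"
      "\<And>t. t \<in> {-\<tau><..<T} \<Longrightarrow> deriv g (fst (Z t)) = mz t / (1 - mz t)"
      "\<And>s t. -\<tau> \<le> s \<Longrightarrow> s < t \<Longrightarrow> t \<le> T \<Longrightarrow> fst (Z s) < fst (Z t)"
      "\<And>y. y \<in> {fst (Z (-\<tau>))..fst (Z T)} \<Longrightarrow> \<exists>t\<in>{-\<tau>..T}. y = fst (Z t)"
    proof (rule profile_graph_of_curve[OF \<tau>T, of "\<lambda>t. fst (Z t)" "\<lambda>t. fst (snd (Z t))" mz n])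
      show "continuous_on {-\<tau>..T} mz" by (rule continuous_on_subset[OF cmz]) (use \<tau> in auto)
      show "fst (Z t) \<noteq> 0" if "t \<in> {-\<tau><..<T}" for t using Z(4)[of t] that \<tau> by simp
    qed (use dZ mz1 in \<open>auto intro!: continuous_intros cZ\<close>)
    have Zr: "fst (Z t) = r t" "fst (snd (Z t)) = x t" "mz t = m t" if "t \<in> {0..T}" for t
      using Z(3)[OF that] by (auto simp: r_def x_def m_def mz_def)
    have rR: "r 0 = R" using init by (simp add: r_def)
    have g': "g (r t) = x t" if "t \<in> {0..T}" for t using g(1)[of t] Zr[OF that] \<tau>(1) that by simp
    have g'': "deriv g (r t) = m t / (1 - m t)" if "t \<in> {0..<T}" for t
      using g(3)[of t] Zr[of t] \<tau>(1) that by simp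
    have g''': "r s < r t" if "0 \<le> s" "s < t" "t \<le> T" for s t
      using g(4)[of s t] Zr(1)[of s] Zr(1)[of t] \<tau>(1) that by simp
    show ?thesis
    proof (rule goal)
      have "fst (Z (-\<tau>)) < R" using g(4)[of "-\<tau>" 0] \<tau>(1) T Zr[of 0] rR by simp
      moreover have "m 0 / (1 - m 0) = c"
      proof -
        have "1 - m 0 = 1 / (1 + c)" using c by (simp add: m00 field_simps)
        then show ?thesis using c by (simp add: m00)
      qed
      then have "deriv g R = c" using g''[of 0] T rR by simp
      moreover have "g R = 0" using g'[of 0] T rR init by (simp add: x_def)
      moreover have "R < r T" using g'''[of 0 T] T rR by simp
      ultimately show "profile_solution n C R (r T) g"
        using g(2) Zr(1)[of T] T by (auto simp: profile_solution_def real)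
      show "\<exists>t\<in>{0..T}. y = r t" if y: "y \<in> {r 0..r T}" for y
        using IVT'[of r 0 y T] y comp(1) T by (metis atLeastAtMost_iff less_eq_real_def)
    qed (use g' g'' g''' in auto)
  next
    case PInf
    have m00: "m 0 = 1" using init PInf by (simp add: m_def initial_slope_def)
    obtain g \<phi> where g: "continuous_on {r 0..r T} g" "\<And>t. t \<in> {0..T} \<Longrightarrow> g (r t) = x t"
      "solves_profile_equation_on n {r 0<..<r T} g"
      "\<And>t. t \<in> {0<..<T} \<Longrightarrow> deriv g (r t) = m t / (1 - m t)"
      "\<And>s t. 0 \<le> s \<Longrightarrow> s < t \<Longrightarrow> t \<le> T \<Longrightarrow> r s < r t"
      "\<And>y. y \<in> {r 0..r T} \<Longrightarrow> \<exists>t\<in>{0..T}. y = r t"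
      and \<phi>: "continuous_on {r 0..r T} \<phi>" "\<And>t. t \<in> {0..T} \<Longrightarrow> \<phi> (r t) = t"
      by (rule profile_graph_of_curve[OF T comp(1-3,5-7)]) (use m1 comp(4) in \<open>auto simp: m_def\<close>)
    have rR: "r 0 = R" using init by (simp add: r_def)
    have RT: "R < r T" using g(5)[of 0 T] T rR by simp
    show ?thesis
    proof (rule goal)
      have "g R = 0" using g(2)[of 0] T rR init by (simp add: x_def)
      moreover have "continuous (at_right R) g"
      proof -
        have "continuous (at R within {R..r T}) g"
          using g(1) RT rR by (simp add: continuous_on_eq_continuous_within)
        then show ?thesis by (simp add: at_within_Icc_at_right[OF RT])
      qed
      moreover have "filterlim (deriv g) at_top (at_right R)"
      proof -
        have ev: "\<forall>\<^sub>F y in at_right R. \<exists>t\<in>{0<..<T}. y = r t"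
        proof -
          have "\<forall>\<^sub>F y in at_right R. y \<in> {R<..<r T}" using RT eventually_at_right_real by blast
          then show ?thesis
          proof eventually_elim
            case (elim y)
            then obtain t where t: "t \<in> {0..T}" "y = r t" using g(6)[of y] rR by auto
            then have "t \<noteq> 0" "t \<noteq> T" using elim rR by auto
            then show ?case using t by auto
          qed
        qed
        have "continuous_on {r 0..r T} (\<lambda>y. 1 - m (\<phi> y))"
          by (intro continuous_intros continuous_on_compose2[OF comp(3) \<phi>(1)]) (use \<phi>(2) g(6) in fastforce)
        then have "continuous (at_right R) (\<lambda>y. 1 - m (\<phi> y))"
          using RT rR by (simp add: continuous_on_eq_continuous_within at_within_Icc_at_right[OF RT, symmetric])
        then have "((\<lambda>y. 1 - m (\<phi> y)) \<longlongrightarrow> 0) (at_right R)"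
          using \<phi>(2)[of 0] T rR m00 by (simp add: continuous_within)
        moreover have "\<forall>\<^sub>F y in at_right R. 1 - m (\<phi> y) > 0"
          using ev by eventually_elim (use \<phi>(2) m1 in \<open>fastforce simp: m_def\<close>)
        ultimately have "filterlim (\<lambda>y. 1 - m (\<phi> y)) (at_right 0) (at_right R)"
          by (auto simp: filterlim_at elim: eventually_mono)
        then have "filterlim (\<lambda>y. (1 - (1 - m (\<phi> y))) / (1 - m (\<phi> y))) at_top (at_right R)"
        proof (rule filterlim_compose[rotated])
          show "filterlim (\<lambda>u::real. (1 - u) / u) at_top (at_right 0)" by real_asymp
        qed
        moreover have "\<forall>\<^sub>F y in at_right R. (1 - (1 - m (\<phi> y))) / (1 - m (\<phi> y)) = deriv g y"
          using ev by eventually_elim (use \<phi>(2) g(4) in fastforce)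
        ultimately show ?thesis by (rule filterlim_cong[THEN iffD1, OF refl refl, rotated])
      qed
      ultimately show "profile_solution n C R (r T) g"
        using g(3) RT rR by (simp add: profile_solution_def PInf)
    qed (use g in auto)
  qed (use C in auto)
qed

section \<open>Monotonicity of the horizontal points\<close>

text \<open>Here strictness is recovered from a margin that is only nonnegative: the numerator of
  the derivative of w = \<zeta> / (1 - m) is the margin plus a term with the factor p(r) - p(R),
  which is positive. At S, where m = 0, the margin equals \<mu> - x \<zeta> / 2, and this is the
  second claim.\<close>

lemma variation_pos_at_horizontal:
  fixes r x m \<zeta> \<mu> :: "real \<Rightarrow> real"
  assumes S: "0 < S" and cm: "continuous_on {0..S} m" and c\<zeta>: "continuous_on {0..S} \<zeta>"
    and dm: "\<And>t. t \<in> {0<..<S} \<Longrightarrow> (m has_real_derivative slope_speed n (r t) (x t) (m t)) (at t)"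
    and d\<zeta>: "\<And>t. t \<in> {0<..<S} \<Longrightarrow> (\<zeta> has_real_derivative \<mu> t) (at t)"
    and m01: "\<And>t. t \<in> {0<..<S} \<Longrightarrow> 0 < m t \<and> m t < 1" and mS: "m S = 0"
    and drift: "\<And>t. t \<in> {0<..<S} \<Longrightarrow> profile_drift n R < profile_drift n (r t)"
    and margin: "\<And>t. t \<in> {0<..S} \<Longrightarrow> 0 \<le> variation_margin n R (r t) (x t) (m t) (\<zeta> t) (\<mu> t)"
    and \<zeta>0: "\<And>t. t \<in> {0<..<S} \<Longrightarrow> 0 \<le> \<zeta> t"
  shows "0 < \<zeta> S" "x S * \<zeta> S / 2 \<le> \<mu> S"
proof -
  \<comment> \<open>Starting from S / 2 avoids time 0, where 1 - m vanishes if the slope is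
    infinite.\<close>
  have "\<zeta> (S / 2) / (1 - m (S / 2)) < \<zeta> S / (1 - m S)"
  proof (rule DERIV_pos_imp_increasing_open[where f = "\<lambda>t. \<zeta> t / (1 - m t)"])
    have "m t \<noteq> 1" if "t \<in> {S / 2..S}" for t using m01[of t] mS S that by (cases "t = S") auto
    then show "continuous_on {S / 2..S} (\<lambda>t. \<zeta> t / (1 - m t))"
      using S by (intro continuous_intros continuous_on_subset[OF c\<zeta>] continuous_on_subset[OF cm]) auto
    fix t assume "S / 2 < t" "t < S"
    then have t: "t \<in> {0<..<S}" using S by simp
    let ?s = "slope_speed n (r t) (x t) (m t)"
    let ?a = "(m t)\<^sup>2 + (1 - m t)\<^sup>2"
    have m: "0 < m t" "m t < 1" using m01[OF t] by auto
    have d: "((\<lambda>t. \<zeta> t / (1 - m t)) has_real_derivative (\<mu> t * (1 - m t) - \<zeta> t * (0 - ?s)) / ((1 - m t) * (1 - m t))) (at t)"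
      by (rule DERIV_divide[OF d\<zeta>[OF t] DERIV_diff[OF DERIV_const dm[OF t]]]) (use m in simp)
    have "\<mu> t * (1 - m t) - \<zeta> t * (0 - ?s)
      = variation_margin n R (r t) (x t) (m t) (\<zeta> t) (\<mu> t) + ?a * (profile_drift n (r t) - profile_drift n R) * m t"
      by (simp add: variation_margin_def algebra_simps)
    moreover have "0 < ?a * (profile_drift n (r t) - profile_drift n R) * m t"
      using drift[OF t] m by (intro mult_pos_pos) (auto intro: add_pos_pos)
    ultimately have "0 < \<mu> t * (1 - m t) - \<zeta> t * (0 - ?s)" using margin[of t] t by simp
    then have "0 < (\<mu> t * (1 - m t) - \<zeta> t * (0 - ?s)) / ((1 - m t) * (1 - m t))" using m by simp
    with d show "\<exists>y. ((\<lambda>t. \<zeta> t / (1 - m t)) has_real_derivative y) (at t) \<and> 0 < y" by blast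
  qed (use S in auto)
  moreover have "0 \<le> \<zeta> (S / 2) / (1 - m (S / 2))" using \<zeta>0[of "S / 2"] m01[of "S / 2"] S by simp
  ultimately show "0 < \<zeta> S" using mS by simp
  show "x S * \<zeta> S / 2 \<le> \<mu> S"
    using margin[of S] S mS by (simp add: variation_margin_def slope_speed_def)
qed

text \<open>Every trajectory keeps r + x - t constant. Hence the first two components of a variation
  have constant sum, here 1, and the first can be eliminated.\<close>

lemma linearization_components:
  assumes T: "0 \<le> T"
    and X: "\<And>t. t \<in> {0..T} \<Longrightarrow> (X has_vector_derivative profile_field_deriv n (Y t) (X t)) (at t within {0..T})"
    and X0: "X 0 = (1, 0, 0)"
  shows "continuous_on {0..T} X"
    "\<And>t. t \<in> {0..T} \<Longrightarrow> fst (X t) = 1 - fst (snd (X t))"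
    "\<And>t. t \<in> {0<..<T} \<Longrightarrow> ((\<lambda>t. fst (snd (X t))) has_real_derivative snd (snd (X t))) (at t)"
    "\<And>t. t \<in> {0<..<T} \<Longrightarrow> ((\<lambda>t. snd (snd (X t))) has_real_derivative
       slope_speed_deriv n (fst (Y t)) (fst (snd (Y t))) (snd (snd (Y t)))
         (1 - fst (snd (X t))) (fst (snd (X t))) (snd (snd (X t)))) (at t)"
proof -
  show "continuous_on {0..T} X"
    using X has_vector_derivative_continuous continuous_on_eq_continuous_within by blast
  note d = has_real_derivative_components[OF X[unfolded profile_field_deriv_apply]]
  have "\<exists>c. \<forall>t\<in>{0..T}. fst (X t) + fst (snd (X t)) = c"
    by (rule has_field_derivative_zero_constant)
      (use DERIV_add[OF d(1,2)] in auto)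
  then show 1: "fst (X t) = 1 - fst (snd (X t))" if "t \<in> {0..T}" for t
    using T X0 that by (metis (no_types, lifting) add.right_neutral add_diff_cancel_right' atLeastAtMost_iff fst_conv order_refl snd_conv)
  have at: "at t within {0..T} = at t" if "t \<in> {0<..<T}" for t
    using that by (intro at_within_interior) simp
  show "((\<lambda>t. fst (snd (X t))) has_real_derivative snd (snd (X t))) (at t)" if "t \<in> {0<..<T}" for t
    using d(2)[of t] at[OF that] that by simp
  show "((\<lambda>t. snd (snd (X t))) has_real_derivative
       slope_speed_deriv n (fst (Y t)) (fst (snd (Y t))) (snd (snd (Y t)))
         (1 - fst (snd (X t))) (fst (snd (X t))) (snd (snd (X t)))) (at t)" if "t \<in> {0<..<T}" for t
    using d(3)[of t] at[OF that] that 1[of t] by simp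
qed

text \<open>Identifies a trajectory supplied by the flow with the one read off from the graph, by
  uniqueness; the times s and S agree since m is positive before either of them and zero
  there.\<close>

lemma trajectory_on_portion:
  assumes hp: "horizontal_portion n C R g \<rho>" and C: "0 < C" and R: "R \<noteq> 0"
    and Z: "trajectory n T Z" "Z 0 = (R, 0, initial_slope C)"
    and s: "0 < s" "s \<le> T" "snd (snd (Z s)) = 0" "\<And>t. t \<in> {0<..<s} \<Longrightarrow> 0 < snd (snd (Z t))"
  shows "Z s = (\<rho>, g \<rho>, 0)"
    "\<And>t. t \<in> {0<..<s} \<Longrightarrow> snd (snd (Z t)) < 1"
    "\<And>t. t \<in> {0<..s} \<Longrightarrow> R < fst (Z t) \<and> fst (Z t) \<le> \<rho> \<and> fst (snd (Z t)) = g (fst (Z t)) \<and>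
       deriv g (fst (Z t)) = snd (snd (Z t)) / (1 - snd (snd (Z t))) \<and>
       deriv (deriv g) (fst (Z t)) = (1 + (deriv g (fst (Z t)))\<^sup>2) *
         (profile_drift n (fst (Z t)) * deriv g (fst (Z t)) - g (fst (Z t)) / 2)"
proof -
  obtain T' S Y where Y: "0 < S" "S < T'" "trajectory n T' Y" "Y 0 = (R, 0, initial_slope C)" "Y S = (\<rho>, g \<rho>, 0)"
    "\<And>t. t \<in> {0<..<S} \<Longrightarrow> 0 < snd (snd (Y t)) \<and> snd (snd (Y t)) < 1"
    "\<And>t. t \<in> {0<..S} \<Longrightarrow> R < fst (Y t) \<and> fst (Y t) \<le> \<rho> \<and> fst (snd (Y t)) = g (fst (Y t)) \<and>
       deriv g (fst (Y t)) = snd (snd (Y t)) / (1 - snd (snd (Y t))) \<and>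
       deriv (deriv g) (fst (Y t)) = (1 + (deriv g (fst (Y t)))\<^sup>2) *
         (profile_drift n (fst (Y t)) * deriv g (fst (Y t)) - g (fst (Y t)) / 2)"
    by (rule trajectory_of_portion[OF hp C R]) blast
  have eq: "Z t = Y t" if "0 \<le> t" "t \<le> T" "t \<le> T'" for t
    using profile.ode_solution_unique[of n "min T T'" Z Y t] ode_solution_subinterval[OF Z(1), of "min T T'"]
      ode_solution_subinterval[OF Y(3), of "min T T'"] Z(2) Y(4) that by simp
  have "s = S"
  proof (rule antisym; rule ccontr)
    assume "\<not> s \<le> S"
    then have "0 < snd (snd (Z S))" using s(4)[of S] Y(1) by simp
    moreover have "Z S = Y S" using \<open>\<not> s \<le> S\<close> eq[of S] s(2) Y(1,2) by simp
    ultimately show False using Y(5) by simp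
  next
    assume "\<not> S \<le> s"
    then have "Z s = Y s" "0 < snd (snd (Y s))" using eq[of s] Y(6)[of s] s(1,2) Y(2) by auto
    then show False using s(3) by simp
  qed
  then show "Z s = (\<rho>, g \<rho>, 0)"
    "\<And>t. t \<in> {0<..<s} \<Longrightarrow> snd (snd (Z t)) < 1"
    "\<And>t. t \<in> {0<..s} \<Longrightarrow> R < fst (Z t) \<and> fst (Z t) \<le> \<rho> \<and> fst (snd (Z t)) = g (fst (Z t)) \<and>
       deriv g (fst (Z t)) = snd (snd (Z t)) / (1 - snd (snd (Z t))) \<and>
       deriv (deriv g) (fst (Z t)) = (1 + (deriv g (fst (Z t)))\<^sup>2) *
         (profile_drift n (fst (Z t)) * deriv g (fst (Z t)) - g (fst (Z t)) / 2)"
    using eq Y s(1,2) by auto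
qed

text \<open>A finite slope gives m < 1 from time 0 on, so the Sturm comparison applies on the whole
  portion.\<close>

lemma finite_slope_variation_nonneg:
  assumes n: "n \<ge> 1" and c: "0 < c" and R: "R \<noteq> 0" and pR: "profile_drift n R < 0"
    and hp: "horizontal_portion n (ereal c) R g \<rho>" and eta: "\<And>r. r \<in> {R..\<rho>} \<Longrightarrow> 0 \<le> profile_eta n R g r"
    and Z: "trajectory n T Z" "Z 0 = (R, 0, initial_slope (ereal c))"
    and s: "0 < s" "s \<le> T" "snd (snd (Z s)) = 0" "\<And>t. t \<in> {0<..<s} \<Longrightarrow> 0 < snd (snd (Z t))"
    and W: "\<And>t. t \<in> {0..T} \<Longrightarrow> (W has_vector_derivative profile_field_deriv n (Z t) (W t)) (at t within {0..T})"
    and W0: "W 0 = (1, 0, 0)" and t: "t \<in> {0..s}"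
  shows "0 \<le> variation_margin n R (fst (Z t)) (fst (snd (Z t))) (snd (snd (Z t))) (fst (snd (W t))) (snd (snd (W t)))"
    "0 \<le> fst (snd (W t))"
proof -
  have T: "0 \<le> T" using s by simp
  have C: "0 < ereal c" using c by simp
  note port = trajectory_on_portion[OF hp C R Z s]
  note comp = trajectory_components[OF Z(1)]
  note lin = linearization_components[OF T W W0]
  have cW: "continuous_on {0..s} W" by (rule continuous_on_subset[OF lin(1)]) (use s in auto)
  have m00: "0 < snd (snd (Z 0))" "snd (snd (Z 0)) < 1" using initial_slope_bounds[OF C] Z(2) by auto
  have eta': "0 \<le> A * profile_drift' n (fst (Z u)) +
      2 * (profile_drift n (fst (Z u)) - profile_drift n R) * G * (A * (profile_drift n (fst (Z u)) * G - fst (snd (Z u)) / 2))"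
    if u: "u \<in> {0<..<s}" and GA: "G = snd (snd (Z u)) / (1 - snd (snd (Z u)))" "A = 1 + G\<^sup>2" for u G A
  proof -
    note port' = port(3)[of u]
    have "0 \<le> profile_eta n R g (fst (Z u))" using eta[of "fst (Z u)"] port' u by auto
    moreover have "deriv g (fst (Z u)) = G" "g (fst (Z u)) = fst (snd (Z u))"
      "deriv (deriv g) (fst (Z u)) = A * (profile_drift n (fst (Z u)) * G - fst (snd (Z u)) / 2)"
      using port' u GA by auto
    ultimately show ?thesis using GA(2) by (simp add: profile_eta_def)
  qed
  have m1: "snd (snd (Z u)) < 1" if "u \<in> {0..s}" for u
    using port(2)[of u] m00 s(3) that by (cases "u = 0"; cases "u = s") auto
  have m0: "0 < snd (snd (Z u))" if "u \<in> {0..<s}" for u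
    using s(4)[of u] m00 that by (cases "u = 0") auto
  have c\<zeta>: "continuous_on {0..s} (\<lambda>t. fst (snd (W t)))" and c\<mu>: "continuous_on {0..s} (\<lambda>t. snd (snd (W t)))"
    by (intro continuous_intros cW)+
  have sub': "u \<in> {0<..<T}" if "u \<in> {0<..<s}" for u
    using s that by auto
  have sub: "{0..s} \<subseteq> {0..T}" using s by auto
  note concl = horizontal_variation_nonneg[where S = s and r = "\<lambda>t. fst (Z t)" and x = "\<lambda>t. fst (snd (Z t))"
      and m = "\<lambda>t. snd (snd (Z t))" and \<zeta> = "\<lambda>t. fst (snd (W t))" and \<mu> = "\<lambda>t. snd (snd (W t))" and n = n and R = R,
      OF n s(1) continuous_on_subset[OF comp(1) sub] continuous_on_subset[OF comp(2) sub]
        continuous_on_subset[OF comp(3) sub] c\<zeta> c\<mu> comp(5)[OF sub'] comp(6)[OF sub'] comp(7)[OF sub']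
        lin(3)[OF _ sub'] lin(4)[OF _ sub'] _ _ _ _ m1 m0 comp(4)[OF subsetD[OF sub]] pR eta' t]
  show "0 \<le> variation_margin n R (fst (Z t)) (fst (snd (Z t))) (snd (snd (Z t))) (fst (snd (W t))) (snd (snd (W t)))"
    by (rule concl(1)) (simp_all add: Z(2) W0)
  show "0 \<le> fst (snd (W t))"
    by (rule concl(2)) (simp_all add: Z(2) W0)
qed

lemma norm_components_le:
  "\<bar>fst y\<bar> \<le> norm y" "\<bar>fst (snd y)\<bar> \<le> norm y" "\<bar>snd (snd y)\<bar> \<le> norm y"
  for y :: "real \<times> real \<times> real"
proof -
  obtain a b c where y: "y = (a, b, c)" by (cases y)
  have "\<bar>b\<bar> \<le> norm (b, c)" "\<bar>c\<bar> \<le> norm (b, c)" "norm (b, c) \<le> norm y" "\<bar>a\<bar> \<le> norm y"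
    unfolding y real_norm_def[symmetric] by (rule norm_fst_le norm_snd_le)+
  then show "\<bar>fst y\<bar> \<le> norm y" "\<bar>fst (snd y)\<bar> \<le> norm y" "\<bar>snd (snd y)\<bar> \<le> norm y" by (auto simp: y)
qed

lemma slope_speed_near:
  assumes "fst y \<noteq> 0" "0 < e"
  obtains d where "0 < d" "\<And>z. norm (z - y) < d \<Longrightarrow>
    \<bar>slope_speed n (fst z) (fst (snd z)) (snd (snd z)) - slope_speed n (fst y) (fst (snd y)) (snd (snd y))\<bar> < e"
proof -
  have "isCont (profile_field n) y"
    using profile.deriv[of y n] assms has_derivative_continuous by blast
  then have "isCont (\<lambda>z. snd (snd (profile_field n z))) y" by (intro continuous_intros)
  then have "isCont (\<lambda>z. slope_speed n (fst z) (fst (snd z)) (snd (snd z))) y"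
    by (simp add: profile_field_def[abs_def])
  then show thesis
    using that assms(2) unfolding continuous_at_eps_delta dist_norm real_norm_def by metis
qed

section \<open>Stability and comparison of horizontal points\<close>

text \<open>At S one has dm/dt = -x / 2 < 0, so near S the slope coordinate of every close curve
  decreases strictly and has exactly one zero; before that window m is bounded away from 0 by
  compactness. The bound m < 1 cannot come from closeness near time 0, where m may equal 1; there it
  follows from dm/dt < 0, the assumption \<open>start\<close>.\<close>

lemma nearby_horizontal:
  assumes Y: "trajectory n T Y" and S: "0 < S" "S < T"
    and mS: "snd (snd (Y S)) = 0" and xS: "0 < fst (snd (Y S))"
    and m0: "\<And>t. t \<in> {0..<S} \<Longrightarrow> 0 < snd (snd (Y t))" and m1: "\<And>t. t \<in> {0<..<S} \<Longrightarrow> snd (snd (Y t)) < 1"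
    and start: "slope_speed n (fst (Y 0)) (fst (snd (Y 0))) (snd (snd (Y 0))) < 0"
    and e: "0 < e"
  obtains \<delta> d where "0 < \<delta>" "\<delta> < e" "\<delta> < S" "S + \<delta> \<le> T" "0 < d"
    "\<And>t y. \<bar>t - S\<bar> \<le> \<delta> \<Longrightarrow> norm (y - Y t) < d \<Longrightarrow>
       \<bar>slope_speed n (fst y) (fst (snd y)) (snd (snd y)) + fst (snd (Y S)) / 2\<bar> < e \<and>
       slope_speed n (fst y) (fst (snd y)) (snd (snd y)) < 0 \<and> \<bar>snd (snd y)\<bar> < e"
    "\<And>Z. trajectory n (S + \<delta>) Z \<Longrightarrow> (\<And>t. t \<in> {0..S + \<delta>} \<Longrightarrow> norm (Z t - Y t) < d) \<Longrightarrow>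
       snd (snd (Z 0)) \<le> 1 \<Longrightarrow>
       (\<exists>s. S - \<delta> < s \<and> s < S + \<delta> \<and> snd (snd (Z s)) = 0 \<and> (\<forall>t\<in>{0..<s}. 0 < snd (snd (Z t)))) \<and>
       (\<forall>t\<in>{0<..S + \<delta>}. snd (snd (Z t)) < 1)"
proof -
  define m where "m t = snd (snd (Y t))" for t
  define sp where "sp y = slope_speed n (fst y) (fst (snd y)) (snd (snd y))" for y
  define x0 where "x0 = fst (snd (Y S))"
  note comp = trajectory_components[OF Y]
  have cY: "continuous_on {0..T} Y" using Y by (simp add: ode_solution_def)
  have cm: "continuous_on {0..T} m" using comp(3) by (simp add: m_def)
  have contY: "\<exists>d>0. \<forall>t\<in>{0..T}. \<bar>t - s\<bar> < d \<longrightarrow> norm (Y t - Y s) < h" if "s \<in> {0..T}" "0 < h" for s h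
    using cY that unfolding continuous_on_iff dist_norm real_norm_def by metis
  \<comment> \<open>The bound x0 / 4 keeps dm/dt below -x0 / 4 in the window, the bound 1 / 2 keeps
    m < 1 there.\<close>
  define e' where "e' = min e (min (x0 / 4) (1 / 2))"
  have e': "0 < e'" "e' \<le> e" "e' \<le> x0 / 4" "e' \<le> 1 / 2" using e xS by (auto simp: e'_def x0_def)
  have spS: "sp (Y S) = - x0 / 2" by (simp add: sp_def slope_speed_def mS x0_def)
  obtain h where h: "0 < h" "\<And>z. norm (z - Y S) < h \<Longrightarrow> \<bar>sp z + x0 / 2\<bar> < e'"
    using slope_speed_near[of "Y S" e' n] comp(4)[of S] S e'(1) spS by (auto simp: sp_def)
  define h1 where "h1 = min h e'"
  have h1: "0 < h1" "h1 \<le> h" "h1 \<le> e'" using h(1) e'(1) by (auto simp: h1_def)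
  obtain \<delta>1 where \<delta>1: "0 < \<delta>1" "\<And>t. t \<in> {0..T} \<Longrightarrow> \<bar>t - S\<bar> < \<delta>1 \<Longrightarrow> norm (Y t - Y S) < h1 / 2"
    using contY[of S "h1 / 2"] S h1(1) by auto
  define \<delta> where "\<delta> = min (min (\<delta>1 / 2) (e / 2)) (min (S / 2) (T - S))"
  have \<delta>: "0 < \<delta>" "\<delta> < \<delta>1" "\<delta> < e" "\<delta> < S" "S + \<delta> \<le> T"
    using \<delta>1(1) e S by (auto simp: \<delta>_def)
  have window: "\<bar>sp y + x0 / 2\<bar> < e' \<and> \<bar>snd (snd y)\<bar> < e'" if "\<bar>t - S\<bar> \<le> \<delta>" "norm (y - Y t) < h1 / 2" for t y
  proof -
    have "t \<in> {0..T}" "\<bar>t - S\<bar> < \<delta>1" using that(1) \<delta> by auto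
    then have "norm (Y t - Y S) < h1 / 2" by (rule \<delta>1(2))
    then have "norm (y - Y S) < h1"
      using norm_triangle_ineq[of "y - Y t" "Y t - Y S"] that(2) by simp
    then show ?thesis
      using h(2)[of y] h1 norm_components_le(3)[of "y - Y S"] mS by auto
  qed
  have win_neg: "sp y < 0" if "\<bar>t - S\<bar> \<le> \<delta>" "norm (y - Y t) < h1 / 2" for t y
    using window[OF that] e' xS by (auto simp: x0_def)
  obtain h2 where h2: "0 < h2" "\<And>z. norm (z - Y 0) < h2 \<Longrightarrow> \<bar>sp z - sp (Y 0)\<bar> < - sp (Y 0)"
    using slope_speed_near[of "Y 0" "- sp (Y 0)" n] comp(4)[of 0] S start by (auto simp: sp_def)
  obtain \<delta>2 where \<delta>2: "0 < \<delta>2" "\<And>t. t \<in> {0..T} \<Longrightarrow> \<bar>t - 0\<bar> < \<delta>2 \<Longrightarrow> norm (Y t - Y 0) < h2 / 2"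
    using contY[of 0 "h2 / 2"] S h2(1) by auto
  \<comment> \<open>Up to time q every close curve has decreasing m; from q to S - \<delta> the
    reference curve has m bounded away from 1.\<close>
  define q where "q = min (\<delta>2 / 2) (S - \<delta>)"
  have q: "0 < q" "q < \<delta>2" "q \<le> S - \<delta>" using \<delta>2(1) \<delta> by (auto simp: q_def)
  have "\<exists>u\<in>{0..S - \<delta>}. \<forall>v\<in>{0..S - \<delta>}. m u \<le> m v"
    by (rule continuous_attains_inf) (use \<delta> S in \<open>auto intro: continuous_on_subset[OF cm]\<close>)
  then obtain u where u: "u \<in> {0..S - \<delta>}" "\<And>v. v \<in> {0..S - \<delta>} \<Longrightarrow> m u \<le> m v" by blast
  have mu: "0 < m u" using m0[of u] u(1) \<delta> by (simp add: m_def)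
  have "\<exists>w\<in>{q..S - \<delta>}. \<forall>v\<in>{q..S - \<delta>}. m v \<le> m w"
    by (rule continuous_attains_sup) (use \<delta> S q in \<open>auto intro: continuous_on_subset[OF cm]\<close>)
  then obtain w where w: "w \<in> {q..S - \<delta>}" "\<And>v. v \<in> {q..S - \<delta>} \<Longrightarrow> m v \<le> m w" by blast
  have mw: "m w < 1" using m1[of w] w(1) \<delta> q by (simp add: m_def)
  have mend: "m (S + \<delta>) < 0"
  proof -
    have "m (S + \<delta>) < m S"
    proof (rule DERIV_neg_imp_decreasing_open[where f = m])
      show "continuous_on {S..S + \<delta>} m" by (rule continuous_on_subset[OF cm]) (use \<delta> S in auto)
      fix t assume t: "S < t" "t < S + \<delta>"
      then have "(m has_real_derivative sp (Y t)) (at t)"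
        using comp(7)[of t] \<delta> S by (simp add: m_def[abs_def] sp_def)
      moreover have "sp (Y t) < 0" using win_neg[of t "Y t"] t h1 by simp
      ultimately show "\<exists>y. (m has_real_derivative y) (at t) \<and> y < 0" by blast
    qed (use \<delta> in auto)
    then show ?thesis by (simp add: m_def mS)
  qed
  \<comment> \<open>The terms secure, in turn, the window, the initial decrease, m > 0 before the
    window, m < 1 after q, and m < 0 at S + \<delta>.\<close>
  define d where "d = min (min (h1 / 2) (h2 / 2)) (min (min (m u) (1 - m w)) (- m (S + \<delta>)))"
  have d: "0 < d" "d \<le> h1 / 2" "d \<le> h2 / 2" "d \<le> m u" "d \<le> 1 - m w" "d \<le> - m (S + \<delta>)"
    using h1(1) h2(1) mu mw mend unfolding d_def by linarith+
  show thesis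
  proof (rule that[OF \<delta>(1) \<delta>(3) \<delta>(4) \<delta>(5) d(1)])
    fix t y assume "\<bar>t - S\<bar> \<le> \<delta>" "norm (y - Y t) < d"
    then show "\<bar>slope_speed n (fst y) (fst (snd y)) (snd (snd y)) + fst (snd (Y S)) / 2\<bar> < e \<and>
       slope_speed n (fst y) (fst (snd y)) (snd (snd y)) < 0 \<and> \<bar>snd (snd y)\<bar> < e"
      using window[of t y] win_neg[of t y] d(2) e'(2) unfolding sp_def[symmetric] x0_def[symmetric] by auto
  next
    fix Z assume Z: "trajectory n (S + \<delta>) Z" and near: "\<And>t. t \<in> {0..S + \<delta>} \<Longrightarrow> norm (Z t - Y t) < d"
      and Z0: "snd (snd (Z 0)) \<le> 1"
    define mz where "mz t = snd (snd (Z t))" for t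
    note compz = trajectory_components[OF Z]
    have cmz: "continuous_on {0..S + \<delta>} mz" using compz(3) by (simp add: mz_def)
    have dmz: "(mz has_real_derivative sp (Z t)) (at t)" if "t \<in> {0<..<S + \<delta>}" for t
      using compz(7)[OF that] by (simp add: mz_def[abs_def] sp_def)
    have mm: "\<bar>mz t - m t\<bar> < d" if "t \<in> {0..S + \<delta>}" for t
      using norm_components_le(3)[of "Z t - Y t"] near[OF that] by (simp add: mz_def m_def)
    have dec: "mz b < mz a" if "S - \<delta> \<le> a" "a < b" "b \<le> S + \<delta>" for a b
    proof (rule DERIV_neg_imp_decreasing_open[where f = mz])
      show "continuous_on {a..b} mz" by (rule continuous_on_subset[OF cmz]) (use that \<delta> S in auto)
      fix t assume t: "a < t" "t < b"
      then have "t \<in> {0<..<S + \<delta>}" "\<bar>t - S\<bar> \<le> \<delta>" using that \<delta> S by auto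
      then show "\<exists>y. (mz has_real_derivative y) (at t) \<and> y < 0"
        using dmz[of t] win_neg[of t "Z t"] near[of t] d(2) by (intro exI[of _ "sp (Z t)"]) auto
    qed (use that in auto)
    have pos: "0 < mz t" if "t \<in> {0..S - \<delta>}" for t
      using mm[of t] u(2)[OF that] d(4) that \<delta> by simp
    have neg: "mz (S + \<delta>) < 0" using mm[of "S + \<delta>"] d(6) \<delta> S by simp
    have "\<exists>s\<ge>S - \<delta>. s \<le> S + \<delta> \<and> mz s = 0"
    proof (rule IVT2')
      show "continuous_on {S - \<delta>..S + \<delta>} mz" by (rule continuous_on_subset[OF cmz]) (use \<delta> in auto)
    qed (use pos[of "S - \<delta>"] neg \<delta> in auto)
    then obtain s where s: "S - \<delta> \<le> s" "s \<le> S + \<delta>" "mz s = 0" by blast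
    have "s \<noteq> S - \<delta>" using pos[of "S - \<delta>"] s \<delta> by auto
    moreover have "s \<noteq> S + \<delta>" using neg s by auto
    moreover have "0 < mz t" if "t \<in> {0..<s}" for t
      using pos[of t] dec[of t s] s that by (cases "t \<le> S - \<delta>") auto
    ultimately have ex: "\<exists>s. S - \<delta> < s \<and> s < S + \<delta> \<and> mz s = 0 \<and> (\<forall>t\<in>{0..<s}. 0 < mz t)"
      using s by (intro exI[of _ s]) auto
    have lt1: "mz t < 1" if t: "t \<in> {0<..S + \<delta>}" for t
    proof -
      consider "t \<le> q" | "q \<le> t" "t \<le> S - \<delta>" | "S - \<delta> \<le> t" by linarith
      then show ?thesis
      proof cases
        case 1
        have "mz t < mz 0"
        proof (rule DERIV_neg_imp_decreasing_open[where f = mz])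
          show "continuous_on {0..t} mz" by (rule continuous_on_subset[OF cmz]) (use t in auto)
          fix v assume v: "0 < v" "v < t"
          then have vT: "v \<in> {0..S + \<delta>}" "v \<in> {0..T}" "\<bar>v - 0\<bar> < \<delta>2" using t 1 q \<delta> by auto
          have "norm (Z v - Y 0) < h2"
            using norm_triangle_ineq[of "Z v - Y v" "Y v - Y 0"] near[OF vT(1)] \<delta>2(2)[OF vT(2,3)] d(3) by simp
          then have "sp (Z v) < 0" using h2(2)[of "Z v"] by auto
          then show "\<exists>y. (mz has_real_derivative y) (at v) \<and> y < 0"
            using dmz[of v] v t by (intro exI[of _ "sp (Z v)"]) auto
        qed (use t in auto)
        then show ?thesis using Z0 by (simp add: mz_def)
      next
        case 2
        then show ?thesis using mm[of t] w(2)[of t] d(5) t by simp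
      next
        case 3
        then have "\<bar>t - S\<bar> \<le> \<delta>" using t by auto
        then have "\<bar>mz t\<bar> < e'" using window[of t "Z t"] near[of t] t d(2) by (simp add: mz_def)
        then show ?thesis using e'(4) by simp
      qed
    qed
    show "(\<exists>s. S - \<delta> < s \<and> s < S + \<delta> \<and> snd (snd (Z s)) = 0 \<and> (\<forall>t\<in>{0..<s}. 0 < snd (snd (Z t)))) \<and>
       (\<forall>t\<in>{0<..S + \<delta>}. snd (snd (Z t)) < 1)"
      using ex lt1 by (simp add: mz_def)
  qed
qed

text \<open>Both curves are compared at s1, the horizontal time of the first. There the second still
  has m >= h \<mu>' > 0, and as m falls at speed at most K it becomes horizontal no earlier than h
  \<mu>' / K later. Meanwhile its height does not decrease and its abscissa grows at rate at least 1
  - e, which by \<open>total\<close> outweighs a possibly negative h \<rho>'.\<close>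

lemma horizontal_points_compare:
  assumes h: "h > 0"
    and Z1: "trajectory n T Z1" and Z2: "trajectory n T Z2"
    and w: "0 < a" "a < b" "b \<le> T" and s1: "s1 \<in> {a<..<b}" and s2: "s2 \<in> {a<..<b}"
    and z1: "snd (snd (Z1 s1)) = 0" and z2: "snd (snd (Z2 s2)) = 0"
    and pos2: "\<And>t. t \<in> {0..<s2} \<Longrightarrow> 0 < snd (snd (Z2 t))"
    and neg: "\<And>t. t \<in> {a..b} \<Longrightarrow> slope_speed n (fst (Z2 t)) (fst (snd (Z2 t))) (snd (snd (Z2 t))) < 0"
    and lower: "\<And>t. t \<in> {a..b} \<Longrightarrow> - K \<le> slope_speed n (fst (Z2 t)) (fst (snd (Z2 t))) (snd (snd (Z2 t)))"
    and small: "\<And>t. t \<in> {a..b} \<Longrightarrow> snd (snd (Z2 t)) \<le> e" and e: "e < 1" and K: "0 < K"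
    and dr: "h * \<rho>' \<le> fst (Z2 s1) - fst (Z1 s1)"
    and dx: "0 < fst (snd (Z2 s1)) - fst (snd (Z1 s1))"
    and dm: "h * \<mu>' \<le> snd (snd (Z2 s1)) - snd (snd (Z1 s1))" and \<mu>': "0 < \<mu>'"
    and total: "0 < \<rho>' + (1 - e) * (\<mu>' / K)"
  shows "fst (Z1 s1) < fst (Z2 s2)" "fst (snd (Z1 s1)) < fst (snd (Z2 s2))"
proof -
  define r where "r t = fst (Z2 t)" for t
  define x where "x t = fst (snd (Z2 t))" for t
  define m where "m t = snd (snd (Z2 t))" for t
  note comp = trajectory_components[OF Z2, folded r_def x_def m_def]
  have "0 < h * \<mu>'" using h \<mu>' by simp
  then have m_s1: "0 < m s1" "h * \<mu>' \<le> m s1" using dm z1 by (auto simp: m_def)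
  have "s1 < s2"
  proof (rule ccontr)
    assume "\<not> s1 < s2"
    moreover have "s1 \<noteq> s2" using m_s1(1) z2 by (auto simp: m_def)
    ultimately have lt: "s2 < s1" by simp
    have "m s1 < m s2"
    proof (rule DERIV_neg_imp_decreasing_open[OF lt])
      show "continuous_on {s2..s1} m" by (rule continuous_on_subset[OF comp(3)]) (use s1 s2 w in auto)
      fix t assume t: "s2 < t" "t < s1"
      then show "\<exists>y. (m has_real_derivative y) (at t) \<and> y < 0"
        using comp(7)[of t] neg[of t] s1 s2 w unfolding r_def x_def m_def by fastforce
    qed
    then show False using m_s1(1) z2 by (simp add: m_def)
  qed
  have inner: "t \<in> {0<..<T}" "t \<in> {a..b}" "t \<in> {0..<s2}" if "s1 < t" "t < s2" for t
    using that s1 s2 w by auto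
  have sub: "{s1..s2} \<subseteq> {0..T}" using s1 s2 w by auto
  have "x s1 \<le> x s2"
  proof (rule DERIV_nonneg_imp_increasing_open[where f = x])
    show "continuous_on {s1..s2} x" by (rule continuous_on_subset[OF comp(2) sub])
    fix t assume "s1 < t" "t < s2"
    then show "\<exists>y. (x has_real_derivative y) (at t) \<and> 0 \<le> y"
      using comp(6)[of t] pos2[of t] inner[of t] by (intro exI[of _ "m t"]) (auto simp: m_def)
  qed (use \<open>s1 < s2\<close> in simp)
  then show "fst (snd (Z1 s1)) < fst (snd (Z2 s2))" using dx by (simp add: x_def)
  have "m s1 + K * s1 \<le> m s2 + K * s2"
  proof (rule DERIV_nonneg_imp_increasing_open[where f = "\<lambda>t. m t + K * t"])
    show "continuous_on {s1..s2} (\<lambda>t. m t + K * t)"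
      by (intro continuous_intros continuous_on_subset[OF comp(3) sub])
    fix t assume t: "s1 < t" "t < s2"
    have "((\<lambda>t. m t + K * t) has_real_derivative slope_speed n (r t) (x t) (m t) + K) (at t)"
      by (auto intro!: derivative_eq_intros comp(7)[OF inner(1)[OF t]])
    moreover have "0 \<le> slope_speed n (r t) (x t) (m t) + K"
      using lower[OF inner(2)[OF t]] by (simp add: r_def x_def m_def)
    ultimately show "\<exists>y. ((\<lambda>t. m t + K * t) has_real_derivative y) (at t) \<and> 0 \<le> y" by blast
  qed (use \<open>s1 < s2\<close> in simp)
  then have "h * \<mu>' \<le> K * (s2 - s1)" using m_s1(2) z2 by (simp add: m_def algebra_simps)
  then have gap: "h * (\<mu>' / K) \<le> s2 - s1" using K by (simp add: field_simps)
  have "r s1 - (1 - e) * s1 \<le> r s2 - (1 - e) * s2"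
  proof (rule DERIV_nonneg_imp_increasing_open[where f = "\<lambda>t. r t - (1 - e) * t"])
    show "continuous_on {s1..s2} (\<lambda>t. r t - (1 - e) * t)"
      by (intro continuous_intros continuous_on_subset[OF comp(1) sub])
    fix t assume t: "s1 < t" "t < s2"
    have "((\<lambda>t. r t - (1 - e) * t) has_real_derivative (1 - m t) - (1 - e)) (at t)"
      by (auto intro!: derivative_eq_intros comp(5)[OF inner(1)[OF t]])
    moreover have "0 \<le> (1 - m t) - (1 - e)" using small[OF inner(2)[OF t]] by (simp add: m_def)
    ultimately show "\<exists>y. ((\<lambda>t. r t - (1 - e) * t) has_real_derivative y) (at t) \<and> 0 \<le> y" by blast
  qed (use \<open>s1 < s2\<close> in simp)
  then have "(1 - e) * (s2 - s1) \<le> r s2 - r s1" by (simp add: algebra_simps)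
  moreover have "(1 - e) * (h * (\<mu>' / K)) \<le> (1 - e) * (s2 - s1)" using gap e by (intro mult_left_mono) auto
  moreover have "0 < h * (\<rho>' + (1 - e) * (\<mu>' / K))" using total h by simp
  ultimately show "fst (Z1 s1) < fst (Z2 s2)" using dr by (simp add: r_def algebra_simps)
qed

text \<open>Strict differentiability of the flow gives one error e for all pairs R1 < R2 near R, so
  positive derivatives of the two coordinates at R turn into strict inequalities between any two
  nearby horizontal points.\<close>

lemma horizontal_curve_increasing_of_variation:
  assumes C: "0 < C" and J: "open J" "R \<in> J" "0 \<notin> J" and pR: "profile_drift n R < 0"
    and Y: "trajectory n T Y" "Y 0 = (R, 0, initial_slope C)" and S: "0 < S" "S < T"
    and mS: "snd (snd (Y S)) = 0" and xS: "0 < fst (snd (Y S))"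
    and m01: "\<And>t. t \<in> {0<..<S} \<Longrightarrow> 0 < snd (snd (Y t)) \<and> snd (snd (Y t)) < 1"
    and X: "\<And>t. t \<in> {0..T} \<Longrightarrow> (X has_vector_derivative profile_field_deriv n (Y t) (X t)) (at t within {0..T})"
    and X0: "X 0 = (1, 0, 0)"
    and \<zeta>: "0 < fst (snd (X S))" and \<mu>: "fst (snd (Y S)) * fst (snd (X S)) / 2 \<le> snd (snd (X S))"
  shows "horizontal_curve_increasing_at n C J R"
proof -
  define x0 where "x0 = fst (snd (Y S))"
  define \<zeta>0 where "\<zeta>0 = fst (snd (X S))"
  define \<mu>0 where "\<mu>0 = snd (snd (X S))"
  have x0: "0 < x0" and \<zeta>0: "0 < \<zeta>0" using xS \<zeta> by (auto simp: x0_def \<zeta>0_def)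
  have \<mu>0: "x0 * \<zeta>0 / 2 \<le> \<mu>0" using \<mu> by (simp add: x0_def \<zeta>0_def \<mu>0_def)
  have "0 < x0 * \<zeta>0 / 2" using x0 \<zeta>0 by simp
  then have \<mu>0_pos: "0 < \<mu>0" using \<mu>0 by linarith
  have T: "0 \<le> T" using S by simp
  note lin = linearization_components[OF T X X0]
  have \<xi>0: "fst (X S) = 1 - \<zeta>0" using lin(2)[of S] S by (simp add: \<zeta>0_def)
  \<comment> \<open>f(0) = (1 - \<zeta>0) + \<mu>0 / (x0 / 2) is the derivative of the abscissa of
    the horizontal point: the change at fixed time plus the change caused by the shift of the
    horizontal time. The assumption on \<mu> makes it at least 1, and f(e) is the same bound with
    all errors included.\<close>
  define f where "f e = (1 - \<zeta>0 - e) + (1 - e) * ((\<mu>0 - e) / (x0 / 2 + e))" for e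
  have "0 < f 0"
  proof -
    have "\<zeta>0 \<le> \<mu>0 / (x0 / 2)" using \<mu>0 x0 by (simp add: field_simps)
    then show ?thesis by (simp add: f_def)
  qed
  moreover have "(f \<longlongrightarrow> f 0) (at_right 0)"
    unfolding f_def using x0 by (intro tendsto_intros) auto
  ultimately have "\<forall>\<^sub>F e in at_right 0. 0 < f e" by (rule order_tendstoD(1)[rotated])
  moreover have "\<forall>\<^sub>F e in at_right 0. e \<in> {0<..<min (min \<zeta>0 \<mu>0) 1}"
    by (rule eventually_at_right_real) (use \<zeta>0 \<mu>0_pos in auto)
  ultimately have "\<forall>\<^sub>F e in at_right 0. 0 < f e \<and> e \<in> {0<..<min (min \<zeta>0 \<mu>0) 1}"
    by (rule eventually_conj)
  then obtain e where e: "0 < f e" "0 < e" "e < \<zeta>0" "e < \<mu>0" "e < 1"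
    using eventually_happens' trivial_limit_at_right_real by fastforce
  obtain eX where eX: "0 < eX" "\<And>t. t \<in> {0..T} \<Longrightarrow> \<bar>t - S\<bar> < eX \<Longrightarrow> norm (X t - X S) < e / 2"
    using lin(1) S e(2) unfolding continuous_on_iff dist_norm real_norm_def
    by (metis atLeastAtMost_iff half_gt_zero less_eq_real_def)
  have m0: "0 < snd (snd (Y t))" if "t \<in> {0..<S}" for t
    using m01[of t] initial_slope_bounds(1)[OF C] Y(2) that by (cases "t = 0") auto
  have start: "slope_speed n (fst (Y 0)) (fst (snd (Y 0))) (snd (snd (Y 0))) < 0"
  proof -
    let ?c = "initial_slope C"
    have "0 < ?c\<^sup>2 + (1 - ?c)\<^sup>2" using initial_slope_bounds(1)[OF C] by (intro add_pos_nonneg) auto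
    then show ?thesis using pR initial_slope_bounds(1)[OF C]
      by (simp add: Y(2) slope_speed_def mult_pos_neg mult_neg_pos)
  qed
  \<comment> \<open>The window must also be shorter than \<open>eX\<close>, so that the
    linearization at s1 is close to its value at S.\<close>
  have "0 < min e eX" using e(2) eX(1) by simp
  then obtain \<delta> d where \<delta>: "0 < \<delta>" "\<delta> < min e eX" "\<delta> < S" "S + \<delta> \<le> T" "0 < d"
    and window: "\<And>t y. \<bar>t - S\<bar> \<le> \<delta> \<Longrightarrow> norm (y - Y t) < d \<Longrightarrow>
       \<bar>slope_speed n (fst y) (fst (snd y)) (snd (snd y)) + fst (snd (Y S)) / 2\<bar> < min e eX \<and>
       slope_speed n (fst y) (fst (snd y)) (snd (snd y)) < 0 \<and> \<bar>snd (snd y)\<bar> < min e eX"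
    and horiz: "\<And>Z. trajectory n (S + \<delta>) Z \<Longrightarrow> (\<And>t. t \<in> {0..S + \<delta>} \<Longrightarrow> norm (Z t - Y t) < d) \<Longrightarrow>
       snd (snd (Z 0)) \<le> 1 \<Longrightarrow>
       (\<exists>s. S - \<delta> < s \<and> s < S + \<delta> \<and> snd (snd (Z s)) = 0 \<and> (\<forall>t\<in>{0..<s}. 0 < snd (snd (Z t)))) \<and>
       (\<forall>t\<in>{0<..S + \<delta>}. snd (snd (Z t)) < 1)"
    using nearby_horizontal[OF Y(1) S mS xS m0 _ start, of "min e eX" thesis] m01 by blast
  define T' where "T' = S + \<delta>"
  have T': "0 \<le> T'" "T' \<le> T" using S \<delta> by (auto simp: T'_def)
  have Y': "trajectory n T' Y" by (rule ode_solution_subinterval[OF Y(1) T'(2)])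
  have X': "(X has_vector_derivative profile_field_deriv n (Y t) (X t)) (at t within {0..T'})" if "t \<in> {0..T'}" for t
    by (rule has_vector_derivative_within_subset[OF X]) (use that T' in auto)
  obtain d2 where d2: "0 < d2"
    "\<And>Y1 Y2 h t. trajectory n T' Y1 \<Longrightarrow> trajectory n T' Y2 \<Longrightarrow>
       (\<And>t. t \<in> {0..T'} \<Longrightarrow> norm (Y1 t - Y t) < d2) \<Longrightarrow> (\<And>t. t \<in> {0..T'} \<Longrightarrow> norm (Y2 t - Y t) < d2) \<Longrightarrow>
       h \<noteq> 0 \<Longrightarrow> Y2 0 - Y1 0 = h *\<^sub>R X 0 \<Longrightarrow> t \<in> {0..T'} \<Longrightarrow>
       norm ((Y2 t - Y1 t) /\<^sub>R h - X t) < e / 2"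
    using profile.difference_quotient_bound[OF T'(1) Y' X', of "e / 2" thesis] e(2) by force
  have "0 < min d d2" using \<delta>(5) d2(1) by simp
  then obtain d3 where d3: "0 < d3"
    "\<And>y. norm (y - Y 0) < d3 \<Longrightarrow> \<exists>Z. Z 0 = y \<and> trajectory n T' Z \<and>
       (\<forall>t\<in>{0..T'}. (Z has_vector_derivative profile_field n (Z t)) (at t within {0..T'}) \<and> norm (Z t - Y t) < min d d2)"
    using profile.nearby_solution[OF T'(1) Y', of "min d d2" thesis] by blast
  obtain \<epsilon> where \<epsilon>: "0 < \<epsilon>" "ball R \<epsilon> \<subseteq> J" using J open_contains_ball by blast
  define \<epsilon>' where "\<epsilon>' = min \<epsilon> d3"
  have \<epsilon>': "0 < \<epsilon>'" "\<epsilon>' \<le> \<epsilon>" "\<epsilon>' \<le> d3" using \<epsilon>(1) d3(1) by (auto simp: \<epsilon>'_def)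
  have sub: "{R - \<epsilon>'<..<R + \<epsilon>'} \<subseteq> J" using \<epsilon>(2) \<epsilon>' by (auto simp: subset_iff dist_real_def)
  have family: "\<exists>Z s. Z 0 = (R', 0, initial_slope C) \<and> trajectory n T' Z \<and>
      (\<forall>t\<in>{0..T'}. (Z has_vector_derivative profile_field n (Z t)) (at t within {0..T'}) \<and> norm (Z t - Y t) < min d d2) \<and>
      S - \<delta> < s \<and> s < T' \<and> snd (snd (Z s)) = 0 \<and> (\<forall>t\<in>{0..<s}. 0 < snd (snd (Z t))) \<and>
      (\<forall>t\<in>{0<..T'}. snd (snd (Z t)) < 1)" if R': "R' \<in> {R - \<epsilon>'<..<R + \<epsilon>'}" for R'
  proof -
    have "norm ((R', 0, initial_slope C) - Y 0) = \<bar>R' - R\<bar>" by (simp add: Y(2))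
    then have "norm ((R', 0, initial_slope C) - Y 0) < d3" using R' \<epsilon>'(3) by auto
    from d3(2)[OF this] obtain Z where Z: "Z 0 = (R', 0, initial_slope C)" "trajectory n T' Z"
      "\<And>t. t \<in> {0..T'} \<Longrightarrow> (Z has_vector_derivative profile_field n (Z t)) (at t within {0..T'}) \<and> norm (Z t - Y t) < min d d2"
      by blast
    have "(\<exists>s. S - \<delta> < s \<and> s < T' \<and> snd (snd (Z s)) = 0 \<and> (\<forall>t\<in>{0..<s}. 0 < snd (snd (Z t)))) \<and>
       (\<forall>t\<in>{0<..T'}. snd (snd (Z t)) < 1)"
      unfolding T'_def by (rule horiz) (use Z initial_slope_bounds(2)[OF C] in \<open>auto simp: T'_def\<close>)
    then show ?thesis using Z by blast
  qed
  have compare: "\<rho>1 < \<rho>2 \<and> g1 \<rho>1 < g2 \<rho>2"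
    if R1: "R1 \<in> {R - \<epsilon>'<..<R + \<epsilon>'}" and R2: "R2 \<in> {R - \<epsilon>'<..<R + \<epsilon>'}" and lt: "R1 < R2"
      and hp1: "horizontal_portion n C R1 g1 \<rho>1" and hp2: "horizontal_portion n C R2 g2 \<rho>2" for R1 R2 g1 \<rho>1 g2 \<rho>2
  proof -
    have "R1 \<in> J" "R2 \<in> J" using R1 R2 sub by blast+
    then have nz: "R1 \<noteq> 0" "R2 \<noteq> 0" using J(3) by auto
    obtain Z1 s1 where Z1: "Z1 0 = (R1, 0, initial_slope C)" "trajectory n T' Z1"
      "\<And>t. t \<in> {0..T'} \<Longrightarrow> norm (Z1 t - Y t) < min d d2"
      and s1: "S - \<delta> < s1" "s1 < T'" "snd (snd (Z1 s1)) = 0" "\<And>t. t \<in> {0..<s1} \<Longrightarrow> 0 < snd (snd (Z1 t))"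
      using family[OF R1] by blast
    obtain Z2 s2 where Z2: "Z2 0 = (R2, 0, initial_slope C)" "trajectory n T' Z2"
      "\<And>t. t \<in> {0..T'} \<Longrightarrow> norm (Z2 t - Y t) < min d d2"
      and s2: "S - \<delta> < s2" "s2 < T'" "snd (snd (Z2 s2)) = 0" "\<And>t. t \<in> {0..<s2} \<Longrightarrow> 0 < snd (snd (Z2 t))"
      using family[OF R2] by blast
    have end1: "Z1 s1 = (\<rho>1, g1 \<rho>1, 0)"
      by (rule trajectory_on_portion(1)[OF hp1 C nz(1) Z1(2,1)]) (use s1 \<delta> in auto)
    have end2: "Z2 s2 = (\<rho>2, g2 \<rho>2, 0)"
      by (rule trajectory_on_portion(1)[OF hp2 C nz(2) Z2(2,1)]) (use s2 \<delta> in auto)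
    define h where "h = R2 - R1"
    have h: "0 < h" using lt by (simp add: h_def)
    \<comment> \<open>The difference quotient at the common time s1; the starts differ by h (1, 0,
      0) = h X(0).\<close>
    define v where "v = (Z2 s1 - Z1 s1) /\<^sub>R h"
    have hv: "Z2 s1 - Z1 s1 = h *\<^sub>R v" using h by (simp add: v_def)
    have "norm (v - X s1) < e / 2"
      unfolding v_def by (rule d2(2)[OF Z1(2) Z2(2)]) (use Z1 Z2 h s1 \<delta> X0 h_def in \<open>auto simp: zero_prod_def\<close>)
    moreover have "norm (X s1 - X S) < e / 2"
      by (rule eX(2)) (use s1 \<delta> T' in \<open>auto simp: T'_def\<close>)
    ultimately have "norm (v - X S) < e" using norm_triangle_ineq[of "v - X s1" "X s1 - X S"] by simp
    then have v: "1 - \<zeta>0 - e \<le> fst v" "\<zeta>0 - e \<le> fst (snd v)" "\<mu>0 - e \<le> snd (snd v)"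
      using norm_components_le[of "v - X S"] \<xi>0 by (auto simp: \<zeta>0_def \<mu>0_def)
    have win2: "\<bar>slope_speed n (fst (Z2 t)) (fst (snd (Z2 t))) (snd (snd (Z2 t))) + x0 / 2\<bar> < e \<and>
       slope_speed n (fst (Z2 t)) (fst (snd (Z2 t))) (snd (snd (Z2 t))) < 0 \<and> \<bar>snd (snd (Z2 t))\<bar> < e"
      if t: "t \<in> {S - \<delta>..T'}" for t
      using window[of t "Z2 t"] Z2(3)[of t] t \<delta> by (auto simp: T'_def x0_def)
    have "0 < x0 / 2 + e" using x0 e(2) by simp
    have dr: "h * (1 - \<zeta>0 - e) \<le> fst (Z2 s1) - fst (Z1 s1)"
      using arg_cong[OF hv, of fst] mult_left_mono[OF v(1), of h] h by simp
    have "0 < h * fst (snd v)" using h v(2) e(3) by simp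
    then have dx: "0 < fst (snd (Z2 s1)) - fst (snd (Z1 s1))"
      using arg_cong[OF hv, of "\<lambda>z. fst (snd z)"] by simp
    have dm: "h * (\<mu>0 - e) \<le> snd (snd (Z2 s1)) - snd (snd (Z1 s1))"
      using arg_cong[OF hv, of "\<lambda>z. snd (snd z)"] mult_left_mono[OF v(3), of h] h by simp
    have lower: "- (x0 / 2 + e) \<le> slope_speed n (fst (Z2 t)) (fst (snd (Z2 t))) (snd (snd (Z2 t)))"
      and neg: "slope_speed n (fst (Z2 t)) (fst (snd (Z2 t))) (snd (snd (Z2 t))) < 0"
      and small: "snd (snd (Z2 t)) \<le> e" if "t \<in> {S - \<delta>..T'}" for t
      using win2[OF that] by auto
    have ab: "0 < S - \<delta>" "S - \<delta> < T'" "T' \<le> T'" "s1 \<in> {S - \<delta><..<T'}" "s2 \<in> {S - \<delta><..<T'}"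
      using \<delta> s1 s2 by (auto simp: T'_def)
    have \<mu>e: "0 < \<mu>0 - e" using e(4) by simp
    note concl = horizontal_points_compare[OF h Z1(2) Z2(2) ab s1(3) s2(3) s2(4) neg lower small e(5) \<open>0 < x0 / 2 + e\<close>
        dr dx dm \<mu>e e(1)[unfolded f_def]]
    have "fst (Z1 s1) < fst (Z2 s2)" "fst (snd (Z1 s1)) < fst (snd (Z2 s2))"
      by (rule concl; simp)+
    then show ?thesis by (simp add: end1 end2)
  qed
  show ?thesis
    unfolding horizontal_curve_increasing_at_def
  proof (intro exI conjI)
    show "R \<in> {R - \<epsilon>'<..<R + \<epsilon>'}" using \<epsilon>' by simp
    show "{R - \<epsilon>'<..<R + \<epsilon>'} \<subseteq> J" by (rule sub)
    show "\<forall>R'\<in>{R - \<epsilon>'<..<R + \<epsilon>'}. \<exists>g \<rho>. horizontal_portion n C R' g \<rho>"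
    proof
      fix R' assume R': "R' \<in> {R - \<epsilon>'<..<R + \<epsilon>'}"
      obtain Z s where Z: "Z 0 = (R', 0, initial_slope C)" "trajectory n T' Z"
        "\<And>t. t \<in> {0..T'} \<Longrightarrow> (Z has_vector_derivative profile_field n (Z t)) (at t within {0..T'})"
        and s: "S - \<delta> < s" "s < T'" "snd (snd (Z s)) = 0" "\<And>t. t \<in> {0..<s} \<Longrightarrow> 0 < snd (snd (Z t))"
        "\<And>t. t \<in> {0<..T'} \<Longrightarrow> snd (snd (Z t)) < 1"
        using family[OF R'] by blast
      show "\<exists>g \<rho>. horizontal_portion n C R' g \<rho>"
        using portion_of_trajectory[OF Z(2) Z(3) Z(1) C _ s(2) s(3)] s T' \<delta> by force
    qed
    show "\<forall>R1\<in>{R - \<epsilon>'<..<R + \<epsilon>'}. \<forall>R2\<in>{R - \<epsilon>'<..<R + \<epsilon>'}. \<forall>g1 \<rho>1 g2 \<rho>2.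
        horizontal_portion n C R1 g1 \<rho>1 \<and> horizontal_portion n C R2 g2 \<rho>2 \<and> R1 < R2 \<longrightarrow> \<rho>1 < \<rho>2 \<and> g1 \<rho>1 < g2 \<rho>2"
      using compare by blast
  qed
qed

lemma horizontal_height_pos:
  assumes Y: "trajectory n T Y" and x0: "fst (snd (Y 0)) = 0" and S: "0 < S" "S < T"
    and m0: "\<And>t. t \<in> {0<..<S} \<Longrightarrow> 0 < snd (snd (Y t))"
  shows "0 < fst (snd (Y S))"
proof -
  have "fst (snd (Y 0)) < fst (snd (Y S))"
  proof (rule DERIV_pos_imp_increasing_open[where f = "\<lambda>t. fst (snd (Y t))", OF S(1)])
    show "continuous_on {0..S} (\<lambda>t. fst (snd (Y t)))"
      by (rule continuous_on_subset[OF trajectory_components(2)[OF Y]]) (use S in auto)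
    fix t assume "0 < t" "t < S"
    then show "\<exists>y. ((\<lambda>t. fst (snd (Y t))) has_real_derivative y) (at t) \<and> 0 < y"
      using trajectory_components(6)[OF Y, of t] m0[of t] S by (intro exI[of _ "snd (snd (Y t))"]) auto
  qed
  then show ?thesis using x0 by simp
qed

section \<open>Monotonicity from a nonnegative margin, for finite and infinite slope\<close>

text \<open>Nonnegativity is assumed only before S, because the limit of large slopes yields no
  more: the approximating curves may become horizontal earlier. Continuity supplies the margin at S,
  and the strict conclusions follow from the drift.\<close>

lemma horizontal_curve_increasing_of_margin:
  assumes n: "n \<ge> 1" and C: "0 < C" and J: "open J" "R \<in> J" "0 \<notin> J" and pR: "profile_drift n R < 0"
    and Y: "trajectory n T Y" "Y 0 = (R, 0, initial_slope C)" and S: "0 < S" "S < T"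
    and mS: "snd (snd (Y S)) = 0"
    and m01: "\<And>t. t \<in> {0<..<S} \<Longrightarrow> 0 < snd (snd (Y t)) \<and> snd (snd (Y t)) < 1"
    and X: "\<And>t. t \<in> {0..T} \<Longrightarrow> (X has_vector_derivative profile_field_deriv n (Y t) (X t)) (at t within {0..T})"
    and X0: "X 0 = (1, 0, 0)"
    and nonneg: "\<And>t. t \<in> {0..<S} \<Longrightarrow> 0 \<le> fst (snd (X t)) \<and>
      0 \<le> variation_margin n R (fst (Y t)) (fst (snd (Y t))) (snd (snd (Y t))) (fst (snd (X t))) (snd (snd (X t)))"
  shows "horizontal_curve_increasing_at n C J R"
proof -
  have T: "0 \<le> T" using S by simp
  note comp = trajectory_components[OF Y(1)]
  note lin = linearization_components[OF T X X0]
  have cX: "continuous_on {0..T} X" by (rule lin(1))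
  have cY: "continuous_on {0..T} Y" using Y(1) by (simp add: ode_solution_def)
  have sub: "{0..S} \<subseteq> {0..T}" using S by auto
  define marg where "marg t = variation_margin n R (fst (Y t)) (fst (snd (Y t))) (snd (snd (Y t))) (fst (snd (X t))) (snd (snd (X t)))" for t
  have "continuous_on {0..T} marg"
    unfolding marg_def[abs_def] variation_margin_def slope_speed_def profile_drift_def
    by (intro continuous_intros cX cY) (use comp(4) in auto)
  then have cmarg: "continuous_on {0..S} marg" by (rule continuous_on_subset[OF _ sub])
  have "0 \<le> marg S"
    by (rule continuous_ge_on_closure[of "{0..<S}" marg S]) (use S cmarg nonneg in \<open>auto simp: marg_def\<close>)
  then have marg: "0 \<le> marg t" if "t \<in> {0<..S}" for t
    using nonneg[of t] that by (cases "t = S") (auto simp: marg_def)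
  have drift: "profile_drift n R < profile_drift n (fst (Y t))" if t: "t \<in> {0<..<S}" for t
  proof -
    have "profile_drift n (fst (Y 0)) < profile_drift n (fst (Y t))"
    proof (rule profile_drift_less_along_curve(2)[OF n continuous_on_subset[OF comp(1) sub]])
      show "((\<lambda>t. fst (Y t)) has_real_derivative 1 - snd (snd (Y u))) (at u)" if "u \<in> {0<..<S}" for u
        using comp(5)[of u] that S by simp
    qed (use m01 comp(4) t S in auto)
    then show ?thesis by (simp add: Y(2))
  qed
  have xS: "0 < fst (snd (Y S))"
    by (rule horizontal_height_pos[OF Y(1) _ S]) (use Y(2) m01 in auto)
  have "0 < fst (snd (X S)) \<and> fst (snd (Y S)) * fst (snd (X S)) / 2 \<le> snd (snd (X S))"
    using variation_pos_at_horizontal[OF S(1) continuous_on_subset[OF comp(3) sub],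
        where \<zeta> = "\<lambda>t. fst (snd (X t))" and \<mu> = "\<lambda>t. snd (snd (X t))" and r = "\<lambda>t. fst (Y t)"
          and x = "\<lambda>t. fst (snd (Y t))" and n = n and R = R]
      comp(7) lin(3) m01 mS drift marg[unfolded marg_def] nonneg S
      continuous_on_subset[OF cX sub]
    by (simp add: continuous_on_fst continuous_on_snd)
  then show ?thesis
    using horizontal_curve_increasing_of_variation[OF C J pR Y S mS xS m01 X X0] by blast
qed

text \<open>A negative value at time t would persist along trajectories of large finite slope c and
  their linearizations, since c / (1 + c) tends to 1 and both depend continuously on the start. That
  contradicts the finite-slope result.\<close>

lemma infinite_slope_variation_nonneg:
  assumes n: "n \<ge> 1" and R: "R \<noteq> 0" and pR: "profile_drift n R < 0"
    and Y: "trajectory n T Y" "Y 0 = (R, 0, 1)" and S: "0 < S" "S < T"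
    and mS: "snd (snd (Y S)) = 0"
    and m01: "\<And>t. t \<in> {0<..<S} \<Longrightarrow> 0 < snd (snd (Y t)) \<and> snd (snd (Y t)) < 1"
    and X: "\<And>t. t \<in> {0..T} \<Longrightarrow> (X has_vector_derivative profile_field_deriv n (Y t) (X t)) (at t within {0..T})"
    and X0: "X 0 = (1, 0, 0)"
    and ev: "\<forall>\<^sub>F c :: real in at_top. \<exists>g \<rho>. horizontal_portion n (ereal c) R g \<rho> \<and> (\<forall>r\<in>{R..\<rho>}. 0 \<le> profile_eta n R g r)"
    and t: "t \<in> {0..<S}"
  shows "0 \<le> fst (snd (X t)) \<and>
      0 \<le> variation_margin n R (fst (Y t)) (fst (snd (Y t))) (snd (snd (Y t))) (fst (snd (X t))) (snd (snd (X t)))"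
proof (rule ccontr)
  assume contra: "\<not> ?thesis"
  define \<Psi> where "\<Psi> p = min (fst (snd (snd p))) (variation_margin n R (fst (fst p)) (fst (snd (fst p))) (snd (snd (fst p)))
      (fst (snd (snd p))) (snd (snd (snd p))))" for p :: "(real \<times> real \<times> real) \<times> (real \<times> real \<times> real)"
  have c\<Psi>: "continuous_on {p. fst (fst p) \<noteq> 0} \<Psi>"
    unfolding \<Psi>_def variation_margin_def slope_speed_def profile_drift_def by (intro continuous_intros) auto
  have neg: "\<Psi> (Y t, X t) < 0" using contra by (auto simp: \<Psi>_def min_def)
  have Yt: "fst (Y t) \<noteq> 0" using trajectory_components(4)[OF Y(1), of t] t S by simp
  obtain \<epsilon> where \<epsilon>: "0 < \<epsilon>" "\<And>p. fst (fst p) \<noteq> 0 \<Longrightarrow> norm (p - (Y t, X t)) < \<epsilon> \<Longrightarrow> \<bar>\<Psi> p - \<Psi> (Y t, X t)\<bar> < - \<Psi> (Y t, X t)"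
    using c\<Psi> neg Yt unfolding continuous_on_iff dist_norm real_norm_def
    by (metis (mono_tags, lifting) fst_conv mem_Collect_eq neg_0_less_iff_less)
  have xS: "0 < fst (snd (Y S))"
    by (rule horizontal_height_pos[OF Y(1) _ S]) (use Y(2) m01 in auto)
  have start: "slope_speed n (fst (Y 0)) (fst (snd (Y 0))) (snd (snd (Y 0))) < 0"
    using pR by (simp add: Y(2) slope_speed_def)
  have m0: "0 < snd (snd (Y u))" if "u \<in> {0..<S}" for u
    using m01[of u] Y(2) that by (cases "u = 0") auto
  \<comment> \<open>With \<delta> < S - t the approximating curves become horizontal only after t,
    so the finite-slope result covers time t.\<close>
  have St: "0 < S - t" using t by simp
  obtain \<delta> d where \<delta>: "0 < \<delta>" "\<delta> < S - t" "\<delta> < S" "S + \<delta> \<le> T" "0 < d"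
    and horiz: "\<And>Z. trajectory n (S + \<delta>) Z \<Longrightarrow> (\<And>t. t \<in> {0..S + \<delta>} \<Longrightarrow> norm (Z t - Y t) < d) \<Longrightarrow>
       snd (snd (Z 0)) \<le> 1 \<Longrightarrow>
       (\<exists>s. S - \<delta> < s \<and> s < S + \<delta> \<and> snd (snd (Z s)) = 0 \<and> (\<forall>t\<in>{0..<s}. 0 < snd (snd (Z t)))) \<and>
       (\<forall>t\<in>{0<..S + \<delta>}. snd (snd (Z t)) < 1)"
    using nearby_horizontal[OF Y(1) S mS xS m0 _ start St, of thesis] m01 by blast
  define T' where "T' = S + \<delta>"
  have T': "0 \<le> T'" "T' \<le> T" using S \<delta> by (auto simp: T'_def)
  have Y': "trajectory n T' Y" by (rule ode_solution_subinterval[OF Y(1) T'(2)])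
  have X': "(X has_vector_derivative profile_field_deriv n (Y t) (X t)) (at t within {0..T'})" if "t \<in> {0..T'}" for t
    by (rule has_vector_derivative_within_subset[OF X]) (use that T' in auto)
  obtain d2 where d2: "0 < d2"
    "\<And>Z W t. trajectory n T' Z \<Longrightarrow> (\<And>t. t \<in> {0..T'} \<Longrightarrow> norm (Z t - Y t) < d2) \<Longrightarrow> W 0 = X 0 \<Longrightarrow>
       (\<And>t. t \<in> {0..T'} \<Longrightarrow> (W has_vector_derivative profile_field_deriv n (Z t) (W t)) (at t within {0..T'})) \<Longrightarrow>
       t \<in> {0..T'} \<Longrightarrow> norm (W t - X t) < \<epsilon> / 2"
    using profile.linearized_solution_continuous[OF T'(1) Y' X', of "\<epsilon> / 2" thesis] \<epsilon>(1) by force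
  have "0 < min (min d d2) (\<epsilon> / 2)" using \<delta>(5) d2(1) \<epsilon>(1) by simp
  then obtain d3 where d3: "0 < d3"
    "\<And>y. norm (y - Y 0) < d3 \<Longrightarrow> \<exists>Z. Z 0 = y \<and> trajectory n T' Z \<and>
       (\<forall>t\<in>{0..T'}. (Z has_vector_derivative profile_field n (Z t)) (at t within {0..T'}) \<and> norm (Z t - Y t) < min (min d d2) (\<epsilon> / 2))"
    using profile.nearby_solution[OF T'(1) Y', of "min (min d d2) (\<epsilon> / 2)" thesis] by blast
  have "((\<lambda>c::real. c / (1 + c)) \<longlongrightarrow> 1) at_top" by real_asymp
  then have "\<forall>\<^sub>F c in at_top. dist (c / (1 + c)) (1::real) < d3" by (rule tendstoD[OF _ d3(1)])
  then have "\<forall>\<^sub>F c in at_top. (0::real) < c \<and> dist (c / (1 + c)) 1 < d3 \<and>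
     (\<exists>g \<rho>. horizontal_portion n (ereal c) R g \<rho> \<and> (\<forall>r\<in>{R..\<rho>}. 0 \<le> profile_eta n R g r))"
    using ev eventually_gt_at_top[of 0] by eventually_elim auto
  then obtain c g \<rho> where c: "0 < c" "dist (c / (1 + c)) 1 < d3"
    and hp: "horizontal_portion n (ereal c) R g \<rho>" and eta: "\<And>r. r \<in> {R..\<rho>} \<Longrightarrow> 0 \<le> profile_eta n R g r"
    using eventually_happens'[OF trivial_limit_at_top_linorder] by blast
  have "norm ((R, 0, c / (1 + c)) - Y 0) < d3" using c(2) by (simp add: Y(2) dist_norm)
  from d3(2)[OF this] obtain Z where Z: "Z 0 = (R, 0, initial_slope (ereal c))" "trajectory n T' Z"
    "\<And>t. t \<in> {0..T'} \<Longrightarrow> norm (Z t - Y t) < min (min d d2) (\<epsilon> / 2)"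
    by (auto simp: initial_slope_def)
  obtain W where W: "W 0 = (1, 0, 0)"
    "\<And>t. t \<in> {0..T'} \<Longrightarrow> (W has_vector_derivative profile_field_deriv n (Z t) (W t)) (at t within {0..T'})"
    using profile.linearized_solution[OF T'(1) Z(2), of "(1, 0, 0)" thesis] by blast
  have "(\<exists>s. S - \<delta> < s \<and> s < S + \<delta> \<and> snd (snd (Z s)) = 0 \<and> (\<forall>t\<in>{0..<s}. 0 < snd (snd (Z t)))) \<and>
       (\<forall>t\<in>{0<..S + \<delta>}. snd (snd (Z t)) < 1)"
    by (rule horiz) (use Z c(1) in \<open>auto simp: T'_def initial_slope_def\<close>)
  then obtain s where s: "S - \<delta> < s" "s < T'" "snd (snd (Z s)) = 0" "\<And>t. t \<in> {0..<s} \<Longrightarrow> 0 < snd (snd (Z t))"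
    by (auto simp: T'_def)
  have ts: "t \<in> {0..s}" "t \<in> {0..T'}" "0 < s" "s \<le> T'" using t s \<delta> by auto
  have "0 \<le> \<Psi> (Z t, W t)"
    using finite_slope_variation_nonneg[OF n c(1) R pR hp eta Z(2) Z(1) ts(3,4) s(3) _ W(2) W(1) ts(1)] s(4)
    by (simp add: \<Psi>_def)
  moreover have "\<bar>\<Psi> (Z t, W t) - \<Psi> (Y t, X t)\<bar> < - \<Psi> (Y t, X t)"
  proof (rule \<epsilon>(2))
    show "fst (fst (Z t, W t)) \<noteq> 0" using trajectory_components(4)[OF Z(2) ts(2)] by simp
    have "norm (W t - X t) < \<epsilon> / 2" by (rule d2(2)[OF Z(2)]) (use Z(3) W X0 ts(2) in auto)
    moreover have "norm (Z t - Y t) < \<epsilon> / 2" using Z(3)[OF ts(2)] by simp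
    ultimately show "norm ((Z t, W t) - (Y t, X t)) < \<epsilon>"
      using norm_Pair_le[of "Z t - Y t" "W t - X t"] by simp
  qed
  ultimately show False by simp
qed

lemma finite_slope_monotone:
  assumes n: "n \<ge> 1" and c: "0 < c" and J: "open J" "R \<in> J" "0 \<notin> J" and pR: "profile_drift n R < 0"
    and hp: "horizontal_portion n (ereal c) R g \<rho>" and eta: "\<And>r. r \<in> {R..\<rho>} \<Longrightarrow> 0 \<le> profile_eta n R g r"
  shows "horizontal_curve_increasing_at n (ereal c) J R"
proof -
  have R: "R \<noteq> 0" using J by auto
  have C: "0 < ereal c" using c by simp
  obtain T S Y where S: "0 < S" "S < T" and Y: "trajectory n T Y" "Y 0 = (R, 0, initial_slope (ereal c))" and YS: "Y S = (\<rho>, g \<rho>, 0)"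
    and m01: "\<And>t. t \<in> {0<..<S} \<Longrightarrow> 0 < snd (snd (Y t)) \<and> snd (snd (Y t)) < 1"
    by (rule trajectory_of_portion[OF hp C R]) blast
  have T: "0 \<le> T" using S by simp
  obtain X where X: "X 0 = (1, 0, 0)"
    "\<And>t. t \<in> {0..T} \<Longrightarrow> (X has_vector_derivative profile_field_deriv n (Y t) (X t)) (at t within {0..T})"
    using profile.linearized_solution[OF T Y(1), of "(1, 0, 0)" thesis] by blast
  have mS: "snd (snd (Y S)) = 0" by (simp add: YS)
  show ?thesis
  proof (rule horizontal_curve_increasing_of_margin[OF n C J pR Y S mS m01 X(2) X(1)])
    fix t assume "t \<in> {0..<S}"
    then have t: "t \<in> {0..S}" by auto
    show "0 \<le> fst (snd (X t)) \<and>
      0 \<le> variation_margin n R (fst (Y t)) (fst (snd (Y t))) (snd (snd (Y t))) (fst (snd (X t))) (snd (snd (X t)))"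
      using finite_slope_variation_nonneg[OF n c R pR hp eta Y S(1) less_imp_le[OF S(2)] mS _ X(2) X(1) t] m01 by blast
  qed auto
qed

lemma infinite_slope_monotone:
  assumes n: "n \<ge> 1" and J: "open J" "R \<in> J" "0 \<notin> J" and pR: "profile_drift n R < 0"
    and hp: "horizontal_portion n \<infinity> R g \<rho>"
    and ev: "\<forall>\<^sub>F c :: real in at_top. \<exists>g \<rho>. horizontal_portion n (ereal c) R g \<rho> \<and> (\<forall>r\<in>{R..\<rho>}. 0 \<le> profile_eta n R g r)"
  shows "horizontal_curve_increasing_at n \<infinity> J R"
proof -
  have R: "R \<noteq> 0" using J by auto
  have C: "(0 :: ereal) < \<infinity>" by simp
  obtain T S Y where S: "0 < S" "S < T" and Y: "trajectory n T Y" "Y 0 = (R, 0, initial_slope \<infinity>)" and YS: "Y S = (\<rho>, g \<rho>, 0)"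
    and m01: "\<And>t. t \<in> {0<..<S} \<Longrightarrow> 0 < snd (snd (Y t)) \<and> snd (snd (Y t)) < 1"
    by (rule trajectory_of_portion[OF hp C R]) blast
  have T: "0 \<le> T" using S by simp
  obtain X where X: "X 0 = (1, 0, 0)"
    "\<And>t. t \<in> {0..T} \<Longrightarrow> (X has_vector_derivative profile_field_deriv n (Y t) (X t)) (at t within {0..T})"
    using profile.linearized_solution[OF T Y(1), of "(1, 0, 0)" thesis] by blast
  have mS: "snd (snd (Y S)) = 0" by (simp add: YS)
  have Y0: "Y 0 = (R, 0, 1)" using Y(2) by (simp add: initial_slope_def)
  show ?thesis
    by (rule horizontal_curve_increasing_of_margin[OF n C J pR Y S mS m01 X(2) X(1)
          infinite_slope_variation_nonneg[OF n R pR Y(1) Y0 S mS m01 X(2) X(1) ev]]) auto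
qed

text \<open>The drift vanishes exactly at plus and minus sqrt(2 (n - 1)) and is negative to the left
  of the negative zero and between 0 and the positive one.\<close>

lemma profile_drift_neg:
  assumes "n \<ge> 2" "R \<in> L1_range n \<union> L2_range n"
  shows "profile_drift n R < 0"
proof (cases "R \<in> L1_range n")
  case True
  then have R: "R < - sqrt (2 * real n)" by (simp add: L1_range_def)
  have "0 \<le> sqrt (2 * real n)" by simp
  then have "R < 0" using R by linarith
  have "(sqrt (2 * real n))\<^sup>2 < (- R)\<^sup>2" using R by (intro power_strict_mono) auto
  then have "2 * (real n - 1) < R\<^sup>2" by simp
  then show ?thesis using \<open>R < 0\<close> by (simp add: profile_drift_def field_simps power2_eq_square)
next
  case False
  then have R: "0 < R" "R < sqrt (2 * (real n - 1))" using assms(2) by (auto simp: L2_range_def)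
  have "R\<^sup>2 < (sqrt (2 * (real n - 1)))\<^sup>2" using R by (intro power_strict_mono) auto
  then have "R\<^sup>2 < 2 * (real n - 1)" using assms(1) by simp
  then show ?thesis using R(1) by (simp add: profile_drift_def field_simps power2_eq_square)
qed

lemma zero_notin_ranges: "0 \<notin> L1_range n" "0 \<notin> L2_range n"
  by (auto simp: L1_range_def L2_range_def not_less)

lemma open_ranges: "open (L1_range n)" "open (L2_range n)"
  by (auto simp: L1_range_def L2_range_def)

theorem theorem3:
  fixes n :: nat
  assumes "n \<ge> 2"
  shows
    "(\<forall>C::real. 0 < C \<longrightarrow> (\<forall>R \<in> L1_range n. \<forall>g \<rho>.
        horizontal_portion n (ereal C) R g \<rho> \<and> (\<forall>r\<in>{R..\<rho>}. 0 \<le> profile_eta n R g r)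
        \<longrightarrow> horizontal_curve_increasing_at n (ereal C) (L1_range n) R))
   \<and> (\<forall>C::real. 0 < C \<longrightarrow> (\<forall>R \<in> L2_range n. \<forall>g \<rho>.
        horizontal_portion n (ereal C) R g \<rho> \<and> (\<forall>r\<in>{R..\<rho>}. 0 \<le> profile_eta n R g r)
        \<longrightarrow> horizontal_curve_increasing_at n (ereal C) (L2_range n) R))
   \<and> (\<forall>J \<in> {L1_range n, L2_range n}. \<forall>R \<in> J.
        (\<exists>g \<rho>. horizontal_portion n \<infinity> R g \<rho>) \<and>
        (\<forall>\<^sub>F C::real in at_top. \<exists>g \<rho>.
           horizontal_portion n (ereal C) R g \<rho> \<and> (\<forall>r\<in>{R..\<rho>}. 0 < profile_eta n R g r))
        \<longrightarrow> horizontal_curve_increasing_at n \<infinity> J R)"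
proof -
  have n: "n \<ge> 1" using assms by simp
  have fin: "horizontal_curve_increasing_at n (ereal C) J R"
    if "J \<in> {L1_range n, L2_range n}" "0 < C" "R \<in> J" "horizontal_portion n (ereal C) R g \<rho>"
      "\<forall>r\<in>{R..\<rho>}. 0 \<le> profile_eta n R g r" for C J R g \<rho>
  proof (rule finite_slope_monotone[OF n that(2) _ that(3) _ _ that(4)])
    show "0 \<le> profile_eta n R g r" if "r \<in> {R..\<rho>}" for r using that \<open>\<forall>r\<in>{R..\<rho>}. 0 \<le> profile_eta n R g r\<close> by blast
  qed (use that(1,3) profile_drift_neg[OF assms, of R] zero_notin_ranges[of n] open_ranges[of n] in auto)
  have inf: "horizontal_curve_increasing_at n \<infinity> J R"
    if J: "J \<in> {L1_range n, L2_range n}" "R \<in> J" and hp: "horizontal_portion n \<infinity> R g \<rho>"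
      and ev: "\<forall>\<^sub>F C::real in at_top. \<exists>g \<rho>. horizontal_portion n (ereal C) R g \<rho> \<and> (\<forall>r\<in>{R..\<rho>}. 0 < profile_eta n R g r)"
    for J R g \<rho>
  proof (rule infinite_slope_monotone[OF n _ J(2) _ _ hp])
    show "\<forall>\<^sub>F C::real in at_top. \<exists>g \<rho>. horizontal_portion n (ereal C) R g \<rho> \<and> (\<forall>r\<in>{R..\<rho>}. 0 \<le> profile_eta n R g r)"
      using ev by eventually_elim (meson less_imp_le)
  qed (use J profile_drift_neg[OF assms, of R] zero_notin_ranges open_ranges in auto)
  show ?thesis
  proof (intro conjI allI impI ballI, goal_cases)
    case (1 C R g \<rho>)
    then show ?case using fin[of "L1_range n" C R g \<rho>] by simp
  next
    case (2 C R g \<rho>)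
    then show ?case using fin[of "L2_range n" C R g \<rho>] by simp
  next
    case (3 J R)
    then obtain g \<rho> where "horizontal_portion n \<infinity> R g \<rho>" by blast
    then show ?case using inf[of J R g \<rho>] 3 by simp
  qed
qed

end
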